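(* Let $m\ge1$ be an integer and let $\lambda$ be a random partition under the order $m$ minimal multicritical measure $\mathbb{P}^{\mathrm{a},m}_\theta$, with edge coefficients $b,\tilde b$. As $\theta\to\infty$, the rescaled profile $\psi_{\lambda,\theta}$ converges in probability, in the supremum norm on $\mathbb{R}$, to $$\Omega^{\mathrm{a},m}(x)=\begin{cases}x+2\tilde b-\frac2\pi\int_{-\tilde b}^x\arccos\left[1-\frac12\binom{2m}{m-1}^{\frac1m}(b-v)^{\frac1m}\right]dv, & x\in[-\tilde b,b],\\ |x|, & x>b\text{ or }x<-\tilde b.\end{cases}$$
   Context: A partition is a finite non-increasing sequence $\lambda=(\lambda_1\ge\lambda_2\ge\cdots\ge\lambda_{\ell(\lambda)})$ of positive integers, with $\lambda_i:=0$ for $i>\ell(\lambda)$. Its conjugate $\lambda'$ has parts $\lambda'_j=\#\{i:\lambda_i\ge j\}$. For a sequence $t=(t_1,t_2,\ldots)$ (Miwa times), define $h_k[t]$ by $\sum_k h_k[t]z^k=\exp\left[\sum_{r\ge1}t_rz^r\right]$ (so $h_k[t]=0$ for $k<0$, $h_0[t]=1$), and the Schur function $s_\lambda[t]=\det_{1\le i,j\le\ell(\lambda)}h_{\lambda_i-i+j}[t]$. Order $m$ minimal multicritical measure, $\theta>0$: the probability measure on partitions $\mathbb{P}^{\mathrm{a},m}_\theta(\lambda)=e^{-\theta^2\sum_r r\gamma_r^2}s_\lambda[\theta\gamma]^2$ with $\theta\gamma=(\theta\gamma_1,\theta\gamma_2,\ldots)$ and $$\gamma_r=\frac{(-1)^{r+1}}{r}\binom{2m}{m+r}\Big/\binom{2m}{m-1}\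 \ (r=1,\ldots,m),\qquad\gamma_r=0\ \ (r>m).$$ Its edge coefficients are $$b=2\sum_{r\ge1}r\gamma_r=\frac{m+1}m,\qquad\tilde b=2\sum_{r\ge1}(-1)^{r+1}r\gamma_r=4^m\binom{2m}{m-1}^{-1}-\frac{m+1}m.$$ Rescaled profile: $\psi_{\lambda,\theta}:\mathbb{R}\to\mathbb{R}$ is the continuous piecewise linear curve (slopes $\pm1$) tracing the upper boundary of the Young diagram of $\lambda$ in the Russian convention, rescaled by $1/\theta$: it is obtained from the boundary relations $v=\frac1\theta\lambda_{\lfloor\theta u\rfloor+1}$ $(u>0)$, $u=\frac1\theta\lambda'_{\lfloor\theta v\rfloor+1}$ $(v>0)$ by setting $x=v-u$, $\psi_{\lambda,\theta}(x)=u+v$. Equivalently, with $S(\lambda)=\{\lambda_i-i+\frac12:i\ge1\}$, $\psi_{\lambda,\theta}(x)=x+\frac2\theta\#\{k\in S(\lambda):k>\theta x\}$ for $x\in\frac1\theta\mathbb{Z}$, with linear interpolation in between. Convergence in probability in the supremum norm means $\sup_{x\in\mathbb{R}}|\psi_{\lambda,\theta}(x)-\Omega^{\mathrm{a},m}(x)|\to0$ in probability. *)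

theory Defs
  imports
    "HOL-Probability.Probability"
    "HOL-Computational_Algebra.Formal_Power_Series"
    "Jordan_Normal_Form.Determinant"
begin

definition is_partition :: "nat list \<Rightarrow> bool" where
  "is_partition p \<longleftrightarrow> sorted_wrt (\<ge>) p \<and> (\<forall>k\<in>set p. 0 < k)"

text \<open>Parts are indexed from 1: \<open>part p i\<close> is $\lambda_i$, with $\lambda_i = 0$ beyond the length.\<close>

definition part :: "nat list \<Rightarrow> nat \<Rightarrow> nat" where
  "part p i = (if 1 \<le> i \<and> i \<le> length p then p ! (i - 1) else 0)"

text \<open>Miwa times are sequences $t_1, t_2, \ldots$; the value of \<open>t\<close> at 0 is ignored.
  The composition below is the formal power series $\exp[\sum_{r \ge 1} t_r z^r]$.\<close>

definition miwa_h :: "(nat \<Rightarrow> real) \<Rightarrow> int \<Rightarrow> real" where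
  "miwa_h t k =
     (if k < 0 then 0
      else fps_nth (fps_compose (fps_exp 1) (Abs_fps (\<lambda>r. if r = 0 then 0 else t r))) (nat k))"

text \<open>Matrix indices \<open>i\<close>, \<open>j\<close> start from 0, hence the shift in \<open>part\<close>;
  the difference \<open>j - i\<close> is unaffected.\<close>

definition schur :: "(nat \<Rightarrow> real) \<Rightarrow> nat list \<Rightarrow> real" where
  "schur t p = Determinant.det
     (mat (length p) (length p) (\<lambda>(i, j). miwa_h t (int (part p (i + 1)) - int i + int j)))"

definition mc_gamma :: "nat \<Rightarrow> nat \<Rightarrow> real" where
  "mc_gamma m r =
     (if 1 \<le> r \<and> r \<le> m
      then (-1) ^ (r + 1) / real r * real ((2 * m) choose (m + r)) / real ((2 * m) choose (m - 1))
      else 0)"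

text \<open>Sums over all $r \ge 1$ reduce to $r = 1, \ldots, m$ because $\gamma_r = 0$ for $r > m$.\<close>

definition multicritical_measure :: "nat \<Rightarrow> real \<Rightarrow> nat list measure" where
  "multicritical_measure m \<theta> =
     density (count_space {p. is_partition p})
       (\<lambda>p. ennreal (exp (- \<theta>\<^sup>2 * (\<Sum>r=1..m. real r * (mc_gamma m r)\<^sup>2))
                      * (schur (\<lambda>r. \<theta> * mc_gamma m r) p)\<^sup>2))"

definition right_edge :: "nat \<Rightarrow> real" where
  "right_edge m = 2 * (\<Sum>r=1..m. real r * mc_gamma m r)"

definition left_edge :: "nat \<Rightarrow> real" where
  "left_edge m = 2 * (\<Sum>r=1..m. (-1) ^ (r + 1) * real r * mc_gamma m r)"

definition point_config :: "nat list \<Rightarrow> real set" where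
  "point_config p = {real (part p i) - real i + 1/2 | i. 1 \<le> i}"

text \<open>Value of the rescaled profile at the lattice point $n / \theta$.\<close>

definition profile_node :: "real \<Rightarrow> nat list \<Rightarrow> int \<Rightarrow> real" where
  "profile_node \<theta> p n =
     real_of_int n / \<theta> + 2 / \<theta> * real (card {k \<in> point_config p. k > real_of_int n})"

definition profile :: "real \<Rightarrow> nat list \<Rightarrow> real \<Rightarrow> real" where
  "profile \<theta> p x =
     (1 - frac (\<theta> * x)) * profile_node \<theta> p \<lfloor>\<theta> * x\<rfloor>
       + frac (\<theta> * x) * profile_node \<theta> p (\<lfloor>\<theta> * x\<rfloor> + 1)"

definition limit_profile :: "nat \<Rightarrow> real \<Rightarrow> real" where
  "limit_profile m x =
     (if x \<in> {- left_edge m .. right_edge m}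
      then x + 2 * left_edge m
           - 2 / pi * integral {- left_edge m .. x}
               (\<lambda>v. arccos (1 - 1/2 * root m (real ((2 * m) choose (m - 1)))
                                    * root m (right_edge m - v)))
      else \<bar>x\<bar>)"

end

(*
Let t be the Miwa times theta * gamma and h the sequence of the h_k[t].

By Jacobi-Trudi and Andreief's identity, squaring Schur functions gives a biorthogonal ensemble: the
shifted parts of partitions with at most N rows are a determinantal process whose kernel is the
orthogonal projection onto the span of N translates of h. Hence the number of particles in a window
has variance at most its mean. As N grows the projections increase to the projection onto the span
of the translates of u, the Fourier coefficients of exp(sum_r t_r (z^r - z^-r)). These translates
are orthonormal since that function is unimodular, so the mean number of particles above n tends to
sum_d u_d^2 max(0, d - n). The normalisation is the Cauchy identity, obtained by computing with
alternants that adding r-ribbons is adjoint to differentiating in t_r.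

If X has law u_d^2, its characteristic function is the mean of exp(i theta (S(phi + s/theta) - S(phi)))
over the circle, where exp(i theta S) is the unimodular function. By Levy's theorem X/theta converges
to S'(phi) with phi uniform, where S'(phi) = b - (2 - 2 cos phi)^m / binomial(2m, m-1). With a second
moment bound this gives the limit of the mean, and Chebyshev's inequality the law of large numbers at
each point. Both profiles are 1-Lipschitz, and outside [-b~, b] the difference between the rescaled
profile and |x| is monotone, so finitely many points suffice.
*)
theory Submission
  imports Defs "HOL-Complex_Analysis.Complex_Analysis"
begin

section \<open>Complete symmetric functions in the Miwa times\<close>


text \<open>The numbers \<open>mc_gamma m r\<close> alternate in sign, so \<open>miwa_h\<close> and
  \<open>schur\<close> may take negative values. Positivity enters through squares: every
  probability estimate is carried out on finite sums of squared Schur functions, bounded by the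
  Cauchy identity. Andreief's identity needs a finite matrix size and a finite range of positions,
  hence two cutoffs: N rows and a box. Removing the box produces the Gram matrix of translates of
  \<open>h\<close> in l2 of the integers. Removing N is explicit rather than by density: in the
  system of translates of \<open>u\<close> the function h(_ + j) has coordinates h(n - j), a
  unitriangular Toeplitz matrix whose inverse has the coefficients \<open>g\<close> of the
  reciprocal series. The variance is at most the mean, and the mean is of order \<theta>, so a
  deviation of order \<theta> has probability O(1/\<theta>). The arccosine arises because the
  derivative in x of the mean of the positive part of S'(\<phi>) - x is minus the probability that
  S'(\<phi>) exceeds x. As S' decreases on [0, pi], this probability is its inverse function at x
  divided by pi.\<close>

definition miwa_fps :: "(nat \<Rightarrow> real) \<Rightarrow> real fps" where
  "miwa_fps t = fps_compose (fps_exp 1) (Abs_fps (\<lambda>r. if r = 0 then 0 else t r))"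

lemma miwa_h_neg [simp]: "k < 0 \<Longrightarrow> miwa_h t k = 0"
  by (simp add: miwa_h_def)

lemma miwa_h_of_nat: "miwa_h t (int n) = fps_nth (miwa_fps t) n"
  by (simp add: miwa_h_def miwa_fps_def)

lemma miwa_h_0 [simp]: "miwa_h t 0 = 1"
  using miwa_h_of_nat[of t 0] by (simp add: miwa_fps_def)

lemma fps_deriv_miwa_fps:
  "fps_deriv (miwa_fps t) = Abs_fps (\<lambda>r. real (Suc r) * t (Suc r)) * miwa_fps t"
proof -
  have "fps_deriv (Abs_fps (\<lambda>r. if r = 0 then 0 else t r)) = Abs_fps (\<lambda>r. real (Suc r) * t (Suc r))"
    by (simp add: fps_eq_iff)
  then show ?thesis
    unfolding miwa_fps_def by (subst fps_compose_deriv) (simp_all add: mult.commute)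
qed

text \<open>Newton's identity: the coefficients of H' = T' H for the generating series H = exp T. It
  extends to all integers because both sides vanish for k <= 0.\<close>

lemma miwa_h_recurrence:
  assumes "\<And>r. r > m \<Longrightarrow> t r = 0"
  shows "of_int k * miwa_h t k = (\<Sum>r=1..m. real r * t r * miwa_h t (k - int r))"
proof (cases "k \<le> 0")
  case True
  then show ?thesis by (cases "k = 0") auto
next
  case False
  then obtain n where k: "k = int (Suc n)"
    by (metis not_le zero_less_imp_eq_int Suc_pred)
  have "of_int k * miwa_h t k = fps_nth (fps_deriv (miwa_fps t)) n"
    by (simp add: k miwa_h_of_nat del: of_nat_Suc)
  also have "\<dots> = (\<Sum>i=0..n. real (Suc i) * t (Suc i) * miwa_h t (int (n - i)))"
    by (simp add: fps_deriv_miwa_fps fps_mult_nth miwa_h_of_nat del: of_nat_diff)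
  also have "\<dots> = (\<Sum>r=1..Suc n. real r * t r * miwa_h t (k - int r))"
    by (rule sum.reindex_bij_witness[of _ "\<lambda>r. r - 1" Suc]) (auto simp: k of_nat_diff algebra_simps)
  also have "\<dots> = (\<Sum>r=1..m. real r * t r * miwa_h t (k - int r))"
  proof (rule sum.mono_neutral_cong)
    fix r assume "r \<in> {1..m} - {1..Suc n}"
    then show "real r * t r * miwa_h t (k - int r) = 0" by (auto simp: k)
  next
    fix r assume "r \<in> {1..Suc n} - {1..m}"
    then show "real r * t r * miwa_h t (k - int r) = 0" using assms[of r] by auto
  qed auto
  finally show ?thesis .
qed

text \<open>The product has derivative zero and constant term 1. Negating the times therefore
  inverts the generating series; the new coefficients are, up to the sign (-1)^k, the elementary
  symmetric functions.\<close>

lemma miwa_fps_uminus: "miwa_fps (\<lambda>r. - t r) * miwa_fps t = 1"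
proof -
  let ?P = "miwa_fps (\<lambda>r. - t r) * miwa_fps t"
  have neg: "Abs_fps (\<lambda>r. real (Suc r) * - t (Suc r)) = - Abs_fps (\<lambda>r. real (Suc r) * t (Suc r))"
    by (simp add: fps_eq_iff)
  have "fps_deriv ?P = 0"
    unfolding fps_deriv_mult fps_deriv_miwa_fps neg by (simp add: algebra_simps)
  then have "?P = fps_const (fps_nth ?P 0)" by (simp only: fps_deriv_eq_0_iff)
  moreover have "fps_nth ?P 0 = 1" by (simp add: miwa_fps_def)
  ultimately show ?thesis by simp
qed

lemma miwa_h_convolution_uminus:
  "(\<Sum>i=0..n. miwa_h (\<lambda>r. - t r) (int i) * miwa_h t (int (n - i))) = (if n = 0 then 1 else 0)"
  using arg_cong[OF miwa_fps_uminus[of t], of "\<lambda>f. fps_nth f n"]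
  by (simp add: fps_mult_nth miwa_h_of_nat del: of_nat_diff)

text \<open>The coefficient of z^(r-1) in H'/H, with 1/H written as the series at the negated times.
  It evaluates the trace that appears in \<open>alternant_shift_up\<close>.\<close>

lemma miwa_h_log_derivative:
  "(\<Sum>d=0..r. real (r - d) * miwa_h (\<lambda>r. - t r) (int d) * miwa_h t (int (r - d))) = real r * t r"
proof (cases r)
  case (Suc n)
  have "miwa_fps (\<lambda>r. - t r) * fps_deriv (miwa_fps t)
      = Abs_fps (\<lambda>r. real (Suc r) * t (Suc r)) * (miwa_fps (\<lambda>r. - t r) * miwa_fps t)"
    by (simp add: fps_deriv_miwa_fps algebra_simps)
  then have "miwa_fps (\<lambda>r. - t r) * fps_deriv (miwa_fps t) = Abs_fps (\<lambda>r. real (Suc r) * t (Suc r))"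
    by (simp add: miwa_fps_uminus)
  from arg_cong[OF this, of "\<lambda>f. fps_nth f n"]
  have "(\<Sum>d=0..n. miwa_h (\<lambda>r. - t r) (int d) * (real (Suc (n - d)) * miwa_h t (int (Suc (n - d))))) = real r * t r"
    by (simp add: fps_mult_nth miwa_h_of_nat Suc del: of_nat_Suc)
  also have "(\<Sum>d=0..n. miwa_h (\<lambda>r. - t r) (int d) * (real (Suc (n - d)) * miwa_h t (int (Suc (n - d)))))
     = (\<Sum>d=0..n. real (r - d) * miwa_h (\<lambda>r. - t r) (int d) * miwa_h t (int (r - d)))"
    by (rule sum.cong) (auto simp: Suc Suc_diff_le algebra_simps)
  finally show ?thesis by (simp add: Suc)
qed simp

text \<open>The exponential of a polynomial is entire, so its Taylor series converges everywhere.
  Its Taylor coefficients are the formal ones because both series solve the same first-order linear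
  differential equation, which determines coefficients recursively.\<close>

lemma miwa_h_has_sum_complex:
  fixes z :: complex
  assumes supp: "\<And>r. r > m \<Longrightarrow> t r = 0"
  shows "(\<lambda>n. of_real (miwa_h t (int n)) * z ^ n) sums exp (\<Sum>r=1..m. of_real (t r) * z ^ r)"
    and "summable (\<lambda>n. norm (of_real (miwa_h t (int n)) * z ^ n))"
proof -
  define f where "f z = exp (\<Sum>r=1..m. of_real (t r) * z ^ r)" for z :: complex
  define F where "F = fps_expansion f 0"
  have hol: "f holomorphic_on A" for A unfolding f_def by (intro holomorphic_intros)
  have F: "f has_fps_expansion F"
    unfolding F_def by (rule has_fps_expansion_fps_expansion[of UNIV]) (auto intro: hol)
  have dF: "deriv f has_fps_expansion fps_deriv F" by (rule has_fps_expansion_deriv[OF F])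
  define Q :: "complex fps" where "Q = (\<Sum>r=1..m. fps_const (of_real (real r * t r)) * fps_X ^ (r - 1))"
  have Q: "(\<lambda>z. \<Sum>r=1..m. of_real (real r * t r) * z ^ (r - 1)) has_fps_expansion Q"
    unfolding Q_def by (intro fps_expansion_intros)
  have "deriv f = (\<lambda>z. (\<Sum>r=1..m. of_real (real r * t r) * z ^ (r - 1)) * f z)"
  proof
    fix z
    have "(f has_field_derivative (\<Sum>r=1..m. of_real (real r * t r) * z ^ (r - 1)) * f z) (at z)"
      unfolding f_def by (auto intro!: derivative_eq_intros sum.cong simp: algebra_simps)
    then show "deriv f z = (\<Sum>r=1..m. of_real (real r * t r) * z ^ (r - 1)) * f z"
      by (rule DERIV_imp_deriv)
  qed
  then have "deriv f has_fps_expansion Q * F"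
    using has_fps_expansion_mult[OF Q F] by simp
  with dF have eq: "fps_deriv F = Q * F" by (rule fps_expansion_unique_complex)
  have Qn: "fps_nth Q i = of_real (real (Suc i) * t (Suc i))" for i
  proof -
    have "fps_nth Q i = (\<Sum>r=1..m. if r = Suc i then of_real (real r * t r) else 0)"
      unfolding Q_def fps_sum_nth by (rule sum.cong) (auto simp: fps_X_power_nth)
    also have "\<dots> = of_real (real (Suc i) * t (Suc i))"
      using supp[of "Suc i"] by (subst sum.delta) auto
    finally show ?thesis .
  qed
  have coeff: "fps_nth F n = of_real (miwa_h t (int n))" for n
  proof (induction n rule: less_induct)
    case (less n)
    show ?case
    proof (cases n)
      case 0
      have "fps_nth F 0 = f 0" using has_fps_expansion_imp_0_eq_fps_nth_0[OF F] by simp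
      then show ?thesis by (simp add: 0 f_def power_0_left)
    next
      case (Suc k)
      have "of_nat (Suc k) * fps_nth F (Suc k) = fps_nth (Q * F) k"
        using arg_cong[OF eq, of "\<lambda>f. fps_nth f k"] by simp
      also have "\<dots> = of_real (fps_nth (Abs_fps (\<lambda>r. real (Suc r) * t (Suc r)) * miwa_fps t) k)"
        by (simp add: fps_mult_nth Qn less Suc miwa_h_of_nat del: of_nat_diff)
      also have "\<dots> = of_real (real (Suc k) * miwa_h t (int (Suc k)))"
        unfolding fps_deriv_miwa_fps[symmetric] by (simp add: miwa_h_of_nat del: of_nat_Suc)
      finally show ?thesis unfolding Suc of_real_mult of_real_of_nat_eq
        using of_nat_neq_0 mult_left_cancel by blast
    qed
  qed
  have rad: "fps_conv_radius F \<ge> ereal (norm z + 1)"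
  proof -
    have "f holomorphic_on eball 0 \<infinity>" by (rule hol)
    from conv_radius_fps_expansion[OF this] show ?thesis unfolding F_def by simp
  qed
  show "(\<lambda>n. of_real (miwa_h t (int n)) * z ^ n) sums exp (\<Sum>r=1..m. of_real (t r) * z ^ r)"
  proof -
    have "(\<lambda>n. fps_nth F n * z ^ n) sums f z"
      by (rule has_fps_expansion_imp_sums_complex[OF F hol[of "eball 0 \<infinity>"]]) auto
    then show ?thesis by (simp add: coeff f_def)
  qed
  show "summable (\<lambda>n. norm (of_real (miwa_h t (int n)) * z ^ n))"
  proof -
    have "summable (\<lambda>n. norm (fps_nth F n * z ^ n))"
      by (rule abs_summable_in_conv_radius)
         (use rad in \<open>simp add: fps_conv_radius_def less_le_trans[OF _ rad[unfolded fps_conv_radius_def]]\<close>)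
    then show ?thesis by (simp add: coeff)
  qed
qed

lemma has_sum_int_nonneg_iff:
  fixes f :: "int \<Rightarrow> 'a :: {comm_monoid_add, topological_space}"
  assumes "\<And>k. k < 0 \<Longrightarrow> f k = 0"
  shows "(f has_sum S) UNIV \<longleftrightarrow> ((\<lambda>n. f (int n)) has_sum S) UNIV"
proof -
  have "(f has_sum S) UNIV \<longleftrightarrow> (f has_sum S) (range int)"
  proof (rule has_sum_cong_neutral)
    fix x :: int assume "x \<in> UNIV - range int"
    then have "x < 0" by (metis DiffD2 nonneg_int_cases not_le rangeI)
    then show "f x = 0" by (rule assms)
  qed auto
  also have "\<dots> \<longleftrightarrow> ((\<lambda>n. f (int n)) has_sum S) UNIV"
    by (subst has_sum_reindex) (auto simp: inj_on_def o_def)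
  finally show ?thesis .
qed

lemma abs_summable_miwa_h:
  assumes "\<And>r. r > m \<Longrightarrow> t r = 0"
  shows "(\<lambda>k. \<bar>miwa_h t k\<bar>) summable_on UNIV"
proof -
  have "summable (\<lambda>n. \<bar>miwa_h t (int n)\<bar>)"
    using miwa_h_has_sum_complex(2)[of m t 1] assms by simp
  then have "(\<lambda>n. \<bar>miwa_h t (int n)\<bar>) summable_on UNIV"
    by (intro norm_summable_imp_summable_on) simp
  then obtain S where "((\<lambda>n. \<bar>miwa_h t (int n)\<bar>) has_sum S) UNIV"
    by (auto simp: summable_on_def)
  then have "((\<lambda>k. \<bar>miwa_h t k\<bar>) has_sum S) UNIV"
    by (subst has_sum_int_nonneg_iff) auto
  then show ?thesis by (auto simp: summable_on_def)
qed

lemma miwa_h_generating_function: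
  assumes "\<And>r. r > m \<Longrightarrow> t r = 0"
  shows "((\<lambda>k. of_real (miwa_h t k) * cis (of_int k * \<phi>)) has_sum
            exp (\<Sum>r=1..m. of_real (t r) * cis (of_nat r * \<phi>))) UNIV"
proof -
  have "((\<lambda>n. of_real (miwa_h t (int n)) * cis \<phi> ^ n) has_sum
            exp (\<Sum>r=1..m. of_real (t r) * cis \<phi> ^ r)) UNIV"
    by (rule norm_summable_imp_has_sum[OF miwa_h_has_sum_complex(2,1)[OF assms]])
  then show ?thesis
    by (subst has_sum_int_nonneg_iff) (simp_all add: Complex.DeMoivre)
qed

text \<open>Partial sums of the generating function at z = 1. Applied to the times r t_r^2 it bounds
  the total weight of all partitions.\<close>

lemma sum_miwa_h_le_exp:
  assumes "\<And>r. r > m \<Longrightarrow> t r = 0" and "\<And>n. 0 \<le> miwa_h t (int n)"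
  shows "(\<Sum>n\<le>N. miwa_h t (int n)) \<le> exp (\<Sum>r=1..m. t r)"
proof -
  have "(\<lambda>n. complex_of_real (miwa_h t (int n))) sums of_real (exp (\<Sum>r=1..m. t r))"
    using miwa_h_has_sum_complex(1)[of m t 1] assms(1) by (simp flip: exp_of_real of_real_sum)
  then have s: "(\<lambda>n. miwa_h t (int n)) sums exp (\<Sum>r=1..m. t r)"
    by (simp only: sums_of_real_iff)
  show ?thesis
    using sum_le_suminf[OF sums_summable[OF s], of "{..N}"] assms(2) sums_unique[OF s] by simp
qed

section \<open>Determinants of matrices given by functions\<close>


text \<open>Determinants of functions on indices: rows and columns are replaced by function update,
  and only the values below N matter.\<close>

definition fdet :: "nat \<Rightarrow> (nat \<Rightarrow> nat \<Rightarrow> real) \<Rightarrow> real" where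
  "fdet N M = Determinant.det (mat N N (\<lambda>(i, j). M i j))"

definition fcof :: "nat \<Rightarrow> (nat \<Rightarrow> nat \<Rightarrow> real) \<Rightarrow> nat \<Rightarrow> nat \<Rightarrow> real" where
  "fcof N M i j = cofactor (mat N N (\<lambda>(i, j). M i j)) i j"

lemma fdet_leibniz:
  "fdet N M = (\<Sum>p | p permutes {..<N}. of_int (sign p) * (\<Prod>i<N. M i (p i)))"
proof -
  have "fdet N M = (\<Sum>p | p permutes {0..<N}. signof p * (\<Prod>i = 0..<N. mat N N (\<lambda>(i, j). M i j) $$ (i, p i)))"
    unfolding fdet_def by (rule det_def') simp
  also have "\<dots> = (\<Sum>p | p permutes {0..<N}. of_int (sign p) * (\<Prod>i = 0..<N. M i (p i)))"
  proof (rule sum.cong[OF refl])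
    fix p assume "p \<in> {p. p permutes {0..<N}}"
    then have "p permutes {0..<N}" by simp
    then have "i < N \<Longrightarrow> p i < N" for i using permutes_in_image by fastforce
    then show "signof p * (\<Prod>i = 0..<N. mat N N (\<lambda>(i, j). M i j) $$ (i, p i)) = of_int (sign p) * (\<Prod>i = 0..<N. M i (p i))"
      by simp
  qed
  finally show ?thesis by (simp add: atLeast0LessThan)
qed

lemma fdet_cong:
  assumes "\<And>i j. i < N \<Longrightarrow> j < N \<Longrightarrow> M i j = M' i j"
  shows "fdet N M = fdet N M'"
  unfolding fdet_def by (rule arg_cong[where f = Determinant.det]) (use assms in auto)

text \<open>The cofactors along row i do not see row i, so those of the original \<open>M\<close>
  serve for every replacement row. Sums of determinants that differ in one row thus become linear
  expressions in fixed cofactors.\<close>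

lemma fdet_row_expand:
  assumes "i < N"
  shows "fdet N (M(i := v)) = (\<Sum>j<N. v j * fcof N M i j)"
proof -
  let ?A = "mat N N (\<lambda>(a, b). (M(i := v)) a b)"
  have "fdet N (M(i := v)) = (\<Sum>j<N. ?A $$ (i, j) * cofactor ?A i j)"
    unfolding fdet_def by (rule laplace_expansion_row) (use assms in auto)
  also have "\<dots> = (\<Sum>j<N. v j * fcof N M i j)"
  proof (rule sum.cong[OF refl])
    fix j assume j: "j \<in> {..<N}"
    have "mat_delete ?A i j = mat_delete (mat N N (\<lambda>(i, j). M i j)) i j"
      unfolding mat_delete_def by (rule eq_matI) (use assms j in auto)
    then show "?A $$ (i, j) * cofactor ?A i j = v j * fcof N M i j"
      using assms j by (simp add: fcof_def cofactor_def)
  qed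
  finally show ?thesis .
qed

lemma fdet_col_expand:
  assumes "j < N"
  shows "fdet N (\<lambda>a. (M a)(j := v a)) = (\<Sum>i<N. v i * fcof N M i j)"
proof -
  let ?A = "mat N N (\<lambda>(a, b). ((M a)(j := v a)) b)"
  have "fdet N (\<lambda>a. (M a)(j := v a)) = (\<Sum>i<N. ?A $$ (i, j) * cofactor ?A i j)"
    unfolding fdet_def by (rule laplace_expansion_column) (use assms in auto)
  also have "\<dots> = (\<Sum>i<N. v i * fcof N M i j)"
  proof (rule sum.cong[OF refl])
    fix i assume i: "i \<in> {..<N}"
    have "mat_delete ?A i j = mat_delete (mat N N (\<lambda>(i, j). M i j)) i j"
      unfolding mat_delete_def by (rule eq_matI) (use assms i in auto)
    then show "?A $$ (i, j) * cofactor ?A i j = v i * fcof N M i j"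
      using assms i by (simp add: fcof_def cofactor_def)
  qed
  finally show ?thesis .
qed

lemma fdet_row: "i < N \<Longrightarrow> fdet N M = (\<Sum>j<N. M i j * fcof N M i j)"
  using fdet_row_expand[of i N M "M i"] by simp

lemma fdet_col: "j < N \<Longrightarrow> fdet N M = (\<Sum>i<N. M i j * fcof N M i j)"
  using fdet_col_expand[of j N M "\<lambda>a. M a j"] by simp

lemma fdet_zero_row: "i < N \<Longrightarrow> (\<And>j. j < N \<Longrightarrow> M i j = 0) \<Longrightarrow> fdet N M = 0"
  by (simp add: fdet_row)

lemma fdet_permute_rows:
  assumes "p permutes {..<N}"
  shows "fdet N (\<lambda>i. M (p i)) = of_int (sign p) * fdet N M"
proof -
  have p: "i < N \<Longrightarrow> p i < N" for i using assms permutes_in_image by fastforce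
  have "fdet N (\<lambda>i. M (p i)) = Determinant.det (mat N N (\<lambda>(i, j). mat N N (\<lambda>(i, j). M i j) $$ (p i, j)))"
    unfolding fdet_def by (rule arg_cong[where f = Determinant.det]) (use p in auto)
  also have "\<dots> = of_int (sign p) * fdet N M"
    unfolding fdet_def by (rule det_permute_rows) (use assms in \<open>auto simp: atLeast0LessThan\<close>)
  finally show ?thesis .
qed

lemma fdet_identical_columns:
  assumes "i < N" "j < N" "i \<noteq> j" "\<And>a. a < N \<Longrightarrow> M a i = M a j"
  shows "fdet N M = 0"
  unfolding fdet_def
  by (rule det_identical_columns[of _ N i j]) (use assms in \<open>auto intro!: eq_vecI\<close>)

lemma fdet_identical_rows:
  assumes "i < N" "j < N" "i \<noteq> j" "\<And>a. a < N \<Longrightarrow> M i a = M j a"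
  shows "fdet N M = 0"
  unfolding fdet_def
  by (rule det_identical_rows[of _ N i j]) (use assms in \<open>auto intro!: eq_vecI\<close>)

lemma fdet_mult: "fdet N (\<lambda>i j. \<Sum>k<N. M i k * M' k j) = fdet N M * fdet N M'"
proof -
  have "mat N N (\<lambda>(i, j). M i j) * mat N N (\<lambda>(i, j). M' i j) = mat N N (\<lambda>(i, j). \<Sum>k<N. M i k * M' k j)"
    by (rule eq_matI) (auto simp: scalar_prod_def atLeast0LessThan)
  then show ?thesis unfolding fdet_def by (metis det_mult mat_carrier)
qed

text \<open>No permutation maps the rows \<open>R\<close> into the smaller set of columns
  \<open>C\<close>, so every term of the Leibniz formula contains a zero entry.\<close>

lemma fdet_pigeonhole:
  assumes R: "R \<subseteq> {..<N}" and C: "finite C" "card C < card R"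
    and zero: "\<And>i j. i \<in> R \<Longrightarrow> j < N \<Longrightarrow> j \<notin> C \<Longrightarrow> M i j = 0"
  shows "fdet N M = 0"
  unfolding fdet_leibniz
proof (rule sum.neutral, rule ballI)
  fix p assume "p \<in> {p. p permutes {..<N}}"
  then have p: "p permutes {..<N}" by simp
  have "\<not> p ` R \<subseteq> C"
    using C card_mono[of C "p ` R"] card_image[OF inj_on_subset[OF permutes_inj[OF p]], of R] by auto
  then obtain i where i: "i \<in> R" "p i \<notin> C" by auto
  then have "i < N" "p i < N" using R p permutes_in_image[OF p] by auto
  then have "(\<Prod>i<N. M i (p i)) = 0" using zero i by (auto intro!: bexI[of _ i])
  then show "of_int (sign p) * (\<Prod>i<N. M i (p i)) = 0" by simp
qed

lemma fdet_Suc_last_row_unit: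
  assumes "\<And>j. j < N \<Longrightarrow> M N j = 0" "M N N = 1"
  shows "fdet (Suc N) M = fdet N M"
proof -
  have "fdet (Suc N) M = (\<Sum>j<Suc N. M N j * fcof (Suc N) M N j)" by (rule fdet_row) simp
  also have "\<dots> = fcof (Suc N) M N N" using assms by simp
  also have "mat_delete (mat (Suc N) (Suc N) (\<lambda>(i, j). M i j)) N N = mat N N (\<lambda>(i, j). M i j)"
    unfolding mat_delete_def by (rule eq_matI) auto
  then have "fcof (Suc N) M N N = fdet N M"
    by (simp add: fcof_def cofactor_def fdet_def flip: mult_2)
  finally show ?thesis .
qed

lemma tendsto_fdet:
  assumes "\<And>i j. i < N \<Longrightarrow> j < N \<Longrightarrow> ((\<lambda>x. M x i j) \<longlongrightarrow> M' i j) F"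
  shows "((\<lambda>x. fdet N (M x)) \<longlongrightarrow> fdet N M') F"
  unfolding fdet_leibniz
proof (intro tendsto_sum tendsto_mult tendsto_const tendsto_prod)
  fix p i assume "p \<in> {p. p permutes {..<N}}" "i \<in> {..<N}"
  then have "i < N" "p i < N" using permutes_in_image[of p "{..<N}" i] by auto
  then show "((\<lambda>x. M x i (p i)) \<longlongrightarrow> M' i (p i)) F" by (rule assms)
qed

text \<open>The determinants whose squares are the unnormalised weights of the particle positions
  \<open>x i = part p (i + 1) - i\<close>.\<close>

definition alternant :: "(nat \<Rightarrow> real) \<Rightarrow> nat \<Rightarrow> (nat \<Rightarrow> int) \<Rightarrow> real" where
  "alternant t N x = fdet N (\<lambda>i j. miwa_h t (x i + int j))"

text \<open>Euler's identity for a function of weighted degree: differentiating in t_r lowers one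
  entry by r, which on Schur functions removes an r-ribbon. The factor on the left is the size of
  the partition.\<close>

lemma alternant_euler:
  assumes "\<And>r. r > m \<Longrightarrow> t r = 0"
  shows "of_int ((\<Sum>i<N. x i) + (\<Sum>j<N. int j)) * alternant t N x
     = (\<Sum>r=1..m. real r * t r * (\<Sum>i<N. alternant t N (x(i := x i - int r))))"
proof -
  define M where "M = (\<lambda>i j. miwa_h t (x i + int j))"
  define c where "c = fcof N M"
  have shift: "alternant t N (x(i := x i - int r)) = (\<Sum>j<N. miwa_h t (x i + int j - int r) * c i j)" if "i < N" for i r
  proof -
    have "alternant t N (x(i := x i - int r)) = fdet N (M(i := \<lambda>j. miwa_h t (x i + int j - int r)))"
      unfolding alternant_def by (rule fdet_cong) (auto simp: M_def algebra_simps)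
    then show ?thesis using fdet_row_expand[OF that] by (simp add: c_def)
  qed
  have "(\<Sum>r=1..m. real r * t r * (\<Sum>i<N. alternant t N (x(i := x i - int r))))
      = (\<Sum>r=1..m. real r * t r * (\<Sum>i<N. \<Sum>j<N. miwa_h t (x i + int j - int r) * c i j))"
    by (simp add: shift)
  also have "\<dots> = (\<Sum>r=1..m. \<Sum>i<N. \<Sum>j<N. real r * t r * miwa_h t (x i + int j - int r) * c i j)"
    by (simp add: sum_distrib_left mult.assoc)
  also have "\<dots> = (\<Sum>i<N. \<Sum>j<N. \<Sum>r=1..m. real r * t r * miwa_h t (x i + int j - int r) * c i j)"
    by (subst sum.swap, rule sum.cong[OF refl], rule sum.swap)
  also have "\<dots> = (\<Sum>i<N. \<Sum>j<N. of_int (x i + int j) * M i j * c i j)"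
    by (simp add: sum_distrib_right[symmetric] M_def miwa_h_recurrence[OF assms] del: of_int_add)
  \<comment> \<open>The weight x i + j is split: the part x i is constant along rows and is resummed
    by row expansions, the part j is constant along columns and is resummed by column
    expansions.\<close>
  also have "\<dots> = (\<Sum>i<N. \<Sum>j<N. of_int (x i) * (M i j * c i j)) + (\<Sum>j<N. \<Sum>i<N. real j * (M i j * c i j))"
    by (simp add: sum.swap[of "\<lambda>j i. real j * (M i j * c i j)"] sum.distrib[symmetric] algebra_simps)
  also have "\<dots> = (\<Sum>i<N. of_int (x i) * (\<Sum>j<N. M i j * c i j)) + (\<Sum>j<N. real j * (\<Sum>i<N. M i j * c i j))"
    by (simp add: sum_distrib_left)
  also have "\<dots> = (\<Sum>i<N. of_int (x i) * alternant t N x) + (\<Sum>j<N. real j * alternant t N x)"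
    using fdet_row[of _ N M] fdet_col[of _ N M] by (simp add: alternant_def M_def[symmetric] c_def)
  also have "\<dots> = of_int ((\<Sum>i<N. x i) + (\<Sum>j<N. int j)) * alternant t N x"
    by (simp add: sum_distrib_right distrib_right)
  finally show ?thesis by simp
qed

text \<open>Multiplication by the power sum r t_r adds an r-ribbon in all ways. The hypothesis
  \<open>bottom\<close> says that the last r rows are empty, which is the room needed for a ribbon
  to stay within N rows.\<close>

lemma alternant_shift_up:
  assumes r: "1 \<le> r" "r \<le> N"
    and bottom: "\<And>b. N - r \<le> b \<Longrightarrow> b < N \<Longrightarrow> \<exists>i<N. x i = - int b"
  shows "(\<Sum>i<N. alternant t N (x(i := x i + int r))) = real r * t r * alternant t N x"
proof -
  define M where "M = (\<lambda>i j. miwa_h t (x i + int j))"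
  define c where "c = fcof N M"
  define g where "g = (\<lambda>d. miwa_h (\<lambda>r. - t r) (int d))"
  \<comment> \<open>Coefficients expressing the column with index j + r through the columns m' on
    the bottom rows. There the entries h(m' - b) form a unitriangular Toeplitz matrix, which
    \<open>g\<close> inverts.\<close>
  define \<alpha> where "\<alpha> j m' = (\<Sum>b=m'..<N. g (b - m') * miwa_h t (int j + int r - int b))" for j m'
  have shift: "alternant t N (x(i := x i + int r)) = (\<Sum>j<N. miwa_h t (x i + int j + int r) * c i j)" if "i < N" for i
  proof -
    have "alternant t N (x(i := x i + int r)) = fdet N (M(i := \<lambda>j. miwa_h t (x i + int j + int r)))"
      unfolding alternant_def by (rule fdet_cong) (auto simp: M_def algebra_simps)
    then show ?thesis using fdet_row_expand[OF that] by (simp add: c_def)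
  qed
  define D where "D j = (\<Sum>i<N. miwa_h t (x i + int j + int r) * c i j)" for j
  have "(\<Sum>i<N. alternant t N (x(i := x i + int r))) = (\<Sum>j<N. D j)"
    unfolding D_def by (subst sum.swap) (simp add: shift)
  also have "\<dots> = (\<Sum>j=N-r..<N. D j)"
  \<comment> \<open>Shifting column j by r duplicates column j + r as long as the latter is still
    inside the matrix, so only the last r columns contribute.\<close>
  proof (rule sum.mono_neutral_right)
    show "\<forall>j\<in>{..<N} - {N - r..<N}. D j = 0"
    proof
      fix j assume "j \<in> {..<N} - {N - r..<N}"
      then have j: "j < N" "j + r < N" using r by auto
      have "D j = fdet N (\<lambda>a. (M a)(j := miwa_h t (x a + int j + int r)))"
        unfolding D_def c_def by (rule fdet_col_expand[symmetric]) (use j in auto)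
      also have "\<dots> = 0"
        by (rule fdet_identical_columns[of j N "j + r"]) (use j r in \<open>auto simp: M_def algebra_simps\<close>)
      finally show "D j = 0" .
    qed
  qed auto
  also have "\<dots> = (\<Sum>j=N-r..<N. \<alpha> j j * alternant t N x)"
  proof (rule sum.cong[OF refl])
    fix j assume "j \<in> {N-r..<N}"
    then have j: "N - r \<le> j" "j < N" by auto
    \<comment> \<open>What is left of the shifted column after subtracting the combination of the
      last r columns. It vanishes on every bottom row.\<close>
    define v where "v i = miwa_h t (x i + int j + int r) - (\<Sum>m'=N-r..<N. \<alpha> j m' * M i m')" for i
    have vb: "v i = 0" if "x i = - int b" "N - r \<le> b" "b < N" for i b
    proof -
      have "(\<Sum>m'=N-r..<N. \<alpha> j m' * M i m') = (\<Sum>m'=b..<N. \<alpha> j m' * M i m')"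
        by (rule sum.mono_neutral_right) (use that in \<open>auto simp: M_def\<close>)
      also have "\<dots> = (\<Sum>m'=b..<N. \<Sum>b'=m'..<N. g (b' - m') * miwa_h t (int j + int r - int b') * M i m')"
        by (simp add: \<alpha>_def sum_distrib_right)
      also have "\<dots> = (\<Sum>b'=b..<N. \<Sum>m'=b..b'. g (b' - m') * miwa_h t (int j + int r - int b') * M i m')"
        unfolding sum.Sigma[OF finite_atLeastLessThan ballI[OF finite_atLeastLessThan]]
          sum.Sigma[OF finite_atLeastLessThan ballI[OF finite_atLeastAtMost]]
        by (rule sum.reindex_bij_witness[of _ "\<lambda>(u, w). (w, u)" "\<lambda>(u, w). (w, u)"]) auto
      also have "\<dots> = (\<Sum>b'=b..<N. miwa_h t (int j + int r - int b') * (if b' = b then 1 else 0))"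
      proof (rule sum.cong[OF refl])
        fix b' assume b': "b' \<in> {b..<N}"
        have "(\<Sum>m'=b..b'. g (b' - m') * M i m') = (\<Sum>d=0..b'-b. g d * miwa_h t (int ((b' - b) - d)))"
          by (rule sum.reindex_bij_witness[of _ "\<lambda>d. b' - d" "\<lambda>m'. b' - m'"])
            (use b' that in \<open>auto simp: M_def of_nat_diff algebra_simps\<close>)
        also have "\<dots> = (if b' = b then 1 else 0)"
          unfolding g_def miwa_h_convolution_uminus using b' by auto
        finally have "(\<Sum>m'=b..b'. g (b' - m') * M i m') = (if b' = b then 1 else 0)" .
        moreover have "(\<Sum>m'=b..b'. g (b' - m') * miwa_h t (int j + int r - int b') * M i m')
           = miwa_h t (int j + int r - int b') * (\<Sum>m'=b..b'. g (b' - m') * M i m')"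
          by (simp add: sum_distrib_left mult_ac)
        ultimately show "(\<Sum>m'=b..b'. g (b' - m') * miwa_h t (int j + int r - int b') * M i m')
           = miwa_h t (int j + int r - int b') * (if b' = b then 1 else 0)" by simp
      qed
      also have "\<dots> = miwa_h t (int j + int r - int b)"
        using that by (simp add: if_distrib[where f = "(*) _"] sum.delta cong: if_cong)
      finally show ?thesis by (simp add: v_def that algebra_simps)
    qed
    \<comment> \<open>A bottom row has zeros in all columns before N - r, and now also in column j.
      At least r such rows are supported on r - 1 columns.\<close>
    have "fdet N (\<lambda>a. (M a)(j := v a)) = 0"
    proof (rule fdet_pigeonhole[where R = "{i\<in>{..<N}. \<exists>b. N - r \<le> b \<and> b < N \<and> x i = - int b}" and C = "{N-r..<N} - {j}"])
      let ?R = "{i\<in>{..<N}. \<exists>b. N - r \<le> b \<and> b < N \<and> x i = - int b}"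
      have "(\<lambda>b. - int b) ` {N-r..<N} \<subseteq> x ` ?R"
        using bottom by (auto simp: image_iff) metis
      then have "card ((\<lambda>b. - int b) ` {N-r..<N}) \<le> card (x ` ?R)" by (intro card_mono) auto
      also have "card (x ` ?R) \<le> card ?R" by (rule card_image_le) auto
      finally have "r \<le> card ?R" using r by (simp add: card_image inj_on_def)
      then show "card ({N-r..<N} - {j}) < card ?R" using j r by (simp add: card_Diff_singleton)
    next
      fix i j' assume i: "i \<in> {i \<in> {..<N}. \<exists>b\<ge>N - r. b < N \<and> x i = - int b}" and j': "j' < N" "j' \<notin> {N - r..<N} - {j}"
      then obtain b where b: "N - r \<le> b" "b < N" "x i = - int b" by auto
      show "((M i)(j := v i)) j' = 0"
        using vb[OF b(3,1,2)] j' b by (auto simp: M_def)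
    qed auto
    then have v0: "(\<Sum>i<N. v i * c i j) = 0"
      using fdet_col_expand[OF j(2), of M v] by (simp add: c_def)
    have cols: "(\<Sum>i<N. M i m' * c i j) = (if m' = j then alternant t N x else 0)" if "m' < N" for m'
    proof (cases "m' = j")
      case True
      then show ?thesis using fdet_col[OF j(2), of M] by (simp add: c_def alternant_def M_def)
    next
      case False
      have "(\<Sum>i<N. M i m' * c i j) = fdet N (\<lambda>a. (M a)(j := M a m'))"
        unfolding c_def by (rule fdet_col_expand[symmetric, OF j(2)])
      also have "\<dots> = 0" by (rule fdet_identical_columns[of j N m']) (use False that j in auto)
      finally show ?thesis using False by simp
    qed
    have "D j = (\<Sum>i<N. (v i + (\<Sum>m'=N-r..<N. \<alpha> j m' * M i m')) * c i j)"
      by (simp add: D_def v_def)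
    also have "\<dots> = (\<Sum>i<N. \<Sum>m'=N-r..<N. \<alpha> j m' * (M i m' * c i j))"
      using v0 by (simp add: distrib_right sum.distrib sum_distrib_right mult.assoc)
    also have "\<dots> = (\<Sum>m'=N-r..<N. \<alpha> j m' * (\<Sum>i<N. M i m' * c i j))"
      by (subst sum.swap) (simp add: sum_distrib_left)
    also have "\<dots> = (\<Sum>m'=N-r..<N. if m' = j then \<alpha> j j * alternant t N x else 0)"
      by (rule sum.cong) (auto simp: cols)
    also have "\<dots> = \<alpha> j j * alternant t N x" using j by simp
    finally show "D j = \<alpha> j j * alternant t N x" .
  qed
  also have "\<dots> = (\<Sum>j=N-r..<N. \<alpha> j j) * alternant t N x" by (simp add: sum_distrib_right)
  \<comment> \<open>Along the diagonal the coefficient depends only on the offset d = b - j, and a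
    given d occurs for exactly r - d values of j.\<close>
  also have "(\<Sum>j=N-r..<N. \<alpha> j j) = real r * t r"
  proof -
    have "(\<Sum>j=N-r..<N. \<alpha> j j) = (\<Sum>j=N-r..<N. \<Sum>d\<in>{0..<N-j}. g d * miwa_h t (int (r - d)))"
      unfolding \<alpha>_def
    proof (rule sum.cong[OF refl])
      fix j assume "j \<in> {N-r..<N}"
      then show "(\<Sum>b=j..<N. g (b - j) * miwa_h t (int j + int r - int b)) = (\<Sum>d\<in>{0..<N-j}. g d * miwa_h t (int (r - d)))"
        by (intro sum.reindex_bij_witness[of _ "\<lambda>d. j + d" "\<lambda>b. b - j"]) (use r in \<open>auto simp: of_nat_diff algebra_simps\<close>)
    qed
    also have "\<dots> = (\<Sum>d\<in>{0..<r}. \<Sum>j\<in>{N-r..<N-d}. g d * miwa_h t (int (r - d)))"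
      unfolding sum.Sigma[OF finite_atLeastLessThan ballI[OF finite_atLeastLessThan]]
      by (rule sum.reindex_bij_witness[of _ "\<lambda>(u, w). (w, u)" "\<lambda>(u, w). (w, u)"]) (use r in auto)
    also have "\<dots> = (\<Sum>d\<in>{0..<r}. real (r - d) * g d * miwa_h t (int (r - d)))"
      by (rule sum.cong) (use r in \<open>auto simp: of_nat_diff\<close>)
    also have "\<dots> = (\<Sum>d=0..r. real (r - d) * g d * miwa_h t (int (r - d)))"
      by (rule sum.mono_neutral_left) auto
    also have "\<dots> = real r * t r" unfolding g_def by (rule miwa_h_log_derivative)
    finally show ?thesis .
  qed
  finally show ?thesis .
qed

section \<open>Partitions and alternants\<close>


text \<open>\<open>restrict\<close> makes the tuple extensional, so that it is an element of the
  finite \<open>PiE\<close> sets over which Andreief's identity sums.\<close>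

definition positions :: "nat \<Rightarrow> nat list \<Rightarrow> nat \<Rightarrow> int" where
  "positions N p = restrict (\<lambda>i. int (part p (i + 1)) - int i) {..<N}"

lemma part_antimono:
  assumes "is_partition p" "1 \<le> i" "i \<le> j"
  shows "part p j \<le> part p i"
proof (cases "j \<le> length p \<and> i < j")
  case True
  then have "p ! (j - 1) \<le> p ! (i - 1)"
    using assms unfolding is_partition_def by (auto simp: sorted_wrt_iff_nth_less)
  then show ?thesis using True assms by (simp add: part_def)
next
  case False
  then show ?thesis using assms by (cases "i = j") (auto simp: part_def)
qed

lemma part_beyond: "length p < i \<Longrightarrow> part p i = 0"
  by (simp add: part_def)

lemma part_pos_iff:
  assumes "is_partition p" "1 \<le> i"
  shows "0 < part p i \<longleftrightarrow> i \<le> length p"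
  using assms by (auto simp: part_def is_partition_def)

lemma partition_eqI:
  assumes "is_partition p" "is_partition q" "length p \<le> N" "length q \<le> N"
    and eq: "\<And>i. 1 \<le> i \<Longrightarrow> i \<le> N \<Longrightarrow> part p i = part q i"
  shows "p = q"
proof -
  have eq': "part p i = part q i" if "1 \<le> i" for i
    using eq[OF that] assms by (cases "i \<le> N") (auto simp: part_beyond)
  have "i \<le> length p \<longleftrightarrow> i \<le> length q" if "1 \<le> i" for i
    using part_pos_iff[OF assms(1) that] part_pos_iff[OF assms(2) that] eq'[OF that] by simp
  from this[of "length p"] this[of "length q"] have len: "length p = length q"
    by (cases "length p"; cases "length q") auto
  show ?thesis
  proof (rule nth_equalityI[OF len])
    fix i assume "i < length p"
    then show "p ! i = q ! i" using eq'[of "i + 1"] len by (simp add: part_def)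
  qed
qed

lemma positions_strict_antimono:
  assumes "is_partition p" "i < j" "j < N"
  shows "positions N p j < positions N p i"
proof -
  have "part p (j + 1) \<le> part p (i + 1)"
    using assms by (intro part_antimono) auto
  then show ?thesis using assms(2,3) by (simp add: positions_def)
qed

lemma inj_on_positions:
  assumes "is_partition p"
  shows "inj_on (positions N p) {..<N}"
proof (rule inj_onI)
  fix i j assume "i \<in> {..<N}" "j \<in> {..<N}" "positions N p i = positions N p j"
  then show "i = j"
    using positions_strict_antimono[OF assms, of i j N] positions_strict_antimono[OF assms, of j i N]
    by (cases i j rule: linorder_cases) auto
qed

lemma positions_lower_bound: "i < N \<Longrightarrow> - int N < positions N p i"
  by (simp add: positions_def)

text \<open>An empty row N has entries h(j - N), that is 0 before the diagonal and 1 on it, so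
  padding with empty rows leaves the determinant unchanged. All partitions with at most N rows can
  thus share one matrix size.\<close>

lemma schur_eq_alternant:
  assumes "length p \<le> N"
  shows "schur t p = alternant t N (positions N p)"
proof -
  have "schur t p = fdet N (\<lambda>i j. miwa_h t (int (part p (i + 1)) - int i + int j))"
    using assms
  proof (induction N rule: dec_induct)
    case base
    show ?case by (simp add: schur_def fdet_def)
  next
    case (step n)
    have "part p (Suc n) = 0" using step by (simp add: part_beyond)
    then show ?case
      using step by (subst fdet_Suc_last_row_unit) auto
  qed
  also have "\<dots> = alternant t N (positions N p)"
    unfolding alternant_def by (rule fdet_cong) (simp add: positions_def)
  finally show ?thesis .
qed

lemma alternant_permute:
  assumes "p permutes {..<N}"
  shows "(alternant t N (x \<circ> p))\<^sup>2 = (alternant t N x)\<^sup>2"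
proof -
  have "alternant t N (x \<circ> p) = of_int (sign p) * alternant t N x"
    unfolding alternant_def using fdet_permute_rows[OF assms, of "\<lambda>i j. miwa_h t (x i + int j)"] by simp
  then show ?thesis by (simp add: power_mult_distrib sign_def)
qed

lemma alternant_not_inj:
  assumes "\<not> inj_on x {..<N}"
  shows "alternant t N x = 0"
proof -
  obtain i j where "i < N" "j < N" "i \<noteq> j" "x i = x j" using assms by (auto simp: inj_on_def)
  then show ?thesis unfolding alternant_def by (intro fdet_identical_rows[of i N j]) auto
qed

lemma alternant_too_low:
  assumes "i < N" "x i \<le> - int N"
  shows "alternant t N x = 0"
  unfolding alternant_def by (rule fdet_zero_row[OF assms(1)]) (use assms in simp)

text \<open>Both functions enumerate the same finite set in decreasing order.\<close>

lemma strict_antimono_on_image_unique: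
  fixes f g :: "nat \<Rightarrow> int"
  assumes "\<And>i j. i < j \<Longrightarrow> j < N \<Longrightarrow> f j < f i" "\<And>i j. i < j \<Longrightarrow> j < N \<Longrightarrow> g j < g i"
    and "f ` {..<N} = g ` {..<N}" "i < N"
  shows "f i = g i"
proof -
  have *: "rev (map h [0..<N]) = sorted_list_of_set (h ` {..<N})" if h: "\<And>i j. i < j \<Longrightarrow> j < N \<Longrightarrow> h j < h i" for h :: "nat \<Rightarrow> int"
  proof -
    have "inj_on h {..<N}"
    proof (rule inj_onI)
      fix i j assume "i \<in> {..<N}" "j \<in> {..<N}" "h i = h j"
      then show "i = j" using h[of i j] h[of j i] by (cases i j rule: linorder_cases) auto
    qed
    then have "distinct (rev (map h [0..<N]))" by (simp add: distinct_map atLeast0LessThan)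
    moreover have "sorted (rev (map h [0..<N]))"
      unfolding sorted_wrt_rev sorted_wrt_iff_nth_less by (auto simp: rev_nth intro!: less_imp_le h)
    ultimately have "sorted_list_of_set (set (rev (map h [0..<N]))) = rev (map h [0..<N])"
      by (intro sorted_list_of_set.idem_if_sorted_distinct)
    then show ?thesis by (simp add: atLeast0LessThan)
  qed
  have "rev (map f [0..<N]) = rev (map g [0..<N])" using *[OF assms(1)] *[OF assms(2)] assms(3) by simp
  then have "map f [0..<N] = map g [0..<N]" by simp
  then have "map f [0..<N] ! i = map g [0..<N] ! i" by (simp only:)
  then show ?thesis using assms(4) by simp
qed

text \<open>The parts are recovered as y i + i. They decrease weakly since y decreases strictly, and
  they are nonnegative since the last one is; the zero parts form a final segment that is cut
  off.\<close>

lemma positions_surj: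
  assumes dec: "\<And>i j. i < j \<Longrightarrow> j < N \<Longrightarrow> y j < y i" and low: "\<And>i. i < N \<Longrightarrow> - int N < y i"
  obtains p where "is_partition p" "length p \<le> N" "\<And>i. i < N \<Longrightarrow> positions N p i = y i"
proof -
  define a where "a i = nat (y i + int i)" for i
  have anti: "y j + int j \<le> y i + int i" if "i \<le> j" "j < N" for i j
    using that(1,2)
  proof (induction j rule: dec_induct)
    case (step n)
    then show ?case using dec[of n "Suc n"] by simp
  qed simp
  have pos: "0 \<le> y i + int i" if "i < N" for i
  proof -
    have "i \<le> N - 1" using that by simp
    then show ?thesis using anti[of i "N - 1"] low[of "N - 1"] that by (simp add: of_nat_diff)
  qed
  have anti_a: "a j \<le> a i" if "i \<le> j" "j < N" for i j using anti[OF that] by (simp add: a_def)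
  define n where "n = card {i. i < N \<and> 0 < a i}"
  have set: "{i. i < N \<and> 0 < a i} = {..<n}"
  proof -
    have "\<exists>n. {i. i < N \<and> 0 < a i} = {..<n}"
    proof (cases "\<exists>i<N. a i = 0")
      case True
      define k where "k = (LEAST i. i < N \<and> a i = 0)"
      have k: "k < N" "a k = 0" using True LeastI_ex[of "\<lambda>i. i < N \<and> a i = 0"] by (auto simp: k_def)
      have "0 < a i" if "i < k" for i using not_less_Least[of i "\<lambda>i. i < N \<and> a i = 0"] that k by (auto simp: k_def)
      moreover have "i < k" if "i < N" "0 < a i" for i using anti_a[of k i] that k by (cases "i < k") auto
      ultimately have "{i. i < N \<and> 0 < a i} = {..<k}" using k by auto
      then show ?thesis by blast
    qed (auto intro!: exI[of _ N])
    then obtain n' where n': "{i. i < N \<and> 0 < a i} = {..<n'}" by blast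
    show ?thesis unfolding n_def n' by simp
  qed
  define p where "p = map a [0..<n]"
  have nN: "n \<le> N"
  proof (cases n)
    case (Suc k)
    then have "k \<in> {i. i < N \<and> 0 < a i}" unfolding set by simp
    then show ?thesis using Suc by simp
  qed simp
  have mem: "i < N \<and> 0 < a i \<longleftrightarrow> i < n" for i
    using eqset_imp_iff[OF set, of i] by simp
  have apos: "0 < a i" if "i < n" for i using mem[of i] that by simp
  have azero: "a i = 0" if "n \<le> i" "i < N" for i using mem[of i] that by simp
  have "is_partition p"
    unfolding is_partition_def
  proof
    show "sorted_wrt (\<ge>) p"
      unfolding sorted_wrt_iff_nth_less
    proof (intro allI impI)
      fix i j assume "i < j" "j < length p"
      then show "p ! j \<le> p ! i" using anti_a[of i j] nN by (simp add: p_def)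
    qed
    show "\<forall>k\<in>set p. 0 < k" using apos by (auto simp: p_def)
  qed
  moreover have "length p \<le> N" using nN by (simp add: p_def)
  moreover have "positions N p i = y i" if i: "i < N" for i
  proof -
    have "part p (i + 1) = a i"
      using azero[OF _ i] by (cases "i < n") (simp_all add: part_def p_def)
    then show ?thesis using i pos[OF i] by (simp add: positions_def a_def)
  qed
  ultimately show thesis using that[of p] by blast
qed

text \<open>A tuple of nonzero weight has distinct entries above - N, so it is a rearrangement of
  exactly one position vector, by exactly one permutation. This is where the factor N! comes
  from.\<close>

lemma sum_tuples_eq_sum_partitions:
  fixes F :: "(nat \<Rightarrow> int) \<Rightarrow> real"
  assumes fin: "finite D" and ext: "D \<subseteq> extensional {..<N}"
    and Dperm: "\<And>x q. x \<in> D \<Longrightarrow> q permutes {..<N} \<Longrightarrow> x \<circ> q \<in> D"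
    and Fperm: "\<And>x q. q permutes {..<N} \<Longrightarrow> F (x \<circ> q) = F x"
    and Finj: "\<And>x. \<not> inj_on x {..<N} \<Longrightarrow> F x = 0"
    and Flow: "\<And>x i. i < N \<Longrightarrow> x i \<le> - int N \<Longrightarrow> F x = 0"
  shows "finite {p. is_partition p \<and> length p \<le> N \<and> positions N p \<in> D}" (is "finite ?L")
    and "(\<Sum>x\<in>D. F x) = fact N * (\<Sum>p | is_partition p \<and> length p \<le> N \<and> positions N p \<in> D. F (positions N p))"
proof -
  define E where "E = {x\<in>D. inj_on x {..<N} \<and> (\<forall>i<N. - int N < x i)}"
  define P where "P = {q :: nat \<Rightarrow> nat. q permutes {..<N}}"
  define h where "h = (\<lambda>(p, q). positions N p \<circ> (q :: nat \<Rightarrow> nat))"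
  note inj_pos = inj_on_positions[of _ N]
  have bij: "bij_betw h (?L \<times> P) E"
    unfolding bij_betw_def
  proof
    show "inj_on h (?L \<times> P)"
    proof (rule inj_onI, clarify)
      fix p q p' q'
      assume A: "q \<in> P" "q' \<in> P" "is_partition p" "is_partition p'" "length p \<le> N" "length p' \<le> N"
        and h: "h (p, q) = h (p', q')"
      then have q: "q ` {..<N} = {..<N}" "q' ` {..<N} = {..<N}" by (auto simp: P_def permutes_image)
      have eq: "positions N p (q i) = positions N p' (q' i)" for i using fun_cong[OF h, of i] by (simp add: h_def)
      have "positions N p ` {..<N} = positions N p' ` {..<N}"
        by (subst (1) q(1)[symmetric], subst (2) q(2)[symmetric]) (auto simp: image_image eq)
      then have pp: "positions N p i = positions N p' i" if "i < N" for i
        using strict_antimono_on_image_unique[of N "positions N p" "positions N p'" i]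
          positions_strict_antimono A that by blast
      have "p = p'"
      proof (rule partition_eqI[of _ _ N])
        fix i assume "1 \<le> i" "i \<le> N"
        then show "part p i = part p' i" using pp[of "i - 1"] by (simp add: positions_def)
      qed (use A in auto)
      moreover have "q = q'"
      proof
        fix i show "q i = q' i"
        proof (cases "i < N")
          case True
          then have "q i < N" "q' i < N" using q by auto
          then show ?thesis using eq[of i] inj_pos[OF A(3)] \<open>p = p'\<close> by (simp add: inj_on_def)
        next
          case False
          then show ?thesis using A by (simp add: P_def permutes_def)
        qed
      qed
      ultimately show "p = p' \<and> q = q'" by simp
    qed
    show "h ` (?L \<times> P) = E"
    proof (intro equalityI subsetI)
      fix x assume "x \<in> h ` (?L \<times> P)"
      then obtain p q where pq: "is_partition p" "positions N p \<in> D" "q permutes {..<N}" "x = positions N p \<circ> q"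
        by (auto simp: h_def P_def)
      have "inj_on x {..<N}" unfolding pq(4)
        by (rule comp_inj_on) (use inj_pos[OF pq(1)] pq(3) in \<open>auto simp: permutes_image intro: inj_on_subset[OF permutes_inj]\<close>)
      moreover have "- int N < x i" if "i < N" for i
        using positions_lower_bound[of "q i" N p] permutes_in_image[OF pq(3), of i] that by (simp add: pq(4))
      ultimately show "x \<in> E" unfolding E_def using Dperm[OF pq(2,3)] pq(4) by auto
    next
      fix x assume x: "x \<in> E"
      define l where "l = rev (sorted_list_of_set (x ` {..<N}))"
      have inj: "inj_on x {..<N}" using x by (simp add: E_def)
      have len: "length l = N" by (simp add: l_def card_image[OF inj])
      have setl: "set l = x ` {..<N}" by (simp add: l_def)
      have "sorted_wrt (>) l" unfolding l_def sorted_wrt_rev by simp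
      then have dec: "l ! j < l ! i" if "i < j" "j < N" for i j
        using that len by (auto simp: sorted_wrt_iff_nth_less)
      have low: "- int N < l ! i" if "i < N" for i
      proof -
        have "l ! i \<in> x ` {..<N}" using that len setl nth_mem by blast
        then show ?thesis using x by (auto simp: E_def)
      qed
      obtain p where p: "is_partition p" "length p \<le> N" "\<And>i. i < N \<Longrightarrow> positions N p i = l ! i"
        using positions_surj[of N "\<lambda>i. l ! i", OF dec low] by blast
      have pimg: "positions N p ` {..<N} = x ` {..<N}"
        unfolding setl[symmetric] set_conv_nth len using p(3) by (auto simp: image_iff)
      have b1: "bij_betw (positions N p) {..<N} (x ` {..<N})"
        unfolding bij_betw_def using inj_pos[OF p(1)] pimg by simp
      have b2: "bij_betw x {..<N} (x ` {..<N})" using inj by (simp add: bij_betw_def)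
      \<comment> \<open>The permutation that sends each index to the rank of its entry in decreasing
        order; outside the first N indices it must be the identity.\<close>
      define q where "q i = (if i < N then inv_into {..<N} (positions N p) (x i) else i)" for i
      have "bij_betw (inv_into {..<N} (positions N p) \<circ> x) {..<N} {..<N}"
        by (rule bij_betw_trans[OF b2 bij_betw_inv_into[OF b1]])
      then have "bij_betw q {..<N} {..<N}" by (rule bij_betw_cong[THEN iffD1, rotated]) (simp add: q_def)
      then have q: "q permutes {..<N}" by (rule bij_imp_permutes) (simp add: q_def)
      have posx: "positions N p \<circ> q = x"
      proof
        fix i show "(positions N p \<circ> q) i = x i"
        proof (cases "i < N")
          case True
          then have "x i \<in> positions N p ` {..<N}" using pimg by auto
          then show ?thesis using True by (simp add: q_def f_inv_into_f)
        next
          case False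
          then show ?thesis using x ext by (auto simp: q_def positions_def E_def extensional_def)
        qed
      qed
      have "positions N p = x \<circ> inv_into UNIV q"
        by (simp add: posx[symmetric] comp_assoc permutes_inv_o[OF q])
      then have "positions N p \<in> D" using Dperm[OF _ permutes_inv[OF q], of x] x by (simp add: E_def)
      then show "x \<in> h ` (?L \<times> P)" using p q posx by (auto simp: h_def P_def image_iff intro!: bexI[of _ "(p, q)"])
    qed
  qed
  have finE: "finite E" using fin by (simp add: E_def)
  have "id \<in> P" by (simp add: P_def permutes_id)
  then show finL: "finite ?L"
    using bij_betw_finite[OF bij] finE finite_cartesian_productD1 by blast
  have "(\<Sum>x\<in>D. F x) = (\<Sum>x\<in>E. F x)"
    by (rule sum.mono_neutral_right[OF fin]) (auto simp: E_def intro: Finj Flow simp: not_less)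
  also have "\<dots> = (\<Sum>z\<in>?L \<times> P. F (h z))" by (rule sum.reindex_bij_betw[OF bij, symmetric])
  also have "\<dots> = (\<Sum>z\<in>?L \<times> P. F (positions N (fst z)))"
    by (rule sum.cong) (auto simp: h_def P_def Fperm)
  also have "\<dots> = (\<Sum>p\<in>?L. \<Sum>q\<in>P. F (positions N p))" by (subst sum.cartesian_product) (simp add: split_def)
  also have "\<dots> = fact N * (\<Sum>p\<in>?L. F (positions N p))"
    by (simp add: P_def card_permutations sum_distrib_left)
  finally show "(\<Sum>x\<in>D. F x) = fact N * (\<Sum>p\<in>?L. F (positions N p))" .
qed

section \<open>The Cauchy identity\<close>


text \<open>The grading by size: the constant 0 + ... + (N - 1) is added so that the position vector
  of a partition of n lies in the piece of degree n.\<close>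

definition tuples :: "nat \<Rightarrow> int \<Rightarrow> (nat \<Rightarrow> int) set" where
  "tuples N n = {x \<in> PiE {..<N} (\<lambda>_. {- int N<..}). (\<Sum>i<N. x i) + (\<Sum>j<N. int j) = n}"

lemma double_sum_int: "2 * (\<Sum>j<N. int j) = int N * (int N - 1)"
  by (induction N) (auto simp: algebra_simps)

lemma finite_tuples: "finite (tuples N n)"
proof (rule finite_subset)
  show "tuples N n \<subseteq> PiE {..<N} (\<lambda>_. {- int N<..n + int N * int N})"
  proof
    fix x assume x: "x \<in> tuples N n"
    have "x i \<le> n + int N * int N" if "i < N" for i
    proof -
      have low: "- int N < x k" if "k < N" for k using x that by (auto simp: tuples_def PiE_def Pi_def)
      have "x i + int N \<le> (\<Sum>k<N. x k + int N)"
      proof (rule member_le_sum)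
        fix k assume "k \<in> {..<N} - {i}"
        then show "0 \<le> x k + int N" using low[of k] by simp
      qed (use that in auto)
      also have "\<dots> = n - (\<Sum>j<N. int j) + int N * int N"
        using x by (simp add: tuples_def sum.distrib)
      finally show ?thesis using sum_nonneg[of "{..<N}" int] by simp
    qed
    then show "x \<in> PiE {..<N} (\<lambda>_. {- int N<..n + int N * int N})"
      using x by (auto simp: tuples_def PiE_def Pi_def)
  qed
qed (rule finite_PiE; simp)

lemma sum_lessThan_card_le:
  fixes A :: "nat set"
  assumes "finite A"
  shows "(\<Sum>j<card A. int j) \<le> (\<Sum>a\<in>A. int a)"
  using assms
proof (induction A rule: finite_linorder_max_induct)
  case (insert b A)
  have "A \<subseteq> {..<b}" using insert by auto
  then have "card A \<le> b" using card_mono[of "{..<b}" A] by simp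
  then show ?case using insert by auto
qed simp

text \<open>Adding N - 1 to distinct entries above - N gives a set of N natural numbers, whose sum
  exceeds the least possible one by exactly n.\<close>

lemma sum_shifted_tuple:
  assumes "x \<in> tuples N n" "inj_on x {..<N}"
  defines "A \<equiv> (\<lambda>i. nat (x i + int N - 1)) ` {..<N}"
  shows "card A = N" and "(\<Sum>a\<in>A. int a) = n + (\<Sum>j<N. int j)"
proof -
  have low: "0 \<le> x k + int N - 1" if "k < N" for k using assms(1) that by (auto simp: tuples_def PiE_def Pi_def)
  have inj: "inj_on (\<lambda>i. nat (x i + int N - 1)) {..<N}"
  proof (rule inj_onI)
    fix i j assume "i \<in> {..<N}" "j \<in> {..<N}" "nat (x i + int N - 1) = nat (x j + int N - 1)"
    then show "i = j" using low[of i] low[of j] assms(2) by (auto simp: inj_on_def)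
  qed
  then show "card A = N" by (simp add: A_def card_image)
  have "(\<Sum>a\<in>A. int a) = (\<Sum>i<N. x i + (int N - 1))"
    unfolding A_def by (subst sum.reindex[OF inj]) (use low in \<open>auto intro!: sum.cong\<close>)
  also have "\<dots> = (\<Sum>i<N. x i) + int N * (int N - 1)" by (simp add: sum.distrib)
  also have "\<dots> = n + (\<Sum>j<N. int j)" using assms(1) double_sum_int[of N] by (simp add: tuples_def)
  finally show "(\<Sum>a\<in>A. int a) = n + (\<Sum>j<N. int j)" .
qed

lemma inj_tuple_nonneg:
  assumes "x \<in> tuples N n" "inj_on x {..<N}"
  shows "0 \<le> n"
  using sum_shifted_tuple[OF assms] sum_lessThan_card_le[of "(\<lambda>i. nat (x i + int N - 1)) ` {..<N}"] by simp

text \<open>A gap \<open>- b\<close> would push the remaining entries up and make the sum too large.\<close>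

lemma inj_tuple_contains_bottom:
  assumes x: "x \<in> tuples N n" "inj_on x {..<N}" and n: "n + int r \<le> int N" and b: "N - r \<le> b" "b < N"
  shows "\<exists>i<N. x i = - int b"
proof (rule ccontr)
  assume no: "\<not> (\<exists>i<N. x i = - int b)"
  define A where "A = (\<lambda>i. nat (x i + int N - 1)) ` {..<N}"
  have low: "0 \<le> x k + int N - 1" if "k < N" for k using x that by (auto simp: tuples_def PiE_def Pi_def)
  have A: "card A = N" "(\<Sum>a\<in>A. int a) = n + (\<Sum>j<N. int j)" "finite A"
    using sum_shifted_tuple[OF x] by (auto simp: A_def)
  have "N - 1 - b \<notin> A"
  proof
    assume "N - 1 - b \<in> A"
    then obtain i where i: "i < N" "N - 1 - b = nat (x i + int N - 1)" by (auto simp: A_def)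
    then have "int (N - 1 - b) = x i + int N - 1" using low by simp
    moreover have "int (N - 1 - b) = int N - 1 - int b" using b by simp
    ultimately show False using no i by auto
  qed
  \<comment> \<open>Adding the gap to the set gives N + 1 distinct natural numbers, with sum at
    least 0 + ... + N. This forces n > b, against n <= N - r <= b.\<close>
  then have "(\<Sum>j<Suc N. int j) \<le> int (N - 1 - b) + (n + (\<Sum>j<N. int j))"
    using sum_lessThan_card_le[of "insert (N - 1 - b) A"] A by simp
  then have "int N \<le> int (N - 1 - b) + n" by simp
  then show False using n b by linarith
qed

lemma sum_fun_upd_int:
  fixes x :: "nat \<Rightarrow> int"
  assumes "i < N"
  shows "(\<Sum>k<N. (x(i := v)) k) = (\<Sum>k<N. x k) - x i + v"
proof -
  have "(\<Sum>k<N. (x(i := v)) k) = v + (\<Sum>k\<in>{..<N}-{i}. x k)"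
    using assms by (subst sum.remove[of _ i]) auto
  moreover have "(\<Sum>k<N. x k) = x i + (\<Sum>k\<in>{..<N}-{i}. x k)"
    using assms by (subst sum.remove[of _ i]) auto
  ultimately show ?thesis by simp
qed

lemma fun_upd_in_tuples:
  assumes "x \<in> tuples N n" "i < N" "- int N < v"
  shows "x(i := v) \<in> tuples N (n - x i + v)"
proof -
  have "x(i := v) \<in> PiE {..<N} (\<lambda>_. {- int N<..})"
    using assms by (intro PiE_I) (auto simp: tuples_def PiE_def Pi_def extensional_def)
  then show ?thesis
    using assms sum_fun_upd_int[OF assms(2), of x v] by (simp add: tuples_def del: fun_upd_apply)
qed

abbreviation sq_h :: "(nat \<Rightarrow> real) \<Rightarrow> int \<Rightarrow> real" where
  "sq_h t \<equiv> miwa_h (\<lambda>r. real r * (t r)\<^sup>2)"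

abbreviation partitions_of :: "nat \<Rightarrow> int \<Rightarrow> nat list set" where
  "partitions_of N n \<equiv> {p. is_partition p \<and> length p \<le> N \<and> int (sum_list p) = n}"

text \<open>N! times the sum of squared Schur functions over partitions of n with at most N rows;
  summing over unordered tuples makes shifting a single entry harmless.\<close>

definition tuple_norm :: "(nat \<Rightarrow> real) \<Rightarrow> nat \<Rightarrow> int \<Rightarrow> real" where
  "tuple_norm t N n = (\<Sum>x\<in>tuples N n. (alternant t N x)\<^sup>2)"

lemma tuple_norm_neg: "n < 0 \<Longrightarrow> tuple_norm t N n = 0"
  unfolding tuple_norm_def using inj_tuple_nonneg alternant_not_inj by (intro sum.neutral) fastforce

text \<open>Summation by parts: lowering an entry is adjoint to raising it. The boundary terms
  vanish because an entry at or below - N kills the alternant.\<close>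

lemma sum_alternant_shift:
  assumes i: "i < N"
  shows "(\<Sum>x\<in>tuples N n. alternant t N x * alternant t N (x(i := x i - int r)))
     = (\<Sum>y\<in>tuples N (n - int r). alternant t N y * alternant t N (y(i := y i + int r)))"
proof -
  have "(\<Sum>x\<in>tuples N n. alternant t N x * alternant t N (x(i := x i - int r)))
     = (\<Sum>x\<in>{x\<in>tuples N n. - int N < x i - int r}. alternant t N x * alternant t N (x(i := x i - int r)))"
  proof (rule sum.mono_neutral_right[OF finite_tuples])
    show "\<forall>x\<in>tuples N n - {x\<in>tuples N n. - int N < x i - int r}. alternant t N x * alternant t N (x(i := x i - int r)) = 0"
    proof
      fix x assume "x \<in> tuples N n - {x\<in>tuples N n. - int N < x i - int r}"
      then have "alternant t N (x(i := x i - int r)) = 0" by (intro alternant_too_low[OF i]) auto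
      then show "alternant t N x * alternant t N (x(i := x i - int r)) = 0" by simp
    qed
  qed auto
  also have "\<dots> = (\<Sum>y\<in>tuples N (n - int r). alternant t N y * alternant t N (y(i := y i + int r)))"
  proof (rule sum.reindex_bij_witness[of _ "\<lambda>y. y(i := y i + int r)" "\<lambda>x. x(i := x i - int r)"])
    fix x assume "x \<in> {x\<in>tuples N n. - int N < x i - int r}"
    then show "x(i := x i - int r) \<in> tuples N (n - int r)"
      using fun_upd_in_tuples[OF _ i, of x n "x i - int r"] by simp
  next
    fix y assume y: "y \<in> tuples N (n - int r)"
    then have "- int N < y i" using i by (auto simp: tuples_def PiE_def Pi_def)
    then show "y(i := y i + int r) \<in> {x\<in>tuples N n. - int N < x i - int r}"
      using fun_upd_in_tuples[OF y i, of "y i + int r"] by simp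
  qed (auto simp: mult.commute)
  finally show ?thesis .
qed

text \<open>Euler's identity on one factor lowers an entry by r, adjointness moves the shift to the
  other factor, and \<open>alternant_shift_up\<close> turns it into a second factor r t_r. The
  condition n <= N keeps the last r rows empty. The result is Newton's identity for the times r
  t_r^2.\<close>

lemma tuple_norm_recurrence:
  assumes supp: "\<And>r. r > m \<Longrightarrow> t r = 0" and n: "n \<le> int N"
  shows "of_int n * tuple_norm t N n = (\<Sum>r=1..m. real r * (real r * (t r)\<^sup>2) * tuple_norm t N (n - int r))"
proof -
  have "of_int n * tuple_norm t N n = (\<Sum>x\<in>tuples N n. alternant t N x * (of_int ((\<Sum>i<N. x i) + (\<Sum>j<N. int j)) * alternant t N x))"
    unfolding tuple_norm_def sum_distrib_left
    by (rule sum.cong) (auto simp: tuples_def power2_eq_square)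
  also have "\<dots> = (\<Sum>x\<in>tuples N n. \<Sum>r=1..m. real r * t r * (\<Sum>i<N. alternant t N x * alternant t N (x(i := x i - int r))))"
    by (simp only: alternant_euler[OF supp]) (simp add: sum_distrib_left mult_ac)
  also have "\<dots> = (\<Sum>r=1..m. real r * t r * (\<Sum>i<N. \<Sum>x\<in>tuples N n. alternant t N x * alternant t N (x(i := x i - int r))))"
    by (subst sum.swap) (simp add: sum_distrib_left sum.swap[of _ "tuples N n"])
  also have "\<dots> = (\<Sum>r=1..m. real r * t r * (\<Sum>i<N. \<Sum>y\<in>tuples N (n - int r). alternant t N y * alternant t N (y(i := y i + int r))))"
    by (simp add: sum_alternant_shift)
  also have "\<dots> = (\<Sum>r=1..m. real r * t r * (\<Sum>y\<in>tuples N (n - int r). alternant t N y * (\<Sum>i<N. alternant t N (y(i := y i + int r)))))"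
    by (simp add: sum_distrib_left sum.swap[of _ "{..<N}"])
  also have "\<dots> = (\<Sum>r=1..m. real r * (real r * (t r)\<^sup>2) * tuple_norm t N (n - int r))"
  proof (rule sum.cong[OF refl])
    fix r assume r: "r \<in> {1..m}"
    have "(\<Sum>y\<in>tuples N (n - int r). alternant t N y * (\<Sum>i<N. alternant t N (y(i := y i + int r))))
        = (\<Sum>y\<in>tuples N (n - int r). real r * t r * (alternant t N y)\<^sup>2)"
    proof (rule sum.cong[OF refl])
      fix y assume y: "y \<in> tuples N (n - int r)"
      show "alternant t N y * (\<Sum>i<N. alternant t N (y(i := y i + int r))) = real r * t r * (alternant t N y)\<^sup>2"
      proof (cases "inj_on y {..<N}")
        case True
        then have "r \<le> N" using inj_tuple_nonneg[OF y True] n by simp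
        then have "(\<Sum>i<N. alternant t N (y(i := y i + int r))) = real r * t r * alternant t N y"
          using inj_tuple_contains_bottom[OF y True, of r] n r by (intro alternant_shift_up) auto
        then show ?thesis by (simp add: power2_eq_square)
      qed (simp add: alternant_not_inj)
    qed
    then show "real r * t r * (\<Sum>y\<in>tuples N (n - int r). alternant t N y * (\<Sum>i<N. alternant t N (y(i := y i + int r))))
       = real r * (real r * (t r)\<^sup>2) * tuple_norm t N (n - int r)"
      by (simp add: tuple_norm_def sum_distrib_left[symmetric] power2_eq_square)
  qed
  finally show ?thesis .
qed

lemma tuple_norm_eq_miwa_h:
  assumes supp: "\<And>r. r > m \<Longrightarrow> t r = 0" and n: "n \<le> N"
  shows "tuple_norm t N (int n) = tuple_norm t N 0 * sq_h t (int n)"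
  using n
proof (induction n rule: less_induct)
  case (less n)
  show ?case
  proof (cases "n = 0")
    case False
    have "real n * tuple_norm t N (int n) = (\<Sum>r=1..m. real r * (real r * (t r)\<^sup>2) * tuple_norm t N (int n - int r))"
      using tuple_norm_recurrence[OF supp, where n = "int n"] less.prems by simp
    also have "\<dots> = (\<Sum>r=1..m. real r * (real r * (t r)\<^sup>2) * (tuple_norm t N 0 * sq_h t (int n - int r)))"
    proof (rule sum.cong[OF refl])
      fix r assume r: "r \<in> {1..m}"
      have "tuple_norm t N (int n - int r) = tuple_norm t N 0 * sq_h t (int n - int r)"
      proof (cases "r \<le> n")
        case True
        then show ?thesis using less.IH[of "n - r"] less.prems r False by (simp add: of_nat_diff)
      qed (simp add: tuple_norm_neg)
      then show "real r * (real r * (t r)\<^sup>2) * tuple_norm t N (int n - int r) =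
         real r * (real r * (t r)\<^sup>2) * (tuple_norm t N 0 * sq_h t (int n - int r))" by simp
    qed
    also have "\<dots> = tuple_norm t N 0 * (of_int (int n) * sq_h t (int n))"
      by (subst miwa_h_recurrence[of m]) (use supp in \<open>auto simp: sum_distrib_left mult_ac\<close>)
    finally have "real n * tuple_norm t N (int n) = real n * (tuple_norm t N 0 * sq_h t (int n))"
      by simp
    then show ?thesis using False by simp
  qed simp
qed

lemma sum_list_eq_sum_part: "length p \<le> N \<Longrightarrow> sum_list p = (\<Sum>i<N. part p (i + 1))"
proof -
  assume N: "length p \<le> N"
  have "sum_list p = (\<Sum>i<length p. p ! i)" by (simp add: sum_list_sum_nth atLeast0LessThan)
  also have "\<dots> = (\<Sum>i<N. part p (i + 1))"
    by (rule sum.mono_neutral_cong_left) (use N in \<open>auto simp: part_def\<close>)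
  finally show ?thesis .
qed

lemma positions_in_tuples:
  assumes "length p \<le> N"
  shows "positions N p \<in> tuples N n \<longleftrightarrow> int (sum_list p) = n"
proof -
  have "(\<Sum>i<N. positions N p i) + (\<Sum>j<N. int j) = int (sum_list p)"
    by (simp add: sum_list_eq_sum_part[OF assms] positions_def sum.distrib[symmetric])
  moreover have "positions N p \<in> PiE {..<N} (\<lambda>_. {- int N<..})"
  proof (rule PiE_I)
    fix i assume "i \<in> {..<N}"
    then show "positions N p i \<in> {- int N<..}" using positions_lower_bound[of i N p] by simp
  next
    fix i assume "i \<notin> {..<N}"
    then show "positions N p i = undefined" unfolding positions_def by (rule restrict_apply[THEN trans, OF if_not_P])
  qed
  ultimately show ?thesis unfolding tuples_def mem_Collect_eq by simp
qed

lemma tuple_norm_eq_sum_schur: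
  shows "finite (partitions_of N n)"
    and "tuple_norm t N n = fact N * (\<Sum>p\<in>partitions_of N n. (schur t p)\<^sup>2)"
proof -
  have set: "{p. is_partition p \<and> length p \<le> N \<and> positions N p \<in> tuples N n} = partitions_of N n"
    using positions_in_tuples by blast
  have perm: "x \<circ> q \<in> tuples N n" if "x \<in> tuples N n" "q permutes {..<N}" for x q
  proof -
    have "(\<Sum>i<N. (x \<circ> q) i) = (\<Sum>i<N. x i)" using sum.permute[OF that(2), of x] by simp
    moreover have "x (q i) \<in> {- int N<..}" if "i < N" for i
      using \<open>x \<in> tuples N n\<close> permutes_in_image[OF \<open>q permutes {..<N}\<close>, of i] that by (auto simp: tuples_def PiE_def Pi_def)
    moreover have "(x \<circ> q) i = undefined" if "\<not> i < N" for i
      using \<open>x \<in> tuples N n\<close> that permutes_not_in[OF \<open>q permutes {..<N}\<close>, of i] by (auto simp: tuples_def PiE_def extensional_def)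
    ultimately show ?thesis using that(1) by (auto simp: tuples_def PiE_def Pi_def extensional_def)
  qed
  note tp = sum_tuples_eq_sum_partitions[where D = "tuples N n" and N = N and F = "\<lambda>x. (alternant t N x)\<^sup>2",
      OF finite_tuples _ perm, unfolded set]
  show "finite (partitions_of N n)"
    by (rule tp(1)) (auto simp: tuples_def PiE_def alternant_permute alternant_not_inj alternant_too_low)
  have "tuple_norm t N n = fact N * (\<Sum>p\<in>partitions_of N n. (alternant t N (positions N p))\<^sup>2)"
    unfolding tuple_norm_def
    by (rule tp(2)) (auto simp: tuples_def PiE_def alternant_permute alternant_not_inj alternant_too_low)
  then show "tuple_norm t N n = fact N * (\<Sum>p\<in>partitions_of N n. (schur t p)\<^sup>2)"
    by (auto simp: schur_eq_alternant intro!: sum.cong)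
qed

lemma length_le_sum_list: "is_partition p \<Longrightarrow> length p \<le> sum_list p"
proof -
  assume "is_partition p"
  then have "\<forall>k\<in>set p. 0 < k" by (simp add: is_partition_def)
  then show ?thesis by (induction p) auto
qed

text \<open>The recurrences for both sides agree up to the value at n = 0, where only the empty
  partition contributes. Since a partition of n has at most n parts, the bound N on the length is no
  restriction here.\<close>

lemma cauchy_identity_graded:
  assumes supp: "\<And>r. r > m \<Longrightarrow> t r = 0" and n: "n \<le> N"
  shows "(\<Sum>p\<in>partitions_of N (int n). (schur t p)\<^sup>2) = sq_h t (int n)"
proof -
  have "partitions_of N 0 = {[]}"
    by (auto simp: is_partition_def) (metis list.set_intros(1) neq_Nil_conv less_irrefl)
  then have "tuple_norm t N 0 = fact N"
    unfolding tuple_norm_eq_sum_schur by (simp add: schur_def)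
  then have "fact N * (\<Sum>p\<in>partitions_of N (int n). (schur t p)\<^sup>2) = fact N * sq_h t (int n)"
    using tuple_norm_eq_miwa_h[OF supp n] by (simp add: tuple_norm_eq_sum_schur)
  then show ?thesis by simp
qed

lemma sum_schur_sq_le:
  assumes supp: "\<And>r. r > m \<Longrightarrow> t r = 0" and A: "finite A" "\<And>p. p \<in> A \<Longrightarrow> is_partition p"
  shows "(\<Sum>p\<in>A. (schur t p)\<^sup>2) \<le> exp (\<Sum>r=1..m. real r * (t r)\<^sup>2)"
proof -
  define N where "N = Max (insert 0 (sum_list ` A))"
  have N: "sum_list p \<le> N" if "p \<in> A" for p using A(1) that by (auto simp: N_def)
  define B where "B n = partitions_of N (int n)" for n
  have finB: "finite (B n)" for n unfolding B_def by (rule tuple_norm_eq_sum_schur(1))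
  have "A \<subseteq> (\<Union>n\<in>{..N}. B n)"
  proof
    fix p assume p: "p \<in> A"
    then have "length p \<le> N" using N[OF p] length_le_sum_list[OF A(2)[OF p]] by simp
    then have "p \<in> B (sum_list p)" using A(2) p by (simp add: B_def)
    then show "p \<in> (\<Union>n\<in>{..N}. B n)" using N[OF p] by blast
  qed
  then have "(\<Sum>p\<in>A. (schur t p)\<^sup>2) \<le> (\<Sum>p\<in>(\<Union>n\<in>{..N}. B n). (schur t p)\<^sup>2)"
    by (intro sum_mono2) (auto simp: finB)
  also have "\<dots> = (\<Sum>n\<le>N. \<Sum>p\<in>B n. (schur t p)\<^sup>2)"
    by (rule sum.UNION_disjoint) (auto simp: finB, auto simp: B_def)
  also have "\<dots> = (\<Sum>n\<le>N. sq_h t (int n))"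
    unfolding B_def by (rule sum.cong) (use cauchy_identity_graded[OF supp] in auto)
  also have "\<dots> \<le> exp (\<Sum>r=1..m. real r * (t r)\<^sup>2)"
  proof (rule sum_miwa_h_le_exp)
    \<comment> \<open>Nonnegativity of the coefficients is itself read off the Cauchy identity, as a
      sum of squares.\<close>
    fix n :: nat
    have "0 \<le> (\<Sum>p\<in>partitions_of n (int n). (schur t p)\<^sup>2)"
      by (rule sum_nonneg) simp
    also have "\<dots> = sq_h t (int n)"
      by (rule cauchy_identity_graded[OF supp order_refl])
    finally show "0 \<le> sq_h t (int n)" .
  qed (use supp in simp)
  finally show ?thesis .
qed

section \<open>Biorthogonal ensembles\<close>


text \<open>After the Leibniz expansion each term is a product of functions of separate coordinates,
  so the sum over tuples factorises.\<close>

lemma sum_prod_fdet: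
  assumes "finite X"
  shows "(\<Sum>x\<in>PiE {..<N} (\<lambda>_. X). (\<Prod>i<N. c i (x i)) * fdet N (\<lambda>i j. \<phi> j (x i)))
     = fdet N (\<lambda>i j. \<Sum>k\<in>X. c i k * \<phi> j k)"
proof -
  have "fdet N (\<lambda>i j. \<Sum>k\<in>X. c i k * \<phi> j k)
    = (\<Sum>p | p permutes {..<N}. of_int (sign p) * (\<Sum>x\<in>PiE {..<N} (\<lambda>_. X). \<Prod>i<N. c i (x i) * \<phi> (p i) (x i)))"
    unfolding fdet_leibniz by (subst prod_sum_PiE) (use assms in auto)
  also have "\<dots> = (\<Sum>x\<in>PiE {..<N} (\<lambda>_. X). \<Sum>p | p permutes {..<N}. of_int (sign p) * (\<Prod>i<N. c i (x i) * \<phi> (p i) (x i)))"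
    unfolding sum_distrib_left by (rule sum.swap)
  also have "\<dots> = (\<Sum>x\<in>PiE {..<N} (\<lambda>_. X). (\<Prod>i<N. c i (x i)) * fdet N (\<lambda>i j. \<phi> j (x i)))"
    unfolding fdet_leibniz by (simp add: sum_distrib_left prod.distrib mult_ac)
  finally show ?thesis by simp
qed

text \<open>One of the two determinants is expanded by Leibniz and the sum over tuples is absorbed
  into the rows of the other. Undoing \<sigma> on the rows cancels its sign and moves the weighted
  rows from \<open>I\<close> to its image under \<sigma>.\<close>

lemma andreief:
  fixes \<phi> :: "nat \<Rightarrow> 'a \<Rightarrow> real" and \<eta> :: "'a \<Rightarrow> real" and N :: nat
  assumes X: "finite X" and I: "I \<subseteq> {..<N}"
  defines "G \<equiv> \<lambda>p q. \<Sum>k\<in>X. \<phi> p k * \<phi> q k" and "A \<equiv> \<lambda>p q. \<Sum>k\<in>X. \<eta> k * \<phi> p k * \<phi> q k"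
  shows "(\<Sum>x\<in>PiE {..<N} (\<lambda>_. X). (fdet N (\<lambda>i j. \<phi> j (x i)))\<^sup>2 * (\<Prod>i\<in>I. \<eta> (x i)))
     = (\<Sum>\<sigma> | \<sigma> permutes {..<N}. fdet N (\<lambda>p. if p \<in> \<sigma> ` I then A p else G p))"
proof -
  define w where "w i k = (if i \<in> I then \<eta> k else 1)" for i k
  define F where "F x = fdet N (\<lambda>i j. \<phi> j (x i))" for x
  have w: "(\<Prod>i\<in>I. \<eta> (x i)) = (\<Prod>i<N. w i (x i))" for x
    by (rule prod.mono_neutral_cong_left) (use I in \<open>auto simp: w_def\<close>)
  have "(\<Sum>x\<in>PiE {..<N} (\<lambda>_. X). (F x)\<^sup>2 * (\<Prod>i\<in>I. \<eta> (x i)))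
     = (\<Sum>x\<in>PiE {..<N} (\<lambda>_. X). \<Sum>\<sigma> | \<sigma> permutes {..<N}. of_int (sign \<sigma>) * ((\<Prod>i<N. w i (x i) * \<phi> (\<sigma> i) (x i)) * F x))"
  proof (rule sum.cong[OF refl])
    fix x
    have eq: "(F x)\<^sup>2 * (\<Prod>i\<in>I. \<eta> (x i)) = (\<Sum>\<sigma> | \<sigma> permutes {..<N}. of_int (sign \<sigma>) * (\<Prod>i<N. \<phi> (\<sigma> i) (x i))) * (\<Prod>i<N. w i (x i)) * F x"
      unfolding w F_def fdet_leibniz power2_eq_square by (simp add: mult_ac)
    show "(F x)\<^sup>2 * (\<Prod>i\<in>I. \<eta> (x i)) = (\<Sum>\<sigma> | \<sigma> permutes {..<N}. of_int (sign \<sigma>) * ((\<Prod>i<N. w i (x i) * \<phi> (\<sigma> i) (x i)) * F x))"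
      unfolding eq sum_distrib_right by (rule sum.cong[OF refl]) (simp add: prod.distrib mult_ac)
  qed
  also have "\<dots> = (\<Sum>\<sigma> | \<sigma> permutes {..<N}. of_int (sign \<sigma>) * (\<Sum>x\<in>PiE {..<N} (\<lambda>_. X). (\<Prod>i<N. w i (x i) * \<phi> (\<sigma> i) (x i)) * F x))"
    by (subst sum.swap) (simp add: sum_distrib_left)
  also have "\<dots> = (\<Sum>\<sigma> | \<sigma> permutes {..<N}. fdet N (\<lambda>p. if p \<in> \<sigma> ` I then A p else G p))"
  proof (rule sum.cong[OF refl])
    fix \<sigma> assume "\<sigma> \<in> {\<sigma>. \<sigma> permutes {..<N}}"
    then have s: "\<sigma> permutes {..<N}" by simp
    define M where "M = (\<lambda>p. if p \<in> \<sigma> ` I then A p else G p)"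
    have "(\<Sum>x\<in>PiE {..<N} (\<lambda>_. X). (\<Prod>i<N. w i (x i) * \<phi> (\<sigma> i) (x i)) * F x)
       = fdet N (\<lambda>i j. \<Sum>k\<in>X. (w i k * \<phi> (\<sigma> i) k) * \<phi> j k)"
      unfolding F_def by (rule sum_prod_fdet[OF X])
    also have "\<dots> = fdet N (\<lambda>i. M (\<sigma> i))"
      by (rule fdet_cong) (auto simp: M_def w_def A_def G_def inj_image_mem_iff[OF permutes_inj[OF s]])
    also have "\<dots> = of_int (sign \<sigma>) * fdet N M" by (rule fdet_permute_rows[OF s])
    finally show "of_int (sign \<sigma>) * (\<Sum>x\<in>PiE {..<N} (\<lambda>_. X). (\<Prod>i<N. w i (x i) * \<phi> (\<sigma> i) (x i)) * F x) = fdet N M"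
      by (simp add: sign_def)
  qed
  finally show ?thesis unfolding F_def .
qed

text \<open>Unit rows outside \<open>J\<close> force a contributing permutation to fix those
  indices; what remains is the principal minor of \<open>B\<close> on \<open>J\<close>.\<close>

lemma fdet_unit_rows:
  assumes J: "J \<subseteq> {..<N}"
  shows "fdet N (\<lambda>i j. if i \<in> J then B i j else if i = j then 1 else 0)
     = (\<Sum>\<sigma> | \<sigma> permutes J. of_int (sign \<sigma>) * (\<Prod>i\<in>J. B i (\<sigma> i)))"
proof -
  define M where "M i j = (if i \<in> J then B i j else if i = j then 1 else (0::real))" for i j
  have "fdet N M = (\<Sum>\<sigma> | \<sigma> permutes J. of_int (sign \<sigma>) * (\<Prod>i<N. M i (\<sigma> i)))"
    unfolding fdet_leibniz
  proof (rule sum.mono_neutral_right)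
    show "{\<sigma>. \<sigma> permutes J} \<subseteq> {\<sigma>. \<sigma> permutes {..<N}}" using J permutes_subset by blast
    show "\<forall>\<sigma>\<in>{\<sigma>. \<sigma> permutes {..<N}} - {\<sigma>. \<sigma> permutes J}. of_int (sign \<sigma>) * (\<Prod>i<N. M i (\<sigma> i)) = 0"
    proof
      fix \<sigma> assume s: "\<sigma> \<in> {\<sigma>. \<sigma> permutes {..<N}} - {\<sigma>. \<sigma> permutes J}"
      then obtain i where i: "i \<in> {..<N} - J" "\<sigma> i \<noteq> i"
        using permutes_superset[of \<sigma> "{..<N}" J] by blast
      then have "M i (\<sigma> i) = 0" by (auto simp: M_def)
      then have "(\<Prod>i<N. M i (\<sigma> i)) = 0" using i by (intro prod_zero) auto
      then show "of_int (sign \<sigma>) * (\<Prod>i<N. M i (\<sigma> i)) = 0" by simp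
    qed
  qed (simp add: finite_permutations)
  also have "\<dots> = (\<Sum>\<sigma> | \<sigma> permutes J. of_int (sign \<sigma>) * (\<Prod>i\<in>J. B i (\<sigma> i)))"
  proof (rule sum.cong[OF refl])
    fix \<sigma> assume "\<sigma> \<in> {\<sigma>. \<sigma> permutes J}"
    then have "\<sigma> i = i" if "i \<notin> J" for i using that by (simp add: permutes_def)
    then have "(\<Prod>i<N. M i (\<sigma> i)) = (\<Prod>i\<in>J. B i (\<sigma> i))"
      by (intro prod.mono_neutral_cong_right) (use J in \<open>auto simp: M_def\<close>)
    then show "of_int (sign \<sigma>) * (\<Prod>i<N. M i (\<sigma> i)) = of_int (sign \<sigma>) * (\<Prod>i\<in>J. B i (\<sigma> i))" by simp
  qed
  finally show ?thesis unfolding M_def .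
qed

text \<open>With A = B G the mixed matrix is a product whose right factor is \<open>G\<close> and
  whose left factor has the rows of \<open>B\<close> on \<open>J\<close> and unit rows elsewhere. So
  each correlation is a principal minor of \<open>B\<close> times the normalisation.\<close>

lemma fdet_replace_rows:
  assumes J: "J \<subseteq> {..<N}" and A: "\<And>p q. p < N \<Longrightarrow> q < N \<Longrightarrow> A p q = (\<Sum>r<N. B p r * G r q)"
  shows "fdet N (\<lambda>p. if p \<in> J then A p else G p) = (\<Sum>\<sigma> | \<sigma> permutes J. of_int (sign \<sigma>) * (\<Prod>i\<in>J. B i (\<sigma> i))) * fdet N G"
proof -
  have "fdet N (\<lambda>p. if p \<in> J then A p else G p)
     = fdet N (\<lambda>p q. \<Sum>r<N. (if p \<in> J then B p r else if p = r then 1 else 0) * G r q)"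
    by (rule fdet_cong) (auto simp: A if_distrib[where f = "\<lambda>c. c * _"] sum.delta cong: if_cong)
  then show ?thesis by (simp only: fdet_mult fdet_unit_rows[OF J])
qed

text \<open>For a biorthogonal ensemble with kernel matrix \<open>B = A G\<inverse>\<close> the second factorial moment
  of the number of points in a window is \<open>(tr B)\<^sup>2 - tr (B\<^sup>2)\<close>.\<close>

lemma second_moment_ensemble:
  fixes \<phi> :: "nat \<Rightarrow> 'a \<Rightarrow> real" and \<eta> :: "'a \<Rightarrow> real" and N :: nat
  assumes X: "finite X" and \<eta>: "\<And>k. \<eta> k = 0 \<or> \<eta> k = 1"
  defines "G \<equiv> \<lambda>p q. \<Sum>k\<in>X. \<phi> p k * \<phi> q k" and "A \<equiv> \<lambda>p q. \<Sum>k\<in>X. \<eta> k * \<phi> p k * \<phi> q k"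
  defines "D \<equiv> \<lambda>J. fdet N (\<lambda>p. if p \<in> J then A p else G p)"
  shows "(\<Sum>x\<in>PiE {..<N} (\<lambda>_. X). (fdet N (\<lambda>i j. \<phi> j (x i)))\<^sup>2 * ((\<Sum>i<N. \<eta> (x i)) - \<mu>)\<^sup>2)
     = fact N * ((\<Sum>p<N. \<Sum>q\<in>{..<N}-{p}. D {p, q}) + (1 - 2 * \<mu>) * (\<Sum>p<N. D {p}) + \<mu>\<^sup>2 * D {})"
proof -
  define F where "F x = (fdet N (\<lambda>i j. \<phi> j (x i)))\<^sup>2" for x
  let ?T = "PiE {..<N} (\<lambda>_. X)"
  let ?P = "{\<sigma>. \<sigma> permutes {..<N}}"
  have an: "(\<Sum>x\<in>?T. F x * (\<Prod>i\<in>I. \<eta> (x i))) = (\<Sum>\<sigma>\<in>?P. D (\<sigma> ` I))" if "I \<subseteq> {..<N}" for I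
    unfolding F_def D_def A_def G_def by (rule andreief[OF X that])
  \<comment> \<open>The centred square is written through products over distinct indices, the form
    Andreief's identity accepts; the diagonal terms reduce to first order since \<eta> takes the
    values 0 and 1.\<close>
  have expand: "((\<Sum>i<N. \<eta> (x i)) - \<mu>)\<^sup>2 = (\<Sum>i<N. \<Sum>j\<in>{..<N}-{i}. \<Prod>a\<in>{i, j}. \<eta> (x a)) + (1 - 2 * \<mu>) * (\<Sum>i<N. \<Prod>a\<in>{i}. \<eta> (x a)) + \<mu>\<^sup>2 * (\<Prod>a\<in>{}. \<eta> (x a))" for x
  proof -
    have sq: "\<eta> k * \<eta> k = \<eta> k" for k using \<eta>[of k] by auto
    have "(\<Sum>i<N. \<eta> (x i)) * (\<Sum>j<N. \<eta> (x j)) = (\<Sum>i<N. \<Sum>j<N. \<eta> (x i) * \<eta> (x j))"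
      by (rule sum_product)
    also have "\<dots> = (\<Sum>i<N. \<eta> (x i) + (\<Sum>j\<in>{..<N}-{i}. \<Prod>a\<in>{i, j}. \<eta> (x a)))"
    proof (rule sum.cong[OF refl])
      fix i assume "i \<in> {..<N}"
      then have "(\<Sum>j<N. \<eta> (x i) * \<eta> (x j)) = \<eta> (x i) * \<eta> (x i) + (\<Sum>j\<in>{..<N}-{i}. \<eta> (x i) * \<eta> (x j))"
        by (intro sum.remove) auto
      also have "(\<Sum>j\<in>{..<N}-{i}. \<eta> (x i) * \<eta> (x j)) = (\<Sum>j\<in>{..<N}-{i}. \<Prod>a\<in>{i, j}. \<eta> (x a))"
        by (rule sum.cong) auto
      finally show "(\<Sum>j<N. \<eta> (x i) * \<eta> (x j)) = \<eta> (x i) + (\<Sum>j\<in>{..<N}-{i}. \<Prod>a\<in>{i, j}. \<eta> (x a))"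
        by (simp add: sq)
    qed
    finally show ?thesis by (simp add: power2_eq_square sum.distrib algebra_simps)
  qed
  have card: "card ?P = fact N" by (simp add: card_permutations)
  have bij: "bij_betw \<sigma> {..<N} {..<N}" if "\<sigma> \<in> ?P" for \<sigma> using that by (simp add: permutes_imp_bij)
  \<comment> \<open>A permutation only relabels the index or pair being summed, so every \<sigma>
    contributes the same and the sum over \<sigma> gives N!.\<close>
  have one: "(\<Sum>i<N. D (\<sigma> ` {i})) = (\<Sum>p<N. D {p})" if "\<sigma> \<in> ?P" for \<sigma>
    using sum.reindex_bij_betw[OF bij[OF that], of "\<lambda>p. D {p}"] by simp
  have two: "(\<Sum>i<N. \<Sum>j\<in>{..<N}-{i}. D (\<sigma> ` {i, j})) = (\<Sum>p<N. \<Sum>q\<in>{..<N}-{p}. D {p, q})" if "\<sigma> \<in> ?P" for \<sigma>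
  proof -
    have "(\<Sum>i<N. \<Sum>j\<in>{..<N}-{i}. D (\<sigma> ` {i, j})) = (\<Sum>i<N. \<Sum>q\<in>{..<N}-{\<sigma> i}. D {\<sigma> i, q})"
    proof (rule sum.cong[OF refl])
      fix i assume "i \<in> {..<N}"
      then have "bij_betw \<sigma> ({..<N}-{i}) ({..<N}-{\<sigma> i})"
        using bij[OF that] by (auto simp: bij_betw_def inj_on_def)
      from sum.reindex_bij_betw[OF this, of "\<lambda>q. D {\<sigma> i, q}"]
      show "(\<Sum>j\<in>{..<N}-{i}. D (\<sigma> ` {i, j})) = (\<Sum>q\<in>{..<N}-{\<sigma> i}. D {\<sigma> i, q})" by simp
    qed
    also have "\<dots> = (\<Sum>p<N. \<Sum>q\<in>{..<N}-{p}. D {p, q})"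
      by (rule sum.reindex_bij_betw[OF bij[OF that]])
    finally show ?thesis .
  qed
  have "(\<Sum>x\<in>?T. F x * ((\<Sum>i<N. \<eta> (x i)) - \<mu>)\<^sup>2)
     = (\<Sum>x\<in>?T. (\<Sum>i<N. \<Sum>j\<in>{..<N}-{i}. F x * (\<Prod>a\<in>{i, j}. \<eta> (x a))) + (1 - 2 * \<mu>) * (\<Sum>i<N. F x * (\<Prod>a\<in>{i}. \<eta> (x a))) + \<mu>\<^sup>2 * (F x * (\<Prod>a\<in>{}. \<eta> (x a))))"
    unfolding expand by (rule sum.cong[OF refl]) (simp only: distrib_left sum_distrib_left mult.left_commute)
  also have "\<dots> = (\<Sum>i<N. \<Sum>j\<in>{..<N}-{i}. \<Sum>x\<in>?T. F x * (\<Prod>a\<in>{i, j}. \<eta> (x a))) + (1 - 2 * \<mu>) * (\<Sum>i<N. \<Sum>x\<in>?T. F x * (\<Prod>a\<in>{i}. \<eta> (x a))) + \<mu>\<^sup>2 * (\<Sum>x\<in>?T. F x * (\<Prod>a\<in>{}. \<eta> (x a)))"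
  proof -
    have a: "(\<Sum>x\<in>?T. \<Sum>i<N. \<Sum>j\<in>{..<N}-{i}. F x * (\<Prod>a\<in>{i, j}. \<eta> (x a))) = (\<Sum>i<N. \<Sum>j\<in>{..<N}-{i}. \<Sum>x\<in>?T. F x * (\<Prod>a\<in>{i, j}. \<eta> (x a)))"
      by (subst sum.swap, rule sum.cong[OF refl], rule sum.swap)
    have b: "(\<Sum>x\<in>?T. (1 - 2 * \<mu>) * (\<Sum>i<N. F x * (\<Prod>a\<in>{i}. \<eta> (x a)))) = (1 - 2 * \<mu>) * (\<Sum>i<N. \<Sum>x\<in>?T. F x * (\<Prod>a\<in>{i}. \<eta> (x a)))"
      by (subst sum_distrib_left[symmetric], subst sum.swap, rule refl)
    have c: "(\<Sum>x\<in>?T. \<mu>\<^sup>2 * (F x * (\<Prod>a\<in>{}. \<eta> (x a)))) = \<mu>\<^sup>2 * (\<Sum>x\<in>?T. F x * (\<Prod>a\<in>{}. \<eta> (x a)))"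
      by (rule sum_distrib_left[symmetric])
    show ?thesis by (simp only: sum.distrib a b c)
  qed
  also have "\<dots> = (\<Sum>i<N. \<Sum>j\<in>{..<N}-{i}. \<Sum>\<sigma>\<in>?P. D (\<sigma> ` {i, j})) + (1 - 2 * \<mu>) * (\<Sum>i<N. \<Sum>\<sigma>\<in>?P. D (\<sigma> ` {i})) + \<mu>\<^sup>2 * (\<Sum>\<sigma>\<in>?P. D (\<sigma> ` {}))"
  proof -
    have "(\<Sum>x\<in>?T. F x * (\<Prod>a\<in>{i, j}. \<eta> (x a))) = (\<Sum>\<sigma>\<in>?P. D (\<sigma> ` {i, j}))" if "i \<in> {..<N}" "j \<in> {..<N}-{i}" for i j
      by (rule an) (use that in auto)
    moreover have "(\<Sum>x\<in>?T. F x * (\<Prod>a\<in>{i}. \<eta> (x a))) = (\<Sum>\<sigma>\<in>?P. D (\<sigma> ` {i}))" if "i \<in> {..<N}" for i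
      by (rule an) (use that in auto)
    moreover have "(\<Sum>x\<in>?T. F x * (\<Prod>a\<in>{}. \<eta> (x a))) = (\<Sum>\<sigma>\<in>?P. D (\<sigma> ` {}))"
      by (rule an) auto
    ultimately show ?thesis by (intro arg_cong2[where f = "(+)"] arg_cong2[where f = "(*)"] sum.cong refl) auto
  qed
  also have "\<dots> = (\<Sum>\<sigma>\<in>?P. \<Sum>i<N. \<Sum>j\<in>{..<N}-{i}. D (\<sigma> ` {i, j})) + (1 - 2 * \<mu>) * (\<Sum>\<sigma>\<in>?P. \<Sum>i<N. D (\<sigma> ` {i})) + \<mu>\<^sup>2 * (\<Sum>\<sigma>\<in>?P. D {})"
    by (simp only: sum.swap[of _ ?P] image_empty)
  also have "\<dots> = fact N * ((\<Sum>p<N. \<Sum>q\<in>{..<N}-{p}. D {p, q}) + (1 - 2 * \<mu>) * (\<Sum>p<N. D {p}) + \<mu>\<^sup>2 * D {})"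
    by (simp only: one two sum_constant card cong: sum.cong) (simp add: algebra_simps)
  finally show ?thesis unfolding F_def .
qed

text \<open>The mean is tr B and the second factorial moment is (tr B)^2 - tr (B^2), up to the
  normalisation. Dropping the nonnegative trace of the square leaves a variance of at most tr
  B.\<close>

lemma second_moment_bound:
  assumes A: "\<And>p q. p < N \<Longrightarrow> q < N \<Longrightarrow> A p q = (\<Sum>r<N. B p r * G r q)"
    and G: "0 \<le> fdet N G" and B: "0 \<le> (\<Sum>p<N. \<Sum>q<N. B p q * B q p)"
  defines "D \<equiv> \<lambda>J. fdet N (\<lambda>p. if p \<in> J then A p else G p)"
  shows "(\<Sum>p<N. \<Sum>q\<in>{..<N}-{p}. D {p, q}) + (1 - 2 * \<mu>) * (\<Sum>p<N. D {p}) + \<mu>\<^sup>2 * D {}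
     \<le> fdet N G * (((\<Sum>p<N. B p p) - \<mu>)\<^sup>2 + (\<Sum>p<N. B p p))"
proof -
  have D0: "D {} = fdet N G" by (simp add: D_def)
  have D1: "D {p} = B p p * fdet N G" if "p < N" for p
    unfolding D_def by (subst fdet_replace_rows[OF _ A]) (use that in \<open>auto simp: permutes_sing\<close>)
  have D2: "D {p, q} = (B p p * B q q - B p q * B q p) * fdet N G" if "p < N" "q \<in> {..<N} - {p}" for p q
  proof -
    have ne: "p \<noteq> q" using that by auto
    then have tr: "Transposition.transpose p q \<noteq> id"
      by (metis id_apply transpose_apply_first)
    have "{\<sigma>. \<sigma> permutes {p, q}} = {id, Transposition.transpose p q}"
      by (auto simp: permutes_doubleton_iff)
    then show ?thesis
      unfolding D_def using that ne tr tr[symmetric]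
      by (subst fdet_replace_rows[OF _ A]) (auto simp: sign_swap_id)
  qed
  have "(\<Sum>p<N. \<Sum>q\<in>{..<N}-{p}. D {p, q}) = (\<Sum>p<N. \<Sum>q\<in>{..<N}-{p}. (B p p * B q q - B p q * B q p) * fdet N G)"
    by (intro sum.cong refl) (use D2 in auto)
  also have "\<dots> = (\<Sum>p<N. \<Sum>q<N. (B p p * B q q - B p q * B q p) * fdet N G)"
    by (rule sum.cong[OF refl], rule sum.mono_neutral_left) auto
  also have "\<dots> = ((\<Sum>p<N. \<Sum>q<N. B p p * B q q) - (\<Sum>p<N. \<Sum>q<N. B p q * B q p)) * fdet N G"
    by (simp add: sum_distrib_right sum_subtractf left_diff_distrib)
  also have "(\<Sum>p<N. \<Sum>q<N. B p p * B q q) = (\<Sum>p<N. B p p)\<^sup>2"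
    by (simp add: power2_eq_square sum_product)
  finally have 2: "(\<Sum>p<N. \<Sum>q\<in>{..<N}-{p}. D {p, q}) \<le> (\<Sum>p<N. B p p)\<^sup>2 * fdet N G"
    using G B by (simp add: mult_right_mono)
  have 1: "(\<Sum>p<N. D {p}) = (\<Sum>p<N. B p p) * fdet N G"
    by (simp add: D1 sum_distrib_right)
  show ?thesis using 2 unfolding 1 D0 by (simp add: power2_diff algebra_simps)
qed

section \<open>The symbol of the limiting process\<close>


lemma abs_summable_on_times:
  fixes a :: "'a \<Rightarrow> 'c :: {real_normed_field, banach}" and b :: "'b \<Rightarrow> 'c"
  assumes a: "(\<lambda>x. norm (a x)) summable_on A" and b: "(\<lambda>x. norm (b x)) summable_on B"
  shows "(\<lambda>(x, y). norm (a x * b y)) summable_on A \<times> B"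
proof (rule summable_on_SigmaI)
  show "((\<lambda>y. case (x, y) of (x, y) \<Rightarrow> norm (a x * b y)) has_sum norm (a x) * (\<Sum>\<^sub>\<infinity>y\<in>B. norm (b y))) B" for x
    using has_sum_cmult_right[OF has_sum_infsum[OF b], of "norm (a x)"] by (simp add: norm_mult)
qed (use a in \<open>auto intro: summable_on_cmult_left\<close>)

lemma has_sum_times:
  fixes a :: "'a \<Rightarrow> 'c :: {real_normed_field, banach}" and b :: "'b \<Rightarrow> 'c"
  assumes a: "(\<lambda>x. norm (a x)) summable_on A" "(a has_sum S) A"
    and b: "(\<lambda>x. norm (b x)) summable_on B" "(b has_sum T) B"
  shows "((\<lambda>(x, y). a x * b y) has_sum (S * T)) (A \<times> B)"
proof (rule has_sum_SigmaI)
  show "((\<lambda>y. case (x, y) of (x, y) \<Rightarrow> a x * b y) has_sum a x * T) B" for x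
    using has_sum_cmult_right[OF b(2), of "a x"] by simp
  show "((\<lambda>x. a x * T) has_sum S * T) A" by (rule has_sum_cmult_left[OF a(2)])
  show "(\<lambda>(x, y). a x * b y) summable_on A \<times> B"
    by (rule abs_summable_summable) (use abs_summable_on_times[OF a(1) b(1)] in \<open>simp add: case_prod_unfold\<close>)
qed

lemma has_sum_finite_sum:
  fixes f :: "'a \<Rightarrow> 'b \<Rightarrow> 'c :: topological_comm_monoid_add"
  assumes "\<And>r. r \<in> R \<Longrightarrow> (f r has_sum S r) A"
  shows "((\<lambda>x. \<Sum>r\<in>R. f r x) has_sum (\<Sum>r\<in>R. S r)) A"
  using assms by (induction R rule: infinite_finite_induct) (auto intro: has_sum_add)

lemma summable_on_finite_sum:
  fixes f :: "'a \<Rightarrow> 'b \<Rightarrow> 'c :: topological_comm_monoid_add"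
  assumes "\<And>r. r \<in> R \<Longrightarrow> f r summable_on A"
  shows "(\<lambda>x. \<Sum>r\<in>R. f r x) summable_on A"
  using assms by (induction R rule: infinite_finite_induct) (auto intro: summable_on_add)

lemma summable_on_int_shift:
  fixes f :: "int \<Rightarrow> 'a :: {comm_monoid_add, topological_space}"
  shows "(\<lambda>k. f (k + c)) summable_on UNIV \<longleftrightarrow> f summable_on UNIV"
    and "(\<lambda>k. f (c + k)) summable_on UNIV \<longleftrightarrow> f summable_on UNIV"
    and "(\<lambda>k. f (k - c)) summable_on UNIV \<longleftrightarrow> f summable_on UNIV"
    and "(\<lambda>k. f (c - k)) summable_on UNIV \<longleftrightarrow> f summable_on UNIV"
  by (rule summable_on_reindex_bij_betw,
      rule bij_betwI[of _ _ _ "\<lambda>k. k - c"] bij_betwI[of _ _ _ "\<lambda>k. k + c"] bij_betwI[of _ _ _ "\<lambda>k. c - k"]; simp)+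

lemma abs_summable_on_bounded:
  fixes a :: "'a \<Rightarrow> real"
  assumes "(\<lambda>x. norm (a x)) summable_on UNIV"
  obtains C where "0 \<le> C" "\<And>x. norm (a x) \<le> C"
proof
  show "norm (a x) \<le> (\<Sum>\<^sub>\<infinity>x. norm (a x))" for x
    using finite_sum_le_infsum[OF assms, of "{x}"] by simp
  show "0 \<le> (\<Sum>\<^sub>\<infinity>x. norm (a x))" by (rule infsum_nonneg) simp
qed

lemma abs_summable_on_mult_bounded:
  fixes a b :: "'a \<Rightarrow> real"
  assumes a: "(\<lambda>x. norm (a x)) summable_on A" and b: "\<And>x. norm (b x) \<le> C"
  shows "(\<lambda>x. norm (a x * b x)) summable_on A"
proof (rule Infinite_Sum.abs_summable_on_comparison_test')
  show "(\<lambda>x. norm (a x) * C) summable_on A" by (rule summable_on_cmult_left[OF a])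
  show "norm (a x * b x) \<le> norm (a x) * C" for x
    using b[of x] by (simp add: abs_mult mult_left_mono)
qed

lemma abs_summable_on_mult:
  fixes a b :: "'a \<Rightarrow> real"
  assumes "(\<lambda>x. norm (a x)) summable_on UNIV" "(\<lambda>x. norm (b x)) summable_on UNIV"
  shows "(\<lambda>x. norm (a x * b x)) summable_on UNIV"
  by (metis abs_summable_on_bounded[OF assms(2)] abs_summable_on_mult_bounded[OF assms(1)])

text \<open>The Fourier coefficients of the unimodular function
  $\exp \sum_r t_r (z^r - z^{-r})$, see \<open>symbol_fourier\<close> below.\<close>

definition symbol :: "(nat \<Rightarrow> real) \<Rightarrow> int \<Rightarrow> real" where
  "symbol t d = (\<Sum>\<^sub>\<infinity>i. miwa_h t (d + i) * miwa_h (\<lambda>r. - t r) i)"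

text \<open>Finite support makes the generating functions entire, so all coefficient sequences are
  absolutely summable over the integers and the double sums below may be rearranged.\<close>

locale miwa_times =
  fixes m :: nat and t :: "nat \<Rightarrow> real"
  assumes supp: "\<And>r. r > m \<Longrightarrow> t r = 0"
begin

abbreviation h where "h \<equiv> miwa_h t"
abbreviation g where "g \<equiv> miwa_h (\<lambda>r. - t r)"
abbreviation u where "u \<equiv> symbol t"

abbreviation Z where "Z \<equiv> exp (\<Sum>r=1..m. real r * (t r)\<^sup>2)"

lemma supp_neg: "r > m \<Longrightarrow> - t r = 0"
  using supp by simp

lemma h_abs: "(\<lambda>k. norm (h k)) summable_on UNIV"
  using abs_summable_miwa_h[of m t] supp by simp

lemma g_abs: "(\<lambda>k. norm (g k)) summable_on UNIV"
  using abs_summable_miwa_h[of m "\<lambda>r. - t r"] supp by simp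

lemma hg_abs: "(\<lambda>(d, i). norm (h (d + i) * g i)) summable_on UNIV \<times> UNIV"
proof -
  have "bij_betw (\<lambda>(d, i). (d + i, i)) (UNIV \<times> UNIV) (UNIV \<times> (UNIV :: int set))"
    by (rule bij_betwI[of _ _ _ "\<lambda>(x, i). (x - i, i)"]) auto
  from summable_on_reindex_bij_betw[OF this, of "\<lambda>(x, y). norm (h x * g y)"] abs_summable_on_times[OF h_abs g_abs]
  show ?thesis by (simp add: case_prod_unfold)
qed

lemma hg_row_abs: "(\<lambda>i. norm (h (d + i) * g i)) summable_on UNIV"
  by (rule abs_summable_on_mult[OF _ g_abs]) (use summable_on_int_shift(2)[of "\<lambda>k. norm (h k)" d] h_abs in simp)

lemma u_has_sum: "((\<lambda>i. h (d + i) * g i) has_sum u d) UNIV"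
  unfolding symbol_def by (rule has_sum_infsum[OF abs_summable_summable[OF hg_row_abs]])

lemma u_abs: "(\<lambda>d. norm (u d)) summable_on UNIV"
proof (rule Infinite_Sum.abs_summable_on_comparison_test')
  show "(\<lambda>d. \<Sum>\<^sub>\<infinity>i. norm (h (d + i) * g i)) summable_on UNIV"
    using summable_on_Sigma_banach[OF hg_abs] by simp
  show "norm (u d) \<le> (\<Sum>\<^sub>\<infinity>i. norm (h (d + i) * g i))" for d
    unfolding symbol_def by (rule norm_infsum_bound[OF hg_row_abs])
qed

lemma convolution_hg: "((\<lambda>j. g j * h (n - j)) has_sum (if n = 0 then 1 else 0)) UNIV"
proof (cases "n < 0")
  case True
  then have "g j * h (n - j) = 0" for j by (cases "j < 0") auto
  then have "((\<lambda>j. g j * h (n - j)) has_sum 0) UNIV" by (intro has_sum_0) blast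
  then show ?thesis using True by simp
next
  case False
  then obtain n' where n: "n = int n'" using nonneg_int_cases by (metis not_le)
  have "((\<lambda>j. g j * h (n - j)) has_sum (\<Sum>j\<in>{0..n}. g j * h (n - j))) UNIV"
    by (rule has_sum_finite_neutralI) auto
  also have "(\<Sum>j\<in>{0..n}. g j * h (n - j)) = (\<Sum>i=0..n'. g (int i) * h (int (n' - i)))"
    by (rule sum.reindex_bij_witness[of _ int nat]) (auto simp: n of_nat_diff)
  also have "\<dots> = (if n = 0 then 1 else 0)" using miwa_h_convolution_uminus[of t n'] by (simp add: n)
  finally show ?thesis .
qed

text \<open>\<open>u\<close> correlates \<open>h\<close> with \<open>g\<close>; pairing with
  \<open>h\<close> once more cancels \<open>g\<close>, by \<open>convolution_hg\<close>. Every
  translate of \<open>h\<close> is thereby expanded in translates of \<open>u\<close>.\<close>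

lemma h_eq_u_h: "((\<lambda>i. u (k + i) * h i) has_sum h k) UNIV"
proof -
  obtain C where C: "0 \<le> C" "\<And>x. norm (h x) \<le> C" using abs_summable_on_bounded[OF h_abs] by auto
  \<comment> \<open>The double series is indexed by the total shift n = i + j, so that the inner sum
    is the convolution of \<open>g\<close> with \<open>h\<close>, which is concentrated at n =
    0.\<close>
  define f where "f = (\<lambda>(n, j). h (k + n) * (g j * h (n - j)))"
  have bij: "bij_betw (\<lambda>(i, j). (i + j, j)) (UNIV \<times> UNIV) (UNIV \<times> (UNIV :: int set))"
    by (rule bij_betwI[of _ _ _ "\<lambda>(n, j). (n - j, j)"]) auto
  have "(\<lambda>(i, j). norm (h i * g j) * C) summable_on UNIV \<times> UNIV"
    using summable_on_cmult_left[OF abs_summable_on_times[OF h_abs g_abs], of C] by (simp add: case_prod_unfold)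
  then have "(\<lambda>(i, j). norm (h (k + (i + j)) * (g j * h i))) summable_on UNIV \<times> UNIV"
  proof (rule summable_on_comparison_test, clarsimp)
    fix i j show "\<bar>h (k + (i + j)) * (g j * h i)\<bar> \<le> \<bar>h i * g j\<bar> * C"
      using mult_right_mono[OF C(2)[of "k + (i + j)"], of "\<bar>h i * g j\<bar>"] by (simp add: abs_mult mult_ac)
  qed auto
  then have "(\<lambda>x. norm (f x)) summable_on UNIV \<times> UNIV"
    using summable_on_reindex_bij_betw[OF bij, of "\<lambda>x. norm (f x)"] by (simp add: f_def case_prod_unfold)
  then have fs: "f summable_on UNIV \<times> UNIV" by (rule abs_summable_summable)
  have "((\<lambda>j. f (n, j)) has_sum h (k + n) * (if n = 0 then 1 else 0)) UNIV" for n
    unfolding f_def using has_sum_cmult_right[OF convolution_hg] by simp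
  moreover have "((\<lambda>n. h (k + n) * (if n = 0 then 1 else 0)) has_sum h k) UNIV"
    by (rule has_sum_finite_neutralI[of "{0}"]) auto
  ultimately have "(f has_sum h k) (UNIV \<times> UNIV)" by (intro has_sum_SigmaI fs)
  then have "((\<lambda>(i, j). h (k + (i + j)) * (g j * h i)) has_sum h k) (UNIV \<times> UNIV)"
    using has_sum_reindex_bij_betw[OF bij, of f] by (simp add: f_def case_prod_unfold)
  then show ?thesis
  proof (rule has_sum_SigmaD)
    show "((\<lambda>j. case (i, j) of (i, j) \<Rightarrow> h (k + (i + j)) * (g j * h i)) has_sum u (k + i) * h i) UNIV" for i
      using has_sum_cmult_left[OF u_has_sum[of "k + i"], of "h i"] by (simp add: mult_ac add_ac)
  qed
qed

text \<open>Writing d as (d + i) - i lets Newton's identity act on both factors. For m = 1 this is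
  the three-term recurrence of the Bessel functions J_d(2 t_1).\<close>

lemma u_recurrence:
  "of_int d * u d = (\<Sum>r=1..m. real r * t r * (u (d - int r) + u (d + int r)))"
proof -
  have hr: "of_int k * h k = (\<Sum>r=1..m. real r * t r * h (k - int r))" for k
    by (rule miwa_h_recurrence[OF supp])
  have gr: "of_int k * g k = - (\<Sum>r=1..m. real r * t r * g (k - int r))" for k
    using miwa_h_recurrence[of m "\<lambda>r. - t r" k] supp by (simp add: sum_negf)
  have shift: "((\<lambda>i. h (d + i) * g (i - int r)) has_sum u (d + int r)) UNIV" for r
  proof -
    have "bij_betw (\<lambda>i. i - int r) UNIV UNIV" by (rule bij_betwI[of _ _ _ "\<lambda>i. i + int r"]) auto
    from has_sum_reindex_bij_betw[OF this, of "\<lambda>i. h (d + int r + i) * g i"] u_has_sum[of "d + int r"]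
    show ?thesis by (simp add: algebra_simps)
  qed
  have "((\<lambda>i. of_int d * (h (d + i) * g i)) has_sum of_int d * u d) UNIV"
    by (rule has_sum_cmult_right[OF u_has_sum])
  moreover have "((\<lambda>i. of_int d * (h (d + i) * g i)) has_sum (\<Sum>r=1..m. real r * t r * (u (d - int r) + u (d + int r)))) UNIV"
  proof -
    have "of_int d * (h (d + i) * g i) = (\<Sum>r=1..m. real r * t r * (h (d - int r + i) * g i + h (d + i) * g (i - int r)))" for i
    proof -
      have "of_int d * (h (d + i) * g i) = (of_int (d + i) * h (d + i)) * g i - h (d + i) * (of_int i * g i)"
        by (simp add: algebra_simps)
      then show ?thesis
        unfolding hr gr by (simp add: sum_distrib_left sum_distrib_right sum.distrib[symmetric] algebra_simps)
    qed
    moreover have "((\<lambda>i. \<Sum>r=1..m. real r * t r * (h (d - int r + i) * g i + h (d + i) * g (i - int r))) has_sum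
       (\<Sum>r=1..m. real r * t r * (u (d - int r) + u (d + int r)))) UNIV"
      by (intro has_sum_finite_sum has_sum_cmult_right has_sum_add u_has_sum shift)
    ultimately show ?thesis by simp
  qed
  ultimately show ?thesis by (rule has_sum_unique)
qed

end

section \<open>Gram matrices and convergence of kernels\<close>


lemma summable_on_nat_imp_sums:
  fixes f :: "nat \<Rightarrow> real"
  assumes "(\<lambda>x. norm (f x)) summable_on UNIV"
  shows "f sums suminf f"
  using has_sum_imp_sums[OF has_sum_infsum[OF abs_summable_summable[OF assms]]] sums_summable summable_sums by blast

context miwa_times
begin

definition gram :: "nat \<Rightarrow> nat \<Rightarrow> real" where
  "gram i j = (\<Sum>\<^sub>\<infinity>k. h (k + int i) * h (k + int j))"

text \<open>The density of the limiting process of positions at \<open>x\<close>.\<close>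

definition \<kappa> :: "int \<Rightarrow> real" where
  "\<kappa> x = (\<Sum>n. (u (x + int n))\<^sup>2)"

lemma gram_has_sum: "((\<lambda>k. h (k + int i) * h (k + int j)) has_sum gram i j) UNIV"
  unfolding gram_def
proof (rule has_sum_infsum[OF abs_summable_summable], rule abs_summable_on_mult)
  show "(\<lambda>k. norm (h (k + int i))) summable_on UNIV" for i
    using summable_on_int_shift(1)[of "\<lambda>k. norm (h k)" "int i"] h_abs by simp
  then show "(\<lambda>k. norm (h (k + int j))) summable_on UNIV" .
qed

lemma gram_sym: "gram i j = gram j i"
  by (simp add: gram_def mult.commute)

text \<open>Setting n = k + i + j exchanges the two translates and puts the sum on n >= 0, where it
  is the inner product of the coordinate sequences h(n - i) and h(n - j).\<close>

lemma gram_sums: "(\<lambda>n. h (int n - int i) * h (int n - int j)) sums gram i j"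
proof -
  have "bij_betw (\<lambda>k. k - int i - int j) UNIV UNIV"
    by (rule bij_betwI[of _ _ _ "\<lambda>k. k + int i + int j"]) auto
  from has_sum_reindex_bij_betw[OF this, of "\<lambda>k. h (k + int i) * h (k + int j)"] gram_has_sum
  have "((\<lambda>k. h (k - int j) * h (k - int i)) has_sum gram i j) UNIV" by simp
  then have "((\<lambda>n. h (int n - int j) * h (int n - int i)) has_sum gram i j) UNIV"
    by (subst (asm) has_sum_int_nonneg_iff) auto
  from has_sum_imp_sums[OF this] show ?thesis by (simp add: mult.commute)
qed

lemma u_nat_abs: "(\<lambda>n. norm (u (x + int n))) summable_on UNIV"
proof -
  have "(\<lambda>k. norm (u (x + k))) summable_on UNIV" using summable_on_int_shift(2)[of "\<lambda>k. norm (u k)" x] u_abs by simp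
  then have "(\<lambda>k. norm (u (x + k))) summable_on range int" by (rule summable_on_subset_banach) simp
  then show ?thesis by (subst (asm) summable_on_reindex) (auto simp: o_def inj_on_def)
qed

lemma \<kappa>_sums: "(\<lambda>n. (u (x + int n))\<^sup>2) sums \<kappa> x"
  unfolding \<kappa>_def power2_eq_square
  by (rule summable_on_nat_imp_sums) (intro abs_summable_on_mult u_nat_abs)

text \<open>In the system u(_ + n) with n >= 0, the function h(_ + j) has coordinates h(n - j): zero
  for n < j and one at n = j.\<close>

lemma h_sums_u: "(\<lambda>n. h (int n - int j) * u (x + int n)) sums h (x + int j)"
proof -
  have "bij_betw (\<lambda>k. k - int j) UNIV UNIV"
    by (rule bij_betwI[of _ _ _ "\<lambda>k. k + int j"]) auto
  from has_sum_reindex_bij_betw[OF this, of "\<lambda>i. u (x + int j + i) * h i"] h_eq_u_h[of "x + int j"]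
  have "((\<lambda>k. h (k - int j) * u (x + k)) has_sum h (x + int j)) UNIV" by (simp add: mult.commute)
  then have "((\<lambda>n. h (int n - int j) * u (x + int n)) has_sum h (x + int j)) UNIV"
    by (subst (asm) has_sum_int_nonneg_iff) auto
  then show ?thesis by (rule has_sum_imp_sums)
qed

lemma gram_form_sums:
  "(\<lambda>n. (\<Sum>j<N. y j * h (int n - int j)) * (\<Sum>j<N. z j * h (int n - int j))) sums (\<Sum>i<N. \<Sum>j<N. y i * z j * gram i j)"
proof -
  have "(\<lambda>n. \<Sum>i<N. \<Sum>j<N. y i * z j * (h (int n - int i) * h (int n - int j))) sums (\<Sum>i<N. \<Sum>j<N. y i * z j * gram i j)"
    by (intro sums_sum sums_mult gram_sums)
  then show ?thesis by (simp add: sum_product mult_ac)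
qed

text \<open>The squared distance from \<open>\<Sum>j<N. y j * h (_ + j)\<close> to the projection of the unit vector at \<open>x\<close>,
  in the coordinates of the orthonormal system of translates of \<open>u\<close>.\<close>

lemma distance_sums:
  "(\<lambda>n. ((\<Sum>j<N. y j * h (int n - int j)) - u (x + int n))\<^sup>2) sums
     ((\<Sum>i<N. \<Sum>j<N. y i * y j * gram i j) - 2 * (\<Sum>j<N. y j * h (x + int j)) + \<kappa> x)"
proof -
  have "(\<lambda>n. (\<Sum>j<N. y j * h (int n - int j))\<^sup>2 + (u (x + int n))\<^sup>2 - 2 * (\<Sum>j<N. y j * (h (int n - int j) * u (x + int n)))) sums
     ((\<Sum>i<N. \<Sum>j<N. y i * y j * gram i j) + \<kappa> x - 2 * (\<Sum>j<N. y j * h (x + int j)))"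
    unfolding power2_eq_square[of "sum _ _"]
    by (intro sums_add sums_diff gram_form_sums sums_mult sums_sum h_sums_u \<kappa>_sums)
  moreover have "(\<Sum>j<N. y j * (h (int n - int j) * u (x + int n))) = (\<Sum>j<N. y j * h (int n - int j)) * u (x + int n)" for n
    by (simp add: sum_distrib_right mult.assoc)
  moreover have "(\<Sum>i<N. \<Sum>j<N. y i * y j * gram i j) + \<kappa> x - 2 * (\<Sum>j<N. y j * h (x + int j))
     = (\<Sum>i<N. \<Sum>j<N. y i * y j * gram i j) - 2 * (\<Sum>j<N. y j * h (x + int j)) + \<kappa> x" by simp
  ultimately show ?thesis by (simp only: power2_diff mult.assoc)
qed

lemma gram_form_nonneg: "0 \<le> (\<Sum>i<N. \<Sum>j<N. y i * y j * gram i j)"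
  using sums_le[OF _ sums_zero gram_form_sums[of y N y]] by simp

text \<open>The form is a sum of squares of coordinates, and these are unitriangular in y, so the
  entries of y vanish one after another.\<close>

lemma gram_form_definite:
  assumes "(\<Sum>i<N. \<Sum>j<N. y i * y j * gram i j) = 0" "n < N"
  shows "y n = 0"
  using assms(2)
proof (induction n rule: less_induct)
  case (less n)
  let ?f = "\<lambda>n. (\<Sum>j<N. y j * h (int n - int j)) * (\<Sum>j<N. y j * h (int n - int j))"
  have "?f sums 0" using gram_form_sums[of y N y] assms(1) by simp
  then have "?f n = 0" using suminf_eq_zero_iff[of ?f] by (simp add: sums_iff)
  then have "0 = (\<Sum>j<N. y j * h (int n - int j))" by simp
  also have "\<dots> = (\<Sum>j<N. if j = n then y n else 0)"
  proof (rule sum.cong[OF refl])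
    fix j assume "j \<in> {..<N}"
    then show "y j * h (int n - int j) = (if j = n then y n else 0)"
      using less.IH[of j] by (cases j n rule: linorder_cases) auto
  qed
  finally show ?case using less.prems by simp
qed

lemma fdet_gram_nonzero: "fdet N gram \<noteq> 0"
proof
  assume "fdet N gram = 0"
  then obtain v where v: "v \<in> carrier_vec N" "v \<noteq> 0\<^sub>v N" "mat N N (\<lambda>(i, j). gram i j) *\<^sub>v v = 0\<^sub>v N"
    unfolding fdet_def by (subst (asm) det_0_iff_vec_prod_zero_field[of _ N]) auto
  have row: "(\<Sum>j<N. gram i j * v $ j) = 0" if "i < N" for i
    using arg_cong[OF v(3), of "\<lambda>w. vec_index w i"] v(1) that by (simp add: scalar_prod_def atLeast0LessThan)
  have "(\<Sum>i<N. \<Sum>j<N. v $ i * v $ j * gram i j) = (\<Sum>i<N. v $ i * (\<Sum>j<N. gram i j * v $ j))"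
    by (simp add: sum_distrib_left mult_ac)
  also have "\<dots> = 0" using row by simp
  finally have "v $ n = 0" if "n < N" for n by (rule gram_form_definite) (rule that)
  then have "v = 0\<^sub>v N" using v(1) by (intro eq_vecI) auto
  with v(2) show False ..
qed

text \<open>Cramer's rule for the Gram system with right-hand side h(x + q): the coefficients of the
  orthogonal projection of the unit vector at x onto the span of N translates of
  \<open>h\<close>.\<close>

definition sol :: "nat \<Rightarrow> int \<Rightarrow> nat \<Rightarrow> real" where
  "sol N x r = (\<Sum>q<N. h (x + int q) * fcof N gram q r) / fdet N gram"

lemma gram_sol:
  assumes "p < N"
  shows "(\<Sum>r<N. gram p r * sol N x r) = h (x + int p)"
proof -
  have "(\<Sum>r<N. gram p r * fcof N gram q r) = (if q = p then fdet N gram else 0)" if "q < N" for q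
  proof -
    have "(\<Sum>r<N. gram p r * fcof N gram q r) = fdet N (gram(q := gram p))"
      by (rule fdet_row_expand[symmetric, OF that])
    also have "\<dots> = (if q = p then fdet N gram else 0)"
      using assms that by (auto intro: fdet_identical_rows[of p N q])
    finally show ?thesis .
  qed
  then have "(\<Sum>q<N. h (x + int q) * (\<Sum>r<N. gram p r * fcof N gram q r)) = h (x + int p) * fdet N gram"
    using assms by (simp add: if_distrib[where f = "(*) _"] cong: if_cong)
  moreover have "(\<Sum>r<N. gram p r * sol N x r) = (\<Sum>q<N. h (x + int q) * (\<Sum>r<N. gram p r * fcof N gram q r)) / fdet N gram"
    unfolding sol_def sum_distrib_left sum_divide_distrib[symmetric] times_divide_eq_right
    by (subst sum.swap) (simp add: mult_ac)
  ultimately show ?thesis using fdet_gram_nonzero by simp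
qed

text \<open>The correlation kernel of the ensemble with N rows, that is the matrix of this
  projection.\<close>

definition \<kappa>N :: "nat \<Rightarrow> int \<Rightarrow> int \<Rightarrow> real" where
  "\<kappa>N N x x' = (\<Sum>j<N. sol N x j * h (x' + int j))"

lemma gram_form_sol: "(\<Sum>i<N. \<Sum>j<N. y i * sol N x j * gram i j) = (\<Sum>i<N. y i * h (x + int i))"
proof -
  have "(\<Sum>i<N. \<Sum>j<N. y i * sol N x j * gram i j) = (\<Sum>i<N. y i * (\<Sum>j<N. gram i j * sol N x j))"
    by (simp add: sum_distrib_left mult_ac)
  then show ?thesis by (simp add: gram_sol)
qed

lemma \<kappa>N_sym: "\<kappa>N N x x' = \<kappa>N N x' x"
proof -
  have "\<kappa>N N x x' = (\<Sum>i<N. \<Sum>j<N. sol N x i * sol N x' j * gram i j)"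
    by (simp add: gram_form_sol \<kappa>N_def)
  also have "\<dots> = (\<Sum>i<N. \<Sum>j<N. sol N x' i * sol N x j * gram i j)"
    by (subst sum.swap) (simp add: gram_sym mult_ac)
  finally show ?thesis by (simp add: gram_form_sol \<kappa>N_def)
qed

text \<open>At the coefficients \<open>sol\<close> the squared distance of
  \<open>distance_sums\<close> equals \<kappa> x - \<kappa>N N x x.\<close>

lemma \<kappa>N_le: "\<kappa>N N x x \<le> \<kappa> x"
proof -
  have "0 \<le> (\<Sum>i<N. \<Sum>j<N. sol N x i * sol N x j * gram i j) - 2 * (\<Sum>j<N. sol N x j * h (x + int j)) + \<kappa> x"
    by (rule sums_le[OF _ sums_zero distance_sums]) simp
  then show ?thesis by (simp add: gram_form_sol \<kappa>N_def)
qed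

text \<open>Completing the square: the two sides differ by the Gram form at y - \<open>sol\<close>.
  Any trial vector y hence bounds the kernel from below.\<close>

lemma \<kappa>N_ge: "2 * (\<Sum>j<N. y j * h (x + int j)) - (\<Sum>i<N. \<Sum>j<N. y i * y j * gram i j) \<le> \<kappa>N N x x"
proof -
  define s where "s = sol N x"
  have cross: "(\<Sum>i<N. \<Sum>j<N. y i * s j * gram i j) = (\<Sum>i<N. y i * h (x + int i))"
    unfolding s_def by (rule gram_form_sol)
  have cross': "(\<Sum>i<N. \<Sum>j<N. s i * y j * gram i j) = (\<Sum>i<N. y i * h (x + int i))"
    unfolding cross[symmetric] by (subst sum.swap) (simp add: gram_sym mult_ac)
  have self: "(\<Sum>i<N. \<Sum>j<N. s i * s j * gram i j) = \<kappa>N N x x"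
    unfolding s_def by (simp add: gram_form_sol \<kappa>N_def)
  have "0 \<le> (\<Sum>i<N. \<Sum>j<N. (y i - s i) * (y j - s j) * gram i j)" by (rule gram_form_nonneg)
  also have "\<dots> = (\<Sum>i<N. \<Sum>j<N. y i * y j * gram i j) - (\<Sum>i<N. \<Sum>j<N. y i * s j * gram i j)
      - (\<Sum>i<N. \<Sum>j<N. s i * y j * gram i j) + (\<Sum>i<N. \<Sum>j<N. s i * s j * gram i j)"
    by (simp add: sum_subtractf[symmetric] sum.distrib[symmetric] algebra_simps)
  finally show ?thesis unfolding cross cross' self by simp
qed

text \<open>The truncation to \<open>N\<close> columns of the expansion of the projected unit vector at \<open>x\<close> shows that
  the finite kernels converge.\<close>

lemma \<kappa>N_tendsto: "(\<lambda>N. \<kappa>N N x x) \<longlonglongrightarrow> \<kappa> x"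
proof -
  define U where "U = Abs_fps (\<lambda>n. u (x + int n))"
  \<comment> \<open>Dividing the series of coordinates of the target by the series of
    \<open>h\<close> solves the triangular system exactly, so the first N columns reproduce the
    first N coordinates.\<close>
  define y where "y = fps_nth (U * miwa_fps (\<lambda>r. - t r))"
  define p where "p N n = (\<Sum>j<N. y j * h (int n - int j))" for N n
  have p_small: "p N n = u (x + int n)" if "n < N" for N n
  proof -
    have "p N n = (\<Sum>j=0..n. y j * fps_nth (miwa_fps t) (n - j))"
      unfolding p_def
      by (rule sum.mono_neutral_cong_right) (use that in \<open>auto simp: miwa_h_of_nat[symmetric] of_nat_diff\<close>)
    also have "\<dots> = fps_nth (U * miwa_fps (\<lambda>r. - t r) * miwa_fps t) n"
      by (simp add: fps_mult_nth y_def)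
    also have "\<dots> = u (x + int n)" by (simp add: mult.assoc miwa_fps_uminus U_def)
    finally show ?thesis .
  qed
  have nat_abs: "summable (\<lambda>n. norm (a (int n)))" if "(\<lambda>k::int. norm (a k)) summable_on UNIV" for a :: "int \<Rightarrow> real"
  proof -
    have "(\<lambda>k. norm (a k)) summable_on range int" using that by (rule summable_on_subset_banach) simp
    then have "(\<lambda>n. norm (a (int n))) summable_on UNIV"
      by (subst (asm) summable_on_reindex) (auto simp: o_def inj_on_def)
    then show ?thesis by (rule summable_on_imp_summable)
  qed
  have su: "summable (\<lambda>n. norm (u (x + int n)))" using u_nat_abs by (rule summable_on_imp_summable)
  define Y where "Y n = (\<Sum>i\<le>n. norm (u (x + int i)) * norm (g (int (n - i))))" for n
  have sY: "summable Y"
    unfolding Y_def by (rule summable_Cauchy_product) (use su nat_abs[OF g_abs] in simp_all)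
  have Y0: "0 \<le> Y n" for n unfolding Y_def by (rule sum_nonneg) simp
  have yY: "\<bar>y n\<bar> \<le> Y n" for n
    unfolding y_def fps_mult_nth U_def Y_def atLeast0AtMost miwa_h_of_nat[symmetric]
    by (rule order.trans[OF sum_abs]) (simp add: abs_mult)
  \<comment> \<open>A bound for the error in coordinate n that does not depend on N. It is summable
    as a Cauchy product of absolutely summable series, and so is its square.\<close>
  define c where "c n = norm (u (x + int n)) + (\<Sum>j\<le>n. Y j * norm (h (int (n - j))))" for n
  have sc: "summable c"
    unfolding c_def
    by (intro summable_add su summable_Cauchy_product) (use sY Y0 nat_abs[OF h_abs] in simp_all)
  have c0: "0 \<le> c n" for n unfolding c_def using Y0 by (intro add_nonneg_nonneg sum_nonneg) auto
  have "(\<lambda>n. norm (c n)) summable_on UNIV"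
    using sc c0 by (simp add: summable_on_UNIV_nonneg_real_iff)
  then have sc2: "summable (\<lambda>n. (c n)\<^sup>2)"
    unfolding power2_eq_square by (intro sums_summable[OF summable_on_nat_imp_sums] abs_summable_on_mult)
  have bound: "(p N n - u (x + int n))\<^sup>2 \<le> (if n < N then 0 else (c n)\<^sup>2)" for N n
  proof (cases "n < N")
    case False
    have "\<bar>p N n\<bar> \<le> (\<Sum>j<N. Y j * norm (h (int n - int j)))"
      unfolding p_def by (rule order.trans[OF sum_abs]) (auto simp: abs_mult intro!: sum_mono mult_right_mono yY)
    also have "\<dots> \<le> (\<Sum>j\<le>n. Y j * norm (h (int n - int j)))"
      by (rule sum_mono2) (use False Y0 in auto)
    also have "\<dots> = (\<Sum>j\<le>n. Y j * norm (h (int (n - j))))"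
      by (rule sum.cong) (auto simp: of_nat_diff)
    finally have "\<bar>p N n - u (x + int n)\<bar> \<le> c n"
      unfolding c_def real_norm_def by linarith
    then have "\<bar>p N n - u (x + int n)\<bar>\<^sup>2 \<le> (c n)\<^sup>2" by (intro power_mono) auto
    then show ?thesis using False by simp
  qed (simp add: p_small)
  have lower: "\<kappa> x - (suminf (\<lambda>n. (c n)\<^sup>2) - (\<Sum>n<N. (c n)\<^sup>2)) \<le> \<kappa>N N x x" for N
  proof -
    have "(\<lambda>n. if n < N then 0 else (c n)\<^sup>2) sums (suminf (\<lambda>n. (c n)\<^sup>2) - (\<Sum>n<N. (c n)\<^sup>2))"
    proof -
      have "(\<lambda>n. (c n)\<^sup>2 - (if n \<in> {..<N} then (c n)\<^sup>2 else 0)) sums (suminf (\<lambda>n. (c n)\<^sup>2) - (\<Sum>n\<in>{..<N}. (c n)\<^sup>2))"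
        by (intro sums_diff summable_sums[OF sc2] sums_If_finite_set) simp
      moreover have "(\<lambda>n. (c n)\<^sup>2 - (if n \<in> {..<N} then (c n)\<^sup>2 else 0)) = (\<lambda>n. if n < N then 0 else (c n)\<^sup>2)"
        by auto
      ultimately show ?thesis by simp
    qed
    from sums_le[OF bound distance_sums[where N = N and y = y and x = x, folded p_def] this]
    show ?thesis using \<kappa>N_ge[where N = N and y = y and x = x] by linarith
  qed
  have "(\<lambda>N. \<kappa> x - (suminf (\<lambda>n. (c n)\<^sup>2) - (\<Sum>n<N. (c n)\<^sup>2))) \<longlonglongrightarrow> \<kappa> x - (suminf (\<lambda>n. (c n)\<^sup>2) - suminf (\<lambda>n. (c n)\<^sup>2))"
    by (intro tendsto_intros summable_LIMSEQ sc2)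
  then have lim: "(\<lambda>N. \<kappa> x - (suminf (\<lambda>n. (c n)\<^sup>2) - (\<Sum>n<N. (c n)\<^sup>2))) \<longlonglongrightarrow> \<kappa> x" by simp
  show ?thesis
    by (rule tendsto_sandwich[OF _ _ lim tendsto_const]) (simp_all add: lower \<kappa>N_le)
qed

end

section \<open>Variance of the number of particles\<close>


text \<open>The points of \<open>point_config\<close> shifted by 1/2, hence integers.\<close>

definition particles :: "nat list \<Rightarrow> int set" where
  "particles p = {int (part p (i + 1)) - int i | i. True}"

lemma finite_int_set_bounded:
  fixes X :: "int set"
  assumes "finite X"
  obtains B where "\<And>k. k \<in> X \<Longrightarrow> \<bar>k\<bar> \<le> B"
proof
  fix k assume "k \<in> X"
  then show "\<bar>k\<bar> \<le> (\<Sum>k\<in>X. \<bar>k\<bar>)" using assms by (intro member_le_sum) auto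
qed

lemma has_sum_int_imp_tendsto:
  fixes f :: "int \<Rightarrow> real"
  assumes "(f has_sum S) UNIV"
  shows "(\<lambda>L. \<Sum>k\<in>{- int L..int L}. f k) \<longlonglongrightarrow> S"
proof -
  have "filterlim (\<lambda>L. {- int L..int L}) (finite_subsets_at_top UNIV) sequentially"
    unfolding filterlim_finite_subsets_at_top
  proof (intro allI impI)
    fix X :: "int set" assume "finite X \<and> X \<subseteq> UNIV"
    then have "finite X" by simp
    then obtain B where B: "\<And>k. k \<in> X \<Longrightarrow> \<bar>k\<bar> \<le> B"
      using finite_int_set_bounded by blast
    show "\<forall>\<^sub>F L in sequentially. finite {- int L..int L} \<and> X \<subseteq> {- int L..int L} \<and> {- int L..int L} \<subseteq> UNIV"
      using eventually_ge_at_top[of "nat B"]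
    proof eventually_elim
      case (elim L)
      have "k \<in> {- int L..int L}" if "k \<in> X" for k using B[OF that] elim by auto
      then show ?case by auto
    qed
  qed
  then show ?thesis using assms unfolding has_sum_def by (rule filterlim_compose[rotated])
qed

lemma sum_partitions_eq_sum_PiE:
  fixes w :: "int \<Rightarrow> real" and N :: nat
  assumes "finite X"
  defines "L \<equiv> {p. is_partition p \<and> length p \<le> N \<and> positions N p \<in> PiE {..<N} (\<lambda>_. X)}"
  shows "finite L"
    and "(\<Sum>x\<in>PiE {..<N} (\<lambda>_. X). (alternant t N x)\<^sup>2 * ((\<Sum>i<N. w (x i)) - \<mu>)\<^sup>2)
      = fact N * (\<Sum>p\<in>L. (schur t p)\<^sup>2 * ((\<Sum>i<N. w (positions N p i)) - \<mu>)\<^sup>2)"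
    and "(\<Sum>x\<in>PiE {..<N} (\<lambda>_. X). (alternant t N x)\<^sup>2) = fact N * (\<Sum>p\<in>L. (schur t p)\<^sup>2)"
proof -
  let ?D = "PiE {..<N} (\<lambda>_. X)"
  have fin: "finite ?D" using assms(1) by (intro finite_PiE) auto
  have perm: "x \<circ> q \<in> ?D" if "x \<in> ?D" "q permutes {..<N}" for x q
  proof (rule PiE_I)
    fix i assume "i \<in> {..<N}"
    then have "q i \<in> {..<N}" using permutes_in_image[OF that(2)] by simp
    then show "(x \<circ> q) i \<in> X" using that(1) by (auto simp: PiE_def Pi_def)
  next
    fix i assume "i \<notin> {..<N}"
    then show "(x \<circ> q) i = undefined" using that permutes_not_in[OF that(2)] by (auto simp: PiE_def extensional_def)
  qed
  have sump: "(\<Sum>i<N. w ((x \<circ> q) i)) = (\<Sum>i<N. w (x i))" if "q permutes {..<N}" for x q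
    using sum.permute[OF that, of "w \<circ> x"] by (simp add: o_def)
  have ext: "?D \<subseteq> extensional {..<N}" by (auto simp: PiE_def)
  note tp = sum_tuples_eq_sum_partitions[where D = ?D and N = N, OF fin ext perm]
  show "finite L" unfolding L_def
    by (rule tp(1)[where F = "\<lambda>_. 0"]) simp_all
  define F where "F x = (alternant t N x)\<^sup>2 * ((\<Sum>i<N. w (x i)) - \<mu>)\<^sup>2" for x
  have "(\<Sum>x\<in>?D. F x) = fact N * (\<Sum>p\<in>L. F (positions N p))"
    unfolding L_def
  proof (rule tp(2))
    show "F (x \<circ> q) = F x" if "q permutes {..<N}" for x q
      unfolding F_def alternant_permute[OF that] sump[OF that] ..
    show "F x = 0" if "\<not> inj_on x {..<N}" for x
      by (simp add: F_def alternant_not_inj[OF that])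
    show "F x = 0" if "i < N" "x i \<le> - int N" for x i
      by (simp add: F_def alternant_too_low[of i N x, OF that])
  qed
  also have "(\<Sum>p\<in>L. F (positions N p)) = (\<Sum>p\<in>L. (schur t p)\<^sup>2 * ((\<Sum>i<N. w (positions N p i)) - \<mu>)\<^sup>2)"
  proof (rule sum.cong[OF refl])
    fix p assume "p \<in> L"
    then have "length p \<le> N" by (simp add: L_def)
    then show "F (positions N p) = (schur t p)\<^sup>2 * ((\<Sum>i<N. w (positions N p i)) - \<mu>)\<^sup>2"
      by (simp add: F_def schur_eq_alternant)
  qed
  finally show "(\<Sum>x\<in>?D. (alternant t N x)\<^sup>2 * ((\<Sum>i<N. w (x i)) - \<mu>)\<^sup>2)
      = fact N * (\<Sum>p\<in>L. (schur t p)\<^sup>2 * ((\<Sum>i<N. w (positions N p i)) - \<mu>)\<^sup>2)" unfolding F_def .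
  have "(\<Sum>x\<in>?D. (alternant t N x)\<^sup>2) = fact N * (\<Sum>p\<in>L. (alternant t N (positions N p))\<^sup>2)"
    unfolding L_def
  proof (rule tp(2))
    show "(alternant t N (x \<circ> q))\<^sup>2 = (alternant t N x)\<^sup>2" if "q permutes {..<N}" for x q
      by (rule alternant_permute[OF that])
    show "(alternant t N x)\<^sup>2 = 0" if "\<not> inj_on x {..<N}" for x
      by (simp add: alternant_not_inj[OF that])
    show "(alternant t N x)\<^sup>2 = 0" if "i < N" "x i \<le> - int N" for x i
      by (simp add: alternant_too_low[of i N x, OF that])
  qed
  also have "(\<Sum>p\<in>L. (alternant t N (positions N p))\<^sup>2) = (\<Sum>p\<in>L. (schur t p)\<^sup>2)"
  proof (rule sum.cong[OF refl])
    fix p assume "p \<in> L"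
    then have "length p \<le> N" by (simp add: L_def)
    then show "(alternant t N (positions N p))\<^sup>2 = (schur t p)\<^sup>2"
      by (simp add: schur_eq_alternant)
  qed
  finally show "(\<Sum>x\<in>?D. (alternant t N x)\<^sup>2) = fact N * (\<Sum>p\<in>L. (schur t p)\<^sup>2)" .
qed

context miwa_times
begin

lemma gram_tendsto:
  "(\<lambda>L. \<Sum>k\<in>{- int L..int L}. h (k + int p) * h (k + int q)) \<longlonglongrightarrow> gram p q"
  by (rule has_sum_int_imp_tendsto[OF gram_has_sum])

text \<open>By Andreief's identity with no marked coordinate, the determinant is the total weight of
  partitions with at most N rows, obtained as the limit over growing boxes; the Cauchy identity
  bounds it by \<open>Z\<close>.\<close>

lemma fdet_gram_bounds: "0 \<le> fdet N gram" "fdet N gram \<le> Z"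
proof -
  let ?G = "\<lambda>L p q. \<Sum>k\<in>{- int L..int L}. h (k + int p) * h (k + int q)"
  have eq: "fdet N (?G L) = (\<Sum>p | is_partition p \<and> length p \<le> N \<and> positions N p \<in> PiE {..<N} (\<lambda>_. {- int L..int L}). (schur t p)\<^sup>2)" for L
  proof -
    have "(\<Sum>x\<in>PiE {..<N} (\<lambda>_. {- int L..int L}). (alternant t N x)\<^sup>2) = fact N * fdet N (?G L)"
      using andreief[of "{- int L..int L}" "{}" N "\<lambda>j k. h (k + int j)" "\<lambda>_. 0"]
      by (simp add: alternant_def card_permutations)
    then show ?thesis using sum_partitions_eq_sum_PiE(3)[of "{- int L..int L}" t N] by simp
  qed
  have lim: "(\<lambda>L. fdet N (?G L)) \<longlonglongrightarrow> fdet N gram" by (intro tendsto_fdet gram_tendsto)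
  show "0 \<le> fdet N gram"
    by (rule LIMSEQ_le_const[OF lim]) (auto simp: eq intro!: sum_nonneg)
  show "fdet N gram \<le> Z"
  proof (rule LIMSEQ_le_const2[OF lim], intro exI allI impI)
    fix L show "fdet N (?G L) \<le> Z"
      unfolding eq
    proof (rule sum_schur_sq_le[OF supp])
      show "finite {p. is_partition p \<and> length p \<le> N \<and> positions N p \<in> PiE {..<N} (\<lambda>_. {- int L..int L})}"
        by (rule sum_partitions_eq_sum_PiE(1)) simp
    qed simp_all
  qed
qed

text \<open>For a finite set \<open>A\<close> of partitions the sum is below the full second moment
  once the box contains all positions involved. The box is then enlarged to the whole line with N
  fixed.\<close>

lemma window_moment:
  assumes A: "finite A" "\<And>p. p \<in> A \<Longrightarrow> is_partition p" "\<And>p. p \<in> A \<Longrightarrow> length p \<le> N" and K: "finite K"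
  shows "(\<Sum>p\<in>A. (schur t p)\<^sup>2 * ((\<Sum>i<N. of_bool (positions N p i \<in> K)) - \<mu>)\<^sup>2)
    \<le> Z * (((\<Sum>x\<in>K. \<kappa>N N x x) - \<mu>)\<^sup>2 + (\<Sum>x\<in>K. \<kappa>N N x x))"
proof -
  define X where "X L = {- int L..int L}" for L
  define \<eta> where "\<eta> k = (of_bool (k \<in> K) :: real)" for k
  define GL where "GL L p q = (\<Sum>k\<in>X L. h (k + int p) * h (k + int q))" for L p q
  define AL where "AL L p q = (\<Sum>k\<in>X L. \<eta> k * h (k + int p) * h (k + int q))" for L p q
  define AK where "AK p q = (\<Sum>k\<in>K. h (k + int p) * h (k + int q))" for p q
  define E where "E A' G' = (\<Sum>p<N. \<Sum>q\<in>{..<N}-{p}. fdet N (\<lambda>a. if a \<in> {p, q} then A' a else G' a))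
      + (1 - 2 * \<mu>) * (\<Sum>p<N. fdet N (\<lambda>a. if a \<in> {p} then A' a else G' a))
      + \<mu>\<^sup>2 * fdet N (\<lambda>a. if a \<in> {} then A' a else G' a)" for A' G' :: "nat \<Rightarrow> nat \<Rightarrow> real"
  define S where "S = (\<Sum>p\<in>A. (schur t p)\<^sup>2 * ((\<Sum>i<N. \<eta> (positions N p i)) - \<mu>)\<^sup>2)"
  have large: "\<forall>\<^sub>F L in sequentially. Y \<subseteq> X L" if "finite Y" for Y :: "int set"
  proof -
    obtain B where B: "\<And>k. k \<in> Y \<Longrightarrow> \<bar>k\<bar> \<le> B" using finite_int_set_bounded[OF \<open>finite Y\<close>] by blast
    show ?thesis using eventually_ge_at_top[of "nat B"]
      proof eventually_elim
      case (elim L)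
      show ?case
      proof
        fix k assume "k \<in> Y"
        then show "k \<in> X L" using B[of k] elim by (auto simp: X_def abs_le_iff)
      qed
    qed
  qed
  have "\<forall>\<^sub>F L in sequentially. (\<Union>p\<in>A. positions N p ` {..<N}) \<subseteq> X L"
    by (rule large) (use A(1) in auto)
  then have SE: "\<forall>\<^sub>F L in sequentially. S \<le> E (AL L) (GL L)"
  proof eventually_elim
    case (elim L)
    let ?D = "PiE {..<N} (\<lambda>_. X L)"
    let ?P = "{p. is_partition p \<and> length p \<le> N \<and> positions N p \<in> ?D}"
    have finX: "finite (X L)" by (simp add: X_def)
    have sub: "A \<subseteq> ?P"
    proof
      fix p assume p: "p \<in> A"
      have "positions N p \<in> ?D"
      proof (rule PiE_I)
        fix i assume "i \<in> {..<N}"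
        then show "positions N p i \<in> X L" using elim p by blast
      next
        fix i assume "i \<notin> {..<N}"
        then show "positions N p i = undefined" unfolding positions_def by (rule restrict_apply[THEN trans, OF if_not_P])
      qed
      then show "p \<in> ?P" using A p by simp
    qed
    have "S \<le> (\<Sum>p\<in>?P. (schur t p)\<^sup>2 * ((\<Sum>i<N. \<eta> (positions N p i)) - \<mu>)\<^sup>2)"
      unfolding S_def by (rule sum_mono2[OF sum_partitions_eq_sum_PiE(1)[OF finX] sub]) simp
    also have "fact N * \<dots> = (\<Sum>x\<in>?D. (alternant t N x)\<^sup>2 * ((\<Sum>i<N. \<eta> (x i)) - \<mu>)\<^sup>2)"
      by (rule sum_partitions_eq_sum_PiE(2)[OF finX, symmetric])
    also have "\<dots> = fact N * E (AL L) (GL L)"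
      unfolding alternant_def E_def AL_def GL_def
      by (rule second_moment_ensemble[OF finX]) (auto simp: \<eta>_def)
    finally show ?case by simp
  qed
  have "(\<lambda>L. E (AL L) (GL L)) \<longlonglongrightarrow> E AK gram"
  proof -
    have G: "(\<lambda>L. GL L p q) \<longlonglongrightarrow> gram p q" for p q unfolding GL_def X_def by (rule gram_tendsto)
    have "\<forall>\<^sub>F L in sequentially. AL L p q = AK p q" for p q
      using large[OF K]
    proof eventually_elim
      case (elim L)
      show ?case unfolding AL_def AK_def
        by (rule sum.mono_neutral_cong_right) (use elim in \<open>auto simp: \<eta>_def X_def\<close>)
    qed
    then have AA: "(\<lambda>L. AL L p q) \<longlonglongrightarrow> AK p q" for p q by (rule tendsto_eventually)
    have rows: "(\<lambda>L. (if a \<in> J then AL L a else GL L a) b) \<longlonglongrightarrow> (if a \<in> J then AK a else gram a) b" for a b J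
      using G AA by simp
    show ?thesis unfolding E_def by (intro tendsto_add tendsto_mult tendsto_const tendsto_sum tendsto_fdet rows)
  qed
  then have "S \<le> E AK gram" using SE by (rule tendsto_lowerbound) simp
  also have "E AK gram \<le> fdet N gram * (((\<Sum>x\<in>K. \<kappa>N N x x) - \<mu>)\<^sup>2 + (\<Sum>x\<in>K. \<kappa>N N x x))"
  proof -
    \<comment> \<open>The kernel matrix \<open>AK\<close> times the inverse of \<open>gram\<close>,
      built from \<open>sol\<close>. Its trace is the sum of \<open>\<kappa>N\<close> over the
      window, and by symmetry of the kernel the trace of its square is a sum of squares.\<close>
    define B where "B p r = (\<Sum>x\<in>K. h (x + int p) * sol N x r)" for p r
    have tr: "(\<Sum>p<N. B p p) = (\<Sum>x\<in>K. \<kappa>N N x x)"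
      unfolding B_def \<kappa>N_def by (subst sum.swap) (simp add: mult.commute)
    have "(\<Sum>p<N. \<Sum>q<N. B p q * B q p) = (\<Sum>p<N. \<Sum>q<N. \<Sum>x\<in>K. \<Sum>x'\<in>K. (sol N x' p * h (x + int p)) * (sol N x q * h (x' + int q)))"
      unfolding B_def sum_product by (simp add: mult_ac)
    also have "\<dots> = (\<Sum>p<N. \<Sum>x\<in>K. \<Sum>q<N. \<Sum>x'\<in>K. (sol N x' p * h (x + int p)) * (sol N x q * h (x' + int q)))"
      by (rule sum.cong[OF refl], rule sum.swap)
    also have "\<dots> = (\<Sum>x\<in>K. \<Sum>p<N. \<Sum>x'\<in>K. \<Sum>q<N. (sol N x' p * h (x + int p)) * (sol N x q * h (x' + int q)))"
      by (subst sum.swap, intro sum.cong refl, rule sum.swap)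
    also have "\<dots> = (\<Sum>x\<in>K. \<Sum>x'\<in>K. \<Sum>p<N. \<Sum>q<N. (sol N x' p * h (x + int p)) * (sol N x q * h (x' + int q)))"
      by (intro sum.cong refl, rule sum.swap)
    also have "\<dots> = (\<Sum>x\<in>K. \<Sum>x'\<in>K. \<kappa>N N x' x * \<kappa>N N x x')"
      unfolding \<kappa>N_def sum_product ..
    also have "\<dots> = (\<Sum>x\<in>K. \<Sum>x'\<in>K. (\<kappa>N N x x')\<^sup>2)"
      by (intro sum.cong refl) (metis \<kappa>N_sym power2_eq_square)
    finally have "0 \<le> (\<Sum>p<N. \<Sum>q<N. B p q * B q p)" by (simp add: sum_nonneg)
    moreover have "AK p q = (\<Sum>r<N. B p r * gram r q)" if "q < N" for p q
    proof -
      have "(\<Sum>r<N. B p r * gram r q) = (\<Sum>x\<in>K. h (x + int p) * (\<Sum>r<N. gram q r * sol N x r))"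
        unfolding B_def sum_distrib_right sum_distrib_left
        by (subst sum.swap) (simp add: gram_sym[of q] mult_ac)
      then show ?thesis by (simp add: gram_sol[OF that] AK_def)
    qed
    ultimately show ?thesis
      unfolding E_def tr[symmetric] by (intro second_moment_bound fdet_gram_bounds(1)) auto
  qed
  also have "\<dots> \<le> Z * (((\<Sum>x\<in>K. \<kappa>N N x x) - \<mu>)\<^sup>2 + (\<Sum>x\<in>K. \<kappa>N N x x))"
  proof (rule mult_right_mono[OF fdet_gram_bounds(2)])
    have "0 \<le> \<kappa>N N x x" for x
      using gram_form_nonneg[of "sol N x" N] by (simp add: gram_form_sol \<kappa>N_def)
    then show "0 \<le> ((\<Sum>x\<in>K. \<kappa>N N x x) - \<mu>)\<^sup>2 + (\<Sum>x\<in>K. \<kappa>N N x x)" by (intro add_nonneg_nonneg sum_nonneg) auto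
  qed
  finally show ?thesis unfolding S_def \<eta>_def .
qed

end

text \<open>Positions with index N or larger belong to empty rows and lie at or below - N, outside
  the window.\<close>

lemma card_particles_window:
  assumes p: "is_partition p" "length p \<le> N" and K: "K \<subseteq> {- int N<..}"
  shows "(\<Sum>i<N. of_bool (positions N p i \<in> K)) = real (card (particles p \<inter> K))"
proof -
  note inj = inj_on_positions[OF p(1), of N]
  have "particles p \<inter> K = positions N p ` {i\<in>{..<N}. positions N p i \<in> K}"
  proof (intro equalityI subsetI)
    fix x assume "x \<in> particles p \<inter> K"
    then obtain i where i: "x = int (part p (i + 1)) - int i" "x \<in> K" by (auto simp: particles_def)
    have "i < N"
    proof (rule ccontr)
      assume "\<not> i < N"
      then have "x = - int i" "N \<le> i" using i(1) p(2) by (auto simp: part_beyond)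
      then show False using i(2) K by auto
    qed
    then show "x \<in> positions N p ` {i\<in>{..<N}. positions N p i \<in> K}"
      using i by (auto simp: positions_def intro!: image_eqI[of _ _ i])
  qed (auto simp: particles_def positions_def)
  then have "card (particles p \<inter> K) = card {i\<in>{..<N}. positions N p i \<in> K}"
    using card_image[OF inj_on_subset[OF inj, of "{i\<in>{..<N}. positions N p i \<in> K}"]] by auto
  then show ?thesis by (simp add: of_bool_def sum.If_cases Int_def)
qed

context miwa_times
begin

text \<open>With \<open>A\<close> and \<open>K\<close> fixed, the left side does not depend on N
  once N exceeds all lengths and the depth of the window, so the limit may be taken in the bound
  alone.\<close>

lemma window_variance:
  assumes A: "finite A" "\<And>p. p \<in> A \<Longrightarrow> is_partition p" and K: "finite K"
  defines "\<mu> \<equiv> \<Sum>x\<in>K. \<kappa> x"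
  shows "(\<Sum>p\<in>A. (schur t p)\<^sup>2 * (real (card (particles p \<inter> K)) - \<mu>)\<^sup>2) \<le> Z * \<mu>"
proof (rule tendsto_lowerbound)
  have "(\<lambda>N. Z * (((\<Sum>x\<in>K. \<kappa>N N x x) - \<mu>)\<^sup>2 + (\<Sum>x\<in>K. \<kappa>N N x x)))
     \<longlonglongrightarrow> Z * ((\<mu> - \<mu>)\<^sup>2 + \<mu>)"
    unfolding \<mu>_def by (intro tendsto_intros \<kappa>N_tendsto)
  then show "(\<lambda>N. Z * (((\<Sum>x\<in>K. \<kappa>N N x x) - \<mu>)\<^sup>2 + (\<Sum>x\<in>K. \<kappa>N N x x)))
     \<longlonglongrightarrow> Z * \<mu>" by simp
  obtain B where B: "\<And>k. k \<in> K \<Longrightarrow> \<bar>k\<bar> \<le> B" using finite_int_set_bounded[OF K] by blast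
  show "\<forall>\<^sub>F N in sequentially. (\<Sum>p\<in>A. (schur t p)\<^sup>2 * (real (card (particles p \<inter> K)) - \<mu>)\<^sup>2)
     \<le> Z * (((\<Sum>x\<in>K. \<kappa>N N x x) - \<mu>)\<^sup>2 + (\<Sum>x\<in>K. \<kappa>N N x x))"
    using eventually_ge_at_top[of "Suc (nat B) + (\<Sum>p\<in>A. length p)"]
  proof eventually_elim
    case (elim N)
    have len: "length p \<le> N" if "p \<in> A" for p
      using member_le_sum[of p A length] that A(1) elim by simp
    have "K \<subseteq> {- int N<..}"
    proof
      fix k assume "k \<in> K"
      then show "k \<in> {- int N<..}" using B[of k] elim by auto
    qed
    then have "(\<Sum>p\<in>A. (schur t p)\<^sup>2 * (real (card (particles p \<inter> K)) - \<mu>)\<^sup>2)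
       = (\<Sum>p\<in>A. (schur t p)\<^sup>2 * ((\<Sum>i<N. of_bool (positions N p i \<in> K)) - \<mu>)\<^sup>2)"
      using card_particles_window len A(2) by (intro sum.cong refl) simp
    also have "\<dots> \<le> Z * (((\<Sum>x\<in>K. \<kappa>N N x x) - \<mu>)\<^sup>2 + (\<Sum>x\<in>K. \<kappa>N N x x))"
      by (rule window_moment[OF A len K])
    finally show ?case .
  qed
qed simp

end


section \<open>From finite windows to half-lines\<close>

lemma particles_upper_finite:
  shows "finite (particles p \<inter> {n<..})"
    and "\<exists>W0. \<forall>W\<ge>W0. particles p \<inter> {n<..n + int W} = particles p \<inter> {n<..}"
proof -
  have "particles p \<inter> {n<..} \<subseteq> (\<lambda>i. int (part p (i + 1)) - int i) ` {..<length p + nat (- n)}"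
  proof
    fix x assume "x \<in> particles p \<inter> {n<..}"
    then obtain i where i: "x = int (part p (i + 1)) - int i" "n < x" by (auto simp: particles_def)
    have "i < length p + nat (- n)"
    proof (rule ccontr)
      assume *: "\<not> i < length p + nat (- n)"
      then have "part p (i + 1) = 0" by (intro part_beyond) simp
      then show False using i * by simp
    qed
    then show "x \<in> (\<lambda>i. int (part p (i + 1)) - int i) ` {..<length p + nat (- n)}" using i by blast
  qed
  then show fin: "finite (particles p \<inter> {n<..})" by (rule finite_subset) simp
  obtain B where B: "\<And>k. k \<in> particles p \<inter> {n<..} \<Longrightarrow> \<bar>k\<bar> \<le> B"
    using finite_int_set_bounded[OF fin] by blast
  have "particles p \<inter> {n<..n + int W} = particles p \<inter> {n<..}" if "nat (B - n) \<le> W" for W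
  proof (intro equalityI subsetI)
    fix k assume k: "k \<in> particles p \<inter> {n<..}"
    then show "k \<in> particles p \<inter> {n<..n + int W}" using B[OF k] that by auto
  qed auto
  then show "\<exists>W0. \<forall>W\<ge>W0. particles p \<inter> {n<..n + int W} = particles p \<inter> {n<..}" by blast
qed

text \<open>A particle x sits at x - 1/2, and for integers x - 1/2 > n means x > n.\<close>

lemma card_point_config:
  "card {k \<in> point_config p. real_of_int n < k} = card (particles p \<inter> {n<..})"
proof -
  have "{k \<in> point_config p. real_of_int n < k} = (\<lambda>x. real_of_int x - 1/2) ` (particles p \<inter> {n<..})"
  proof (intro equalityI subsetI)
    fix k assume "k \<in> {k \<in> point_config p. real_of_int n < k}"
    then obtain i where i: "k = real (part p i) - real i + 1/2" "1 \<le> i" "real_of_int n < k"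
      by (auto simp: point_config_def)
    define x where "x = int (part p i) - int (i - 1)"
    have k: "k = real_of_int x - 1/2" using i by (simp add: x_def of_nat_diff)
    have "x \<in> particles p" unfolding particles_def x_def using i(2) by (auto intro!: exI[of _ "i - 1"])
    moreover have "n < x" using i(3) k by linarith
    ultimately show "k \<in> (\<lambda>x. real_of_int x - 1/2) ` (particles p \<inter> {n<..})" using k by blast
  next
    fix k assume "k \<in> (\<lambda>x. real_of_int x - 1/2) ` (particles p \<inter> {n<..})"
    then obtain x where x: "x \<in> particles p" "n < x" "k = real_of_int x - 1/2" by auto
    then obtain i where i: "x = int (part p (i + 1)) - int i" by (auto simp: particles_def)
    have "k = real (part p (Suc i)) - real (Suc i) + 1/2" using x(3) i by simp
    then have "k \<in> point_config p" unfolding point_config_def by (auto intro!: exI[of _ "Suc i"])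
    moreover have "real_of_int n < k" using x(2,3) by linarith
    ultimately show "k \<in> {k \<in> point_config p. real_of_int n < k}" by simp
  qed
  then show ?thesis by (simp add: card_image inj_on_def)
qed

context miwa_times
begin

lemma du_abs: "(\<lambda>d. norm (of_int d * u d)) summable_on UNIV"
proof (rule Infinite_Sum.abs_summable_on_comparison_test')
  show "(\<lambda>d. \<Sum>r=1..m. \<bar>real r * t r\<bar> * (norm (u (d - int r)) + norm (u (d + int r)))) summable_on UNIV"
  proof (intro summable_on_finite_sum summable_on_cmult_right summable_on_add)
    show "(\<lambda>d. norm (u (d - int r))) summable_on UNIV" "(\<lambda>d. norm (u (d + int r))) summable_on UNIV" for r
      using summable_on_int_shift(1,3)[of "\<lambda>d. norm (u d)" "int r"] u_abs by simp_all
  qed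
  show "norm (of_int d * u d) \<le> (\<Sum>r=1..m. \<bar>real r * t r\<bar> * (norm (u (d - int r)) + norm (u (d + int r))))" for d
    unfolding u_recurrence real_norm_def
    by (rule order.trans[OF sum_abs]) (auto simp: abs_mult intro!: sum_mono mult_left_mono abs_triangle_ineq)
qed

text \<open>The limiting mean number of positions above \<open>n\<close>.\<close>

definition mean :: "int \<Rightarrow> real" where
  "mean n = (\<Sum>e. real (Suc e) * (u (n + 1 + int e))\<^sup>2)"

lemma mean_sums: "(\<lambda>e. real (Suc e) * (u (n + 1 + int e))\<^sup>2) sums mean n"
proof -
  define f where "f d = (of_int d * u d) * u d - of_int n * (u d * u d)" for d
  have "(\<lambda>d. norm (f d)) summable_on UNIV"
  proof (rule Infinite_Sum.abs_summable_on_comparison_test')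
    show "(\<lambda>d. norm ((of_int d * u d) * u d) + \<bar>of_int n\<bar> * norm (u d * u d)) summable_on UNIV"
      by (intro summable_on_add summable_on_cmult_right abs_summable_on_mult du_abs u_abs)
    show "norm (f d) \<le> norm ((of_int d * u d) * u d) + \<bar>of_int n\<bar> * norm (u d * u d)" for d
      unfolding f_def by (rule order.trans[OF norm_triangle_ineq4]) (simp add: abs_mult)
  qed
  then have "(\<lambda>k. norm (f (n + 1 + k))) summable_on UNIV"
    using summable_on_int_shift(2)[of "\<lambda>k. norm (f k)" "n + 1"] by simp
  then have "(\<lambda>k. norm (f (n + 1 + k))) summable_on range int" by (rule summable_on_subset_banach) simp
  then have "(\<lambda>e. norm (f (n + 1 + int e))) summable_on UNIV"
    by (subst (asm) summable_on_reindex) (auto simp: o_def inj_on_def)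
  moreover have "f (n + 1 + int e) = real (Suc e) * (u (n + 1 + int e))\<^sup>2" for e
    by (simp add: f_def power2_eq_square algebra_simps)
  ultimately show ?thesis unfolding mean_def by (intro summable_on_nat_imp_sums) simp
qed

lemma mean_nonneg: "0 \<le> mean n"
  by (rule sums_le[OF _ sums_zero mean_sums]) simp

text \<open>The square of u(n + 1 + e) occurs in the density at n + 1 + w for each w <= e, so a
  window of width W counts it min(W, e + 1) times.\<close>

lemma sum_\<kappa>_tendsto: "(\<lambda>W. \<Sum>x\<in>{n<..n + int W}. \<kappa> x) \<longlonglongrightarrow> mean n"
proof -
  define v where "v e = (u (n + 1 + int e))\<^sup>2" for e
  have reindex: "(\<Sum>x\<in>{n<..n + int W}. \<kappa> x) = (\<Sum>w<W. \<kappa> (n + 1 + int w))" for W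
    by (rule sum.reindex_bij_witness[of _ "\<lambda>w. n + 1 + int w" "\<lambda>x. nat (x - n - 1)"]) auto
  have "(\<lambda>e. if e < w then 0 else v e) sums \<kappa> (n + 1 + int w)" for w
  proof -
    have "(\<lambda>e. v (e + w)) sums \<kappa> (n + 1 + int w)"
      using \<kappa>_sums[of "n + 1 + int w"] by (simp add: v_def add_ac)
    then have "v sums (\<kappa> (n + 1 + int w) + (\<Sum>e<w. v e))" by (simp add: sums_iff_shift)
    moreover have "(\<lambda>e. if e \<in> {..<w} then v e else 0) sums (\<Sum>e\<in>{..<w}. v e)"
      by (rule sums_If_finite_set) simp
    ultimately have "(\<lambda>e. v e - (if e \<in> {..<w} then v e else 0)) sums (\<kappa> (n + 1 + int w) + (\<Sum>e<w. v e) - (\<Sum>e<w. v e))"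
      by (rule sums_diff)
    moreover have "(\<lambda>e. v e - (if e \<in> {..<w} then v e else 0)) = (\<lambda>e. if e < w then 0 else v e)" by auto
    ultimately show ?thesis by simp
  qed
  then have "(\<lambda>e. \<Sum>w<W. if e < w then 0 else v e) sums (\<Sum>w<W. \<kappa> (n + 1 + int w))" for W
    by (intro sums_sum)
  moreover have "(\<Sum>w<W. if e < w then 0 else v e) = real (min W (Suc e)) * v e" for W e
  proof -
    have "(\<Sum>w<W. if e < w then 0 else v e) = (\<Sum>w\<in>{..<min W (Suc e)}. v e)"
      by (rule sum.mono_neutral_cong_right) auto
    then show ?thesis by simp
  qed
  ultimately have s: "(\<lambda>e. real (min W (Suc e)) * v e) sums (\<Sum>x\<in>{n<..n + int W}. \<kappa> x)" for W
    by (simp add: reindex)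
  have v0: "0 \<le> v e" for e by (simp add: v_def)
  have ms: "(\<lambda>e. real (Suc e) * v e) sums mean n" unfolding v_def by (rule mean_sums)
  show ?thesis
  proof (rule tendsto_sandwich)
    show "\<forall>\<^sub>F W in sequentially. (\<Sum>e<W. real (Suc e) * v e) \<le> (\<Sum>x\<in>{n<..n + int W}. \<kappa> x)"
    proof (intro always_eventually allI)
      fix W
      have "(\<lambda>e. if e \<in> {..<W} then real (Suc e) * v e else 0) sums (\<Sum>e\<in>{..<W}. real (Suc e) * v e)"
        by (rule sums_If_finite_set) simp
      then show "(\<Sum>e<W. real (Suc e) * v e) \<le> (\<Sum>x\<in>{n<..n + int W}. \<kappa> x)"
        by (rule sums_le[OF _ _ s, rotated]) (use v0 in \<open>auto intro!: mult_right_mono\<close>)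
    qed
    show "\<forall>\<^sub>F W in sequentially. (\<Sum>x\<in>{n<..n + int W}. \<kappa> x) \<le> mean n"
      by (intro always_eventually allI sums_le[OF _ s ms] mult_right_mono v0) simp
    show "(\<lambda>W. \<Sum>e<W. real (Suc e) * v e) \<longlonglongrightarrow> mean n" using ms by (simp add: sums_def)
  qed simp
qed

lemma half_line_variance:
  assumes A: "finite A" "\<And>p. p \<in> A \<Longrightarrow> is_partition p"
  shows "(\<Sum>p\<in>A. (schur t p)\<^sup>2 * (real (card {k \<in> point_config p. real_of_int n < k}) - mean n)\<^sup>2)
    \<le> Z * mean n"
proof (rule tendsto_le)
  have "(\<lambda>W. real (card (particles p \<inter> {n<..n + int W}))) \<longlonglongrightarrow> real (card (particles p \<inter> {n<..}))" for p
  proof -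
    obtain W0 where "\<And>W. W0 \<le> W \<Longrightarrow> particles p \<inter> {n<..n + int W} = particles p \<inter> {n<..}"
      using particles_upper_finite(2) by blast
    then have "\<forall>\<^sub>F W in sequentially. real (card (particles p \<inter> {n<..n + int W})) = real (card (particles p \<inter> {n<..}))"
      by (intro eventually_sequentiallyI[of W0]) simp
    then show ?thesis by (rule tendsto_eventually)
  qed
  then show "(\<lambda>W. \<Sum>p\<in>A. (schur t p)\<^sup>2 * (real (card (particles p \<inter> {n<..n + int W})) - (\<Sum>x\<in>{n<..n + int W}. \<kappa> x))\<^sup>2)
     \<longlonglongrightarrow> (\<Sum>p\<in>A. (schur t p)\<^sup>2 * (real (card {k \<in> point_config p. real_of_int n < k}) - mean n)\<^sup>2)"
    unfolding card_point_config by (intro tendsto_intros sum_\<kappa>_tendsto)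
  show "(\<lambda>W. Z * (\<Sum>x\<in>{n<..n + int W}. \<kappa> x))
     \<longlonglongrightarrow> Z * mean n"
    by (intro tendsto_intros sum_\<kappa>_tendsto)
  show "\<forall>\<^sub>F W in sequentially. (\<Sum>p\<in>A. (schur t p)\<^sup>2 * (real (card (particles p \<inter> {n<..n + int W})) - (\<Sum>x\<in>{n<..n + int W}. \<kappa> x))\<^sup>2)
     \<le> Z * (\<Sum>x\<in>{n<..n + int W}. \<kappa> x)"
    by (intro always_eventually allI window_variance[OF A]) simp_all
qed simp

end

section \<open>Chebyshev's inequality for the multicritical measure\<close>

interpretation multicritical: miwa_times m "\<lambda>r. \<theta> * mc_gamma m r" for m \<theta>
  by unfold_locales (simp add: mc_gamma_def)

text \<open>The variance bound is available for finite sets of partitions only, so the event is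
  exhausted by finite pieces and continuity from below is applied.\<close>

lemma multicritical_deviation:
  fixes \<delta> :: real and n :: int
  assumes "0 < \<delta>"
  shows "emeasure (multicritical_measure m \<theta>)
      {p. is_partition p \<and> \<delta> \<le> \<bar>real (card {k \<in> point_config p. real_of_int n < k}) - multicritical.mean \<theta> m n\<bar>}
    \<le> ennreal (multicritical.mean \<theta> m n / \<delta>\<^sup>2)" (is "emeasure ?M ?B \<le> _")
proof -
  define \<mu> where "\<mu> = multicritical.mean \<theta> m n"
  define N where "N p = real (card {k \<in> point_config p. real_of_int n < k})" for p
  define C where "C = \<theta>\<^sup>2 * (\<Sum>r=1..m. real r * (mc_gamma m r)\<^sup>2)"
  define f where "f p = exp (- C) * (schur (\<lambda>r. \<theta> * mc_gamma m r) p)\<^sup>2" for p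
  define Bn where "Bn k = ?B \<inter> {p. length p \<le> k \<and> set p \<subseteq> {..k}}" for k
  have M: "?M = density (count_space {p. is_partition p}) (\<lambda>p. ennreal (f p))"
    unfolding multicritical_measure_def f_def C_def by simp
  have fin: "finite (Bn k)" for k
  proof -
    have "finite {p. set p \<subseteq> {..k} \<and> length p \<le> k}" by (rule finite_lists_length_le) simp
    then show ?thesis by (rule rev_finite_subset) (auto simp: Bn_def)
  qed
  have C: "exp (\<Sum>r=1..m. real r * (\<theta> * mc_gamma m r)\<^sup>2) = exp C"
    by (simp add: C_def power_mult_distrib sum_distrib_left mult_ac)
  have bound: "emeasure ?M (Bn k) \<le> ennreal (\<mu> / \<delta>\<^sup>2)" for k
  proof -
    have "emeasure ?M (Bn k) = (\<Sum>p\<in>Bn k. ennreal (f p))"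
    proof -
      have "emeasure ?M (Bn k) = (\<integral>\<^sup>+p. ennreal (f p) * indicator (Bn k) p \<partial>count_space {p. is_partition p})"
        unfolding M by (rule emeasure_density) (auto simp: Bn_def)
      also have "\<dots> = (\<Sum>p\<in>Bn k. ennreal (f p) * indicator (Bn k) p)"
        by (rule nn_integral_count_space'[OF fin]) (auto simp: Bn_def)
      also have "\<dots> = (\<Sum>p\<in>Bn k. ennreal (f p))" by (rule sum.cong) auto
      finally show ?thesis .
    qed
    also have "\<dots> = ennreal (\<Sum>p\<in>Bn k. f p)" by (rule sum_ennreal) (simp add: f_def)
    also have "\<dots> \<le> ennreal (\<mu> / \<delta>\<^sup>2)"
    proof (rule ennreal_leI)
      have "\<delta>\<^sup>2 * (\<Sum>p\<in>Bn k. f p) \<le> (\<Sum>p\<in>Bn k. f p * (N p - \<mu>)\<^sup>2)"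
        unfolding sum_distrib_left
      proof (rule sum_mono)
        fix p assume "p \<in> Bn k"
        then have "\<delta>\<^sup>2 \<le> \<bar>N p - \<mu>\<bar>\<^sup>2" using assms by (intro power_mono) (auto simp: Bn_def N_def \<mu>_def)
        then show "\<delta>\<^sup>2 * f p \<le> f p * (N p - \<mu>)\<^sup>2"
          by (subst mult.commute) (auto simp: f_def intro!: mult_left_mono)
      qed
      also have "\<dots> = exp (- C) * (\<Sum>p\<in>Bn k. (schur (\<lambda>r. \<theta> * mc_gamma m r) p)\<^sup>2 * (N p - \<mu>)\<^sup>2)"
        by (simp add: f_def sum_distrib_left mult_ac)
      \<comment> \<open>The normalising factor of the measure cancels the factor \<open>Z\<close> of
        the variance bound.\<close>
      also have "\<dots> \<le> exp (- C) * (exp C * \<mu>)"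
        unfolding N_def \<mu>_def C[symmetric]
        by (rule mult_left_mono[OF multicritical.half_line_variance[OF fin]]) (auto simp: Bn_def)
      also have "\<dots> = \<mu>" by (simp add: exp_minus field_simps)
      finally show "(\<Sum>p\<in>Bn k. f p) \<le> \<mu> / \<delta>\<^sup>2" using assms by (simp add: field_simps)
    qed
    finally show ?thesis .
  qed
  have "?B = (\<Union>k. Bn k)"
  proof (intro equalityI subsetI)
    fix p assume "p \<in> ?B"
    then have "p \<in> Bn (length p + sum_list p)"
      using member_le_sum_list[of _ p] by (auto simp: Bn_def intro: trans_le_add2)
    then show "p \<in> (\<Union>k. Bn k)" by blast
  qed (auto simp: Bn_def)
  also have "emeasure ?M (\<Union>k. Bn k) = (SUP k. emeasure ?M (Bn k))"
  proof (rule SUP_emeasure_incseq[symmetric])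
    show "range Bn \<subseteq> sets ?M" by (auto simp: M Bn_def)
    show "incseq Bn" unfolding incseq_def Bn_def by force
  qed
  also have "\<dots> \<le> ennreal (\<mu> / \<delta>\<^sup>2)" by (rule SUP_least) (rule bound)
  finally show ?thesis unfolding \<mu>_def .
qed

section \<open>Fourier analysis of the symbol\<close>


lemma has_integral_cis:
  "((\<lambda>\<phi>. cis (of_int n * \<phi>)) has_integral (if n = 0 then 2 * pi else 0)) {0..2 * pi}"
proof (cases "n = 0")
  case True
  then show ?thesis using has_integral_const_real[of "1 :: complex" 0 "2 * pi"] by (simp add: scaleR_conv_of_real)
next
  case False
  have "((\<lambda>\<phi>. cis (of_int n * \<phi>)) has_integral
      cis (of_int n * (2 * pi)) / (\<i> * of_int n) - cis (of_int n * 0) / (\<i> * of_int n)) {0..2 * pi}"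
  proof (rule fundamental_theorem_of_calculus)
    fix x assume "x \<in> {0..2 * pi}"
    have cis: "cis (of_int n * y) = exp (y *\<^sub>R (\<i> * of_int n))" for y
      by (simp add: cis_conv_exp scaleR_conv_of_real mult_ac)
    have "((\<lambda>y. exp (y *\<^sub>R (\<i> * of_int n)) * (1 / (\<i> * of_int n))) has_vector_derivative
        (exp (x *\<^sub>R (\<i> * of_int n)) * (\<i> * of_int n)) * (1 / (\<i> * of_int n))) (at x within {0..2 * pi})"
      by (intro has_vector_derivative_mult_left exp_scaleR_has_vector_derivative_right)
    then show "((\<lambda>\<phi>. cis (of_int n * \<phi>) / (\<i> * of_int n)) has_vector_derivative cis (of_int n * x)) (at x within {0..2 * pi})"
      using False unfolding cis by simp
  qed simp
  moreover have "cis (of_int n * (2 * pi)) = 1"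
    using cis_multiple_2pi[of "of_int n"] by (simp add: mult_ac)
  ultimately show ?thesis using False by simp
qed

text \<open>Absolute summability makes the symmetric partial sums converge uniformly, and each of
  them integrates to its constant term.\<close>

lemma has_integral_fourier_series:
  fixes c :: "int \<Rightarrow> complex"
  assumes c: "(\<lambda>n. norm (c n)) summable_on UNIV"
    and F: "\<And>\<phi>. ((\<lambda>n. c n * cis (of_int n * \<phi>)) has_sum F \<phi>) UNIV"
  shows "(F has_integral (2 * pi * c 0)) {0..2 * pi}"
proof -
  define P where "P L \<phi> = (\<Sum>n\<in>{- int L..int L}. c n * cis (of_int n * \<phi>))" for L \<phi>
  define T where "T = (\<Sum>\<^sub>\<infinity>n. norm (c n))"
  have T: "((\<lambda>n. norm (c n)) has_sum T) UNIV" unfolding T_def by (rule has_sum_infsum[OF c])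
  have err: "norm (F \<phi> - P L \<phi>) \<le> T - (\<Sum>n\<in>{- int L..int L}. norm (c n))" for L \<phi>
  proof -
    let ?X = "{- int L..int L}"
    have sumF: "((\<lambda>n. c n * cis (of_int n * \<phi>)) has_sum (F \<phi> - P L \<phi>)) (UNIV - ?X)"
      unfolding P_def by (rule has_sum_Diff[OF F]) (auto intro: has_sum_finite)
    have "((\<lambda>n. norm (c n)) has_sum (T - (\<Sum>n\<in>?X. norm (c n)))) (UNIV - ?X)"
      by (rule has_sum_Diff[OF T]) (auto intro: has_sum_finite)
    then have "((\<lambda>n. norm (c n * cis (of_int n * \<phi>))) has_sum (T - (\<Sum>n\<in>?X. norm (c n)))) (UNIV - ?X)"
      by (simp add: norm_mult)
    from norm_has_sum_bound[OF this sumF] show ?thesis .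
  qed
  have lim: "(\<lambda>L. T - (\<Sum>n\<in>{- int L..int L}. norm (c n))) \<longlonglongrightarrow> 0"
    using tendsto_diff[OF tendsto_const has_sum_int_imp_tendsto[OF T], of T] by simp
  have "uniform_limit {0..2 * pi} P F sequentially"
  proof (rule uniform_limitI)
    fix e :: real assume "0 < e"
    then have "\<forall>\<^sub>F L in sequentially. T - (\<Sum>n\<in>{- int L..int L}. norm (c n)) < e"
      using order_tendstoD(2)[OF lim] by blast
    then show "\<forall>\<^sub>F L in sequentially. \<forall>\<phi>\<in>{0..2 * pi}. dist (P L \<phi>) (F \<phi>) < e"
    proof eventually_elim
      case (elim L)
      show ?case
      proof
        fix \<phi> show "dist (P L \<phi>) (F \<phi>) < e"
          using le_less_trans[OF err[of \<phi> L] elim] by (simp add: dist_norm norm_minus_commute)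
      qed
    qed
  qed
  moreover have "continuous_on {0..2 * pi} (P L)" for L
    unfolding P_def cis_conv_exp by (intro continuous_intros)
  ultimately obtain I J where I: "\<And>L. (P L has_integral I L) {0..2 * pi}" and J: "(F has_integral J) {0..2 * pi}" and IJ: "I \<longlonglongrightarrow> J"
    by (rule uniform_limit_integral) auto
  have "(P L has_integral (\<Sum>n\<in>{- int L..int L}. c n * (if n = 0 then 2 * pi else 0))) {0..2 * pi}" for L
    unfolding P_def by (intro has_integral_sum has_integral_mult_right has_integral_cis) auto
  moreover have "(\<Sum>n\<in>{- int L..int L}. c n * (if n = 0 then 2 * pi else 0)) = 2 * pi * c 0" for L
    by (simp add: if_distrib[where f = "\<lambda>x. _ * of_real x"] sum.delta mult.commute cong: if_cong)
  ultimately have "I L = 2 * pi * c 0" for L using I has_integral_unique by metis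
  then have "I = (\<lambda>_. 2 * pi * c 0)" by auto
  then have "J = 2 * pi * c 0" using IJ LIMSEQ_unique[OF tendsto_const] by blast
  then show ?thesis using J by simp
qed

context miwa_times
begin

definition phase :: "real \<Rightarrow> real" where
  "phase \<phi> = (\<Sum>r=1..m. 2 * t r * sin (real r * \<phi>))"

text \<open>The generating functions of \<open>h\<close> at \<phi> and of \<open>g\<close> at -
  \<phi> are multiplied and regrouped by the difference d of the indices. Real parts cancel in the
  exponent, which leaves a point of the unit circle.\<close>

lemma symbol_fourier: "((\<lambda>d. of_real (u d) * cis (of_int d * \<phi>)) has_sum cis (phase \<phi>)) UNIV"
proof -
  define a where "a = (\<lambda>k. of_real (h k) * cis (of_int k * \<phi>))"
  define b where "b = (\<lambda>k. of_real (g k) * cis (of_int k * (- \<phi>)))"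
  have a: "(\<lambda>k. norm (a k)) summable_on UNIV" "(a has_sum exp (\<Sum>r=1..m. of_real (t r) * cis (of_nat r * \<phi>))) UNIV"
    using h_abs miwa_h_generating_function[where m = m and t = t and \<phi> = \<phi>, OF supp] by (auto simp: a_def norm_mult)
  have b: "(\<lambda>k. norm (b k)) summable_on UNIV" "(b has_sum exp (\<Sum>r=1..m. of_real (- t r) * cis (of_nat r * (- \<phi>)))) UNIV"
    using g_abs miwa_h_generating_function[where m = m and t = "\<lambda>r. - t r" and \<phi> = "- \<phi>", OF supp_neg] by (auto simp: b_def norm_mult)
  have "exp (\<Sum>r=1..m. of_real (t r) * cis (of_nat r * \<phi>)) * exp (\<Sum>r=1..m. of_real (- t r) * cis (of_nat r * (- \<phi>)))
      = cis (phase \<phi>)"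
  proof -
    have "of_real (t r) * cis (of_nat r * \<phi>) + of_real (- t r) * cis (of_nat r * (- \<phi>)) = \<i> * of_real (2 * t r * sin (real r * \<phi>))" for r
      by (simp add: complex_eq_iff)
    then have "(\<Sum>r=1..m. of_real (t r) * cis (of_nat r * \<phi>)) + (\<Sum>r=1..m. of_real (- t r) * cis (of_nat r * (- \<phi>))) = \<i> * of_real (phase \<phi>)"
      unfolding sum.distrib[symmetric] phase_def of_real_sum sum_distrib_left by (intro sum.cong refl) simp
    then show ?thesis by (simp add: exp_add[symmetric] cis_conv_exp)
  qed
  then have ab: "((\<lambda>(k, i). a k * b i) has_sum cis (phase \<phi>)) (UNIV \<times> UNIV)"
    using has_sum_times[OF a b] by simp
  have "bij_betw (\<lambda>(d, i). (d + i, i)) (UNIV \<times> UNIV) (UNIV \<times> (UNIV :: int set))"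
    by (rule bij_betwI[of _ _ _ "\<lambda>(x, i). (x - i, i)"]) auto
  from has_sum_reindex_bij_betw[OF this, of "\<lambda>(k, i). a k * b i"] ab
  have "((\<lambda>(d, i). a (d + i) * b i) has_sum cis (phase \<phi>)) (UNIV \<times> UNIV)" by (simp add: case_prod_unfold)
  then show ?thesis
  proof (rule has_sum_SigmaD)
    fix d :: int
    have "((\<lambda>i. of_real (h (d + i) * g i)) has_sum complex_of_real (u d)) UNIV"
      by (subst has_sum_of_real_iff) (rule u_has_sum)
    from has_sum_cmult_left[OF this, of "cis (of_int d * \<phi>)"]
    show "((\<lambda>i. case (d, i) of (d, i) \<Rightarrow> a (d + i) * b i) has_sum of_real (u d) * cis (of_int d * \<phi>)) UNIV"
    proof (rule has_sum_cong[THEN iffD1, rotated])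
      fix i
      have "cis (of_int (d + i) * \<phi>) * cis (of_int i * (- \<phi>)) = cis (of_int d * \<phi>)"
        by (simp add: cis_mult algebra_simps)
      then show "of_real (h (d + i) * g i) * cis (of_int d * \<phi>) = (case (d, i) of (d, i) \<Rightarrow> a (d + i) * b i)"
        by (simp add: a_def b_def mult_ac)
    qed
  qed
qed

lemma u_complex_abs: "(\<lambda>d. norm (of_real (u d) * cis (x d))) summable_on UNIV"
  using u_abs by (simp add: norm_mult)

text \<open>The integrand is the symbol at \<phi> + s times the conjugate symbol at \<phi>; its
  constant Fourier coefficient is the characteristic function of the weights u_e^2.\<close>

lemma symbol_char:
  "((\<lambda>\<phi>. cis (phase (\<phi> + s) - phase \<phi>)) has_integral (2 * pi * (\<Sum>\<^sub>\<infinity>e. of_real ((u e)\<^sup>2) * cis (of_int e * s)))) {0..2 * pi}"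
proof -
  define c where "c n = (\<Sum>\<^sub>\<infinity>e. (of_real (u (n + e)) * cis (of_int (n + e) * s)) * of_real (u e))" for n
  have bij: "bij_betw (\<lambda>(d, i). (d + i, i)) (UNIV \<times> UNIV) (UNIV \<times> (UNIV :: int set))"
    by (rule bij_betwI[of _ _ _ "\<lambda>(x, i). (x - i, i)"]) auto
  define a where "a d = complex_of_real (u d) * cis (of_int d * s)" for d
  have a: "(\<lambda>d. norm (a d)) summable_on UNIV" unfolding a_def by (rule u_complex_abs)
  have u: "(\<lambda>d. norm (complex_of_real (u d))) summable_on UNIV" using u_abs by simp
  have dbl: "(\<lambda>(n, e). norm (a (n + e) * of_real (u e))) summable_on UNIV \<times> UNIV"
    using summable_on_reindex_bij_betw[OF bij, of "\<lambda>(x, y). norm (a x * complex_of_real (u y))"] abs_summable_on_times[OF a u]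
    by (simp add: case_prod_unfold)
  have row: "(\<lambda>e. norm (a (n + e) * of_real (u e))) summable_on UNIV" for n
    using summable_on_SigmaD1[of "\<lambda>n e. norm (a (n + e) * of_real (u e))" UNIV "\<lambda>_. UNIV" n] dbl by simp
  have c: "((\<lambda>e. a (n + e) * of_real (u e)) has_sum c n) UNIV" for n
    unfolding c_def a_def[symmetric] by (rule has_sum_infsum[OF abs_summable_summable[OF row]])
  have c_abs: "(\<lambda>n. norm (c n)) summable_on UNIV"
  proof (rule Infinite_Sum.abs_summable_on_comparison_test')
    show "(\<lambda>n. \<Sum>\<^sub>\<infinity>e. norm (a (n + e) * of_real (u e))) summable_on UNIV"
      using summable_on_Sigma_banach[OF dbl] by simp
    show "norm (c n) \<le> (\<Sum>\<^sub>\<infinity>e. norm (a (n + e) * of_real (u e)))" for n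
      unfolding c_def a_def[symmetric] by (rule norm_infsum_bound[OF row])
  qed
  have "((\<lambda>n. c n * cis (of_int n * \<phi>)) has_sum cis (phase (\<phi> + s) - phase \<phi>)) UNIV" for \<phi>
  proof -
    have "((\<lambda>d. of_real (u d) * cis (of_int d * \<phi>)) has_sum cis (phase \<phi>)) UNIV" by (rule symbol_fourier)
    from has_sum_cnj_iff[THEN iffD2, OF this]
    have cn: "((\<lambda>d. of_real (u d) * cis (- (of_int d * \<phi>))) has_sum cis (- phase \<phi>)) UNIV"
      by (simp add: cis_cnj)
    have "((\<lambda>(d, e). (of_real (u d) * cis (of_int d * (\<phi> + s))) * (of_real (u e) * cis (- (of_int e * \<phi>)))) has_sum cis (phase (\<phi> + s)) * cis (- phase \<phi>)) (UNIV \<times> UNIV)"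
      by (rule has_sum_times[OF u_complex_abs symbol_fourier u_complex_abs cn])
    from has_sum_reindex_bij_betw[OF bij, of "\<lambda>(d, e). (of_real (u d) * cis (of_int d * (\<phi> + s))) * (of_real (u e) * cis (- (of_int e * \<phi>)))"] this
    have "((\<lambda>(n, e). (of_real (u (n + e)) * cis (of_int (n + e) * (\<phi> + s))) * (of_real (u e) * cis (- (of_int e * \<phi>)))) has_sum cis (phase (\<phi> + s) - phase \<phi>)) (UNIV \<times> UNIV)"
      by (simp add: case_prod_unfold cis_mult)
    then show ?thesis
    proof (rule has_sum_SigmaD)
      fix n :: int
      show "((\<lambda>e. case (n, e) of (n, e) \<Rightarrow> (of_real (u (n + e)) * cis (of_int (n + e) * (\<phi> + s))) * (of_real (u e) * cis (- (of_int e * \<phi>)))) has_sum c n * cis (of_int n * \<phi>)) UNIV"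
      proof (rule has_sum_cong[THEN iffD1, OF _ has_sum_cmult_left[OF c]])
        fix e
        have "cis (of_int (n + e) * (\<phi> + s)) * cis (- (of_int e * \<phi>)) = cis (of_int (n + e) * s) * cis (of_int n * \<phi>)"
          by (simp add: cis_mult algebra_simps)
        then show "a (n + e) * of_real (u e) * cis (of_int n * \<phi>) = (case (n, e) of (n, e) \<Rightarrow> (of_real (u (n + e)) * cis (of_int (n + e) * (\<phi> + s))) * (of_real (u e) * cis (- (of_int e * \<phi>))))"
          by (simp add: a_def mult_ac) 
      qed
    qed
  qed
  from has_integral_fourier_series[OF c_abs this]
  have "((\<lambda>\<phi>. cis (phase (\<phi> + s) - phase \<phi>)) has_integral (2 * pi * c 0)) {0..2 * pi}" .
  moreover have "c 0 = (\<Sum>\<^sub>\<infinity>e. of_real ((u e)\<^sup>2) * cis (of_int e * s))"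
    unfolding c_def by (rule infsum_cong) (simp add: power2_eq_square mult_ac)
  ultimately show ?thesis by simp
qed

lemma u_sq_summable: "(\<lambda>d. (u d)\<^sup>2) summable_on UNIV"
  unfolding power2_eq_square by (rule abs_summable_summable[OF abs_summable_on_mult[OF u_abs u_abs]])

text \<open>Parseval's identity: the previous formula at s = 0.\<close>

lemma u_sq_has_sum: "((\<lambda>d. (u d)\<^sup>2) has_sum 1) UNIV"
proof -
  have "((\<lambda>\<phi>. cis (phase (\<phi> + 0) - phase \<phi>)) has_integral of_real (2 * pi)) {0..2 * pi}"
    using has_integral_cis[of 0] by simp
  then have "of_real (2 * pi) = 2 * pi * (\<Sum>\<^sub>\<infinity>e. complex_of_real ((u e)\<^sup>2) * cis (of_int e * 0))"
    by (rule has_integral_unique) (rule symbol_char)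
  then have "(\<Sum>\<^sub>\<infinity>e. complex_of_real ((u e)\<^sup>2)) = 1" by simp
  moreover have "((\<lambda>d. complex_of_real ((u d)\<^sup>2)) has_sum of_real (infsum (\<lambda>d. (u d)\<^sup>2) UNIV)) UNIV"
    by (subst has_sum_of_real_iff) (rule has_sum_infsum[OF u_sq_summable])
  ultimately have "infsum (\<lambda>d. (u d)\<^sup>2) UNIV = 1"
    by (metis infsumI of_real_eq_1_iff)
  then show ?thesis using has_sum_infsum[OF u_sq_summable] by simp
qed

text \<open>Cauchy-Schwarz in the recurrence with weights r |t_r|, followed by (a + b)^2 <= 2 (a^2 +
  b^2). Each shifted square sums to 1, so the total is 4 C^2. The bound scales like \<theta>^2,
  which gives tightness after rescaling.\<close>

lemma u_second_moment:
  shows "(\<lambda>d. (of_int d * u d)\<^sup>2) summable_on UNIV"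
    and "(\<Sum>\<^sub>\<infinity>d. (of_int d * u d)\<^sup>2) \<le> (2 * (\<Sum>r=1..m. real r * \<bar>t r\<bar>))\<^sup>2"
proof -
  define C where "C = (\<Sum>r=1..m. real r * \<bar>t r\<bar>)"
  show s: "(\<lambda>d. (of_int d * u d)\<^sup>2) summable_on UNIV"
    unfolding power2_eq_square by (rule abs_summable_summable[OF abs_summable_on_mult[OF du_abs du_abs]])
  have shift: "((\<lambda>d. (u (d - int r))\<^sup>2) has_sum 1) UNIV" "((\<lambda>d. (u (d + int r))\<^sup>2) has_sum 1) UNIV" for r
  proof -
    have "bij_betw (\<lambda>d. d - int r) UNIV UNIV" by (rule bij_betwI[of _ _ _ "\<lambda>d. d + int r"]) auto
    from has_sum_reindex_bij_betw[OF this, of "\<lambda>d. (u d)\<^sup>2"] u_sq_has_sum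
    show "((\<lambda>d. (u (d - int r))\<^sup>2) has_sum 1) UNIV" by simp
    have "bij_betw (\<lambda>d. d + int r) UNIV UNIV" by (rule bij_betwI[of _ _ _ "\<lambda>d. d - int r"]) auto
    from has_sum_reindex_bij_betw[OF this, of "\<lambda>d. (u d)\<^sup>2"] u_sq_has_sum
    show "((\<lambda>d. (u (d + int r))\<^sup>2) has_sum 1) UNIV" by simp
  qed
  have "((\<lambda>d. C * (\<Sum>r=1..m. (real r * \<bar>t r\<bar>) * (2 * ((u (d - int r))\<^sup>2 + (u (d + int r))\<^sup>2)))) has_sum
      C * (\<Sum>r=1..m. (real r * \<bar>t r\<bar>) * (2 * (1 + 1)))) UNIV"
    by (intro has_sum_cmult_right has_sum_finite_sum has_sum_add shift)
  moreover have "(of_int d * u d)\<^sup>2 \<le> C * (\<Sum>r=1..m. (real r * \<bar>t r\<bar>) * (2 * ((u (d - int r))\<^sup>2 + (u (d + int r))\<^sup>2)))" for d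
  proof -
    define z where "z r = u (d - int r) + u (d + int r)" for r
    \<comment> \<open>Each weight r t_r is split into two square roots of its absolute value, the
      sign going to the second factor, to match the Cauchy-Schwarz inequality.\<close>
    have "(of_int d * u d)\<^sup>2 = (\<Sum>r=1..m. sqrt (real r * \<bar>t r\<bar>) * (sgn (t r) * sqrt (real r * \<bar>t r\<bar>) * z r))\<^sup>2"
      unfolding u_recurrence z_def[symmetric]
    proof (intro arg_cong[where f = "\<lambda>x. x\<^sup>2"] sum.cong refl)
      fix r
      have "sqrt (real r * \<bar>t r\<bar>) * (sgn (t r) * sqrt (real r * \<bar>t r\<bar>) * z r)
         = (sqrt (real r * \<bar>t r\<bar>) * sqrt (real r * \<bar>t r\<bar>)) * (sgn (t r) * z r)" by (simp only: mult_ac)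
      also have "\<dots> = real r * (\<bar>t r\<bar> * sgn (t r)) * z r" by simp
      also have "\<bar>t r\<bar> * sgn (t r) = t r" by (simp add: abs_mult_sgn)
      finally show "real r * t r * z r = sqrt (real r * \<bar>t r\<bar>) * (sgn (t r) * sqrt (real r * \<bar>t r\<bar>) * z r)" ..
    qed
    also have "\<dots> \<le> (\<Sum>r=1..m. (sqrt (real r * \<bar>t r\<bar>))\<^sup>2) * (\<Sum>r=1..m. (sgn (t r) * sqrt (real r * \<bar>t r\<bar>) * z r)\<^sup>2)"
      by (rule Cauchy_Schwarz_ineq_sum)
    also have "(\<Sum>r=1..m. (sqrt (real r * \<bar>t r\<bar>))\<^sup>2) = C" unfolding C_def by (rule sum.cong) auto
    also have "C * (\<Sum>r=1..m. (sgn (t r) * sqrt (real r * \<bar>t r\<bar>) * z r)\<^sup>2) \<le> C * (\<Sum>r=1..m. (real r * \<bar>t r\<bar>) * (2 * ((u (d - int r))\<^sup>2 + (u (d + int r))\<^sup>2)))"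
    proof (intro mult_left_mono sum_mono)
      fix r
      have "(sgn (t r) * sqrt (real r * \<bar>t r\<bar>) * z r)\<^sup>2 = (sgn (t r))\<^sup>2 * ((real r * \<bar>t r\<bar>) * (z r)\<^sup>2)"
        by (simp add: power_mult_distrib)
      also have "\<dots> \<le> 1 * ((real r * \<bar>t r\<bar>) * (z r)\<^sup>2)"
        by (rule mult_right_mono) (auto simp: sgn_if)
      also have "(z r)\<^sup>2 \<le> 2 * ((u (d - int r))\<^sup>2 + (u (d + int r))\<^sup>2)"
        using sum_squares_bound[of "u (d - int r)" "u (d + int r)"] by (simp add: z_def power2_sum)
      finally show "(sgn (t r) * sqrt (real r * \<bar>t r\<bar>) * z r)\<^sup>2 \<le> (real r * \<bar>t r\<bar>) * (2 * ((u (d - int r))\<^sup>2 + (u (d + int r))\<^sup>2))"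
        by (simp add: mult_left_mono)
    qed (auto simp: C_def intro!: sum_nonneg)
    finally show ?thesis .
  qed
  ultimately have "(\<Sum>\<^sub>\<infinity>d. (of_int d * u d)\<^sup>2) \<le> C * (\<Sum>r=1..m. (real r * \<bar>t r\<bar>) * (2 * (1 + 1)))"
    by (intro has_sum_mono[OF has_sum_infsum[OF s]]) auto
  also have "\<dots> = (2 * C)\<^sup>2" by (simp add: C_def sum_distrib_right[symmetric] power2_eq_square)
  finally show "(\<Sum>\<^sub>\<infinity>d. (of_int d * u d)\<^sup>2) \<le> (2 * (\<Sum>r=1..m. real r * \<bar>t r\<bar>))\<^sup>2" unfolding C_def .
qed

end

section \<open>Semiclassical limit of the mean\<close>


lemma lebesgue_integral_count_space_eq_infsum:
  fixes f :: "'a \<Rightarrow> 'b :: {banach, second_countable_topology}"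
  assumes "(\<lambda>x. norm (f x)) summable_on UNIV"
  shows "(LINT x|count_space UNIV. f x) = (\<Sum>\<^sub>\<infinity>x. f x)"
  using infsetsum_infsum[of f UNIV] abs_summable_equivalent[of f UNIV] assms
  by (simp add: infsetsum_def)

definition mc_phase :: "nat \<Rightarrow> real \<Rightarrow> real" where
  "mc_phase m \<phi> = (\<Sum>r=1..m. 2 * mc_gamma m r * sin (real r * \<phi>))"

definition mc_velocity :: "nat \<Rightarrow> real \<Rightarrow> real" where
  "mc_velocity m \<phi> = (\<Sum>r=1..m. 2 * real r * mc_gamma m r * cos (real r * \<phi>))"

definition mc_bound :: "nat \<Rightarrow> real" where
  "mc_bound m = 2 * (\<Sum>r=1..m. real r * \<bar>mc_gamma m r\<bar>)"

abbreviation mc_symbol :: "nat \<Rightarrow> real \<Rightarrow> int \<Rightarrow> real" where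
  "mc_symbol m \<theta> \<equiv> symbol (\<lambda>r. \<theta> * mc_gamma m r)"

abbreviation mc_expect :: "nat \<Rightarrow> real \<Rightarrow> (real \<Rightarrow> real) \<Rightarrow> real" where
  "mc_expect m \<theta> f \<equiv> (\<Sum>\<^sub>\<infinity>d. (mc_symbol m \<theta> d)\<^sup>2 * f (of_int d / \<theta>))"

abbreviation mc_mean :: "nat \<Rightarrow> real \<Rightarrow> int \<Rightarrow> real" where
  "mc_mean m \<theta> \<equiv> multicritical.mean \<theta> m"

lemma phase_eq: "multicritical.phase m \<theta> \<phi> = \<theta> * mc_phase m \<phi>"
  by (simp add: multicritical.phase_def mc_phase_def sum_distrib_left mult_ac)

lemma DERIV_mc_phase: "(mc_phase m has_real_derivative mc_velocity m \<phi>) (at \<phi>)"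
  unfolding mc_phase_def mc_velocity_def by (auto intro!: derivative_eq_intros sum.cong)

lemma continuous_mc_phase [continuous_intros]:
  fixes f :: "real \<Rightarrow> real"
  shows "continuous_on A f \<Longrightarrow> continuous_on A (\<lambda>x. mc_phase m (f x))"
  unfolding mc_phase_def by (auto intro!: continuous_intros)

lemma continuous_mc_velocity [continuous_intros]:
  fixes f :: "real \<Rightarrow> real"
  shows "continuous_on A f \<Longrightarrow> continuous_on A (\<lambda>x. mc_velocity m (f x))"
  unfolding mc_velocity_def by (auto intro!: continuous_intros)

lemma mc_velocity_bound: "\<bar>mc_velocity m \<phi>\<bar> \<le> mc_bound m"
proof -
  have "\<bar>mc_velocity m \<phi>\<bar> \<le> (\<Sum>r=1..m. \<bar>2 * real r * mc_gamma m r * cos (real r * \<phi>)\<bar>)"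
    unfolding mc_velocity_def by (rule sum_abs)
  also have "\<dots> \<le> (\<Sum>r=1..m. 2 * (real r * \<bar>mc_gamma m r\<bar>))"
  proof (rule sum_mono)
    fix r
    have "\<bar>2 * real r * mc_gamma m r * cos (real r * \<phi>)\<bar> = (2 * (real r * \<bar>mc_gamma m r\<bar>)) * \<bar>cos (real r * \<phi>)\<bar>"
      by (simp add: abs_mult)
    also have "\<dots> \<le> (2 * (real r * \<bar>mc_gamma m r\<bar>)) * 1"
      by (rule mult_left_mono) simp_all
    finally show "\<bar>2 * real r * mc_gamma m r * cos (real r * \<phi>)\<bar> \<le> 2 * (real r * \<bar>mc_gamma m r\<bar>)" by simp
  qed
  finally show ?thesis by (simp add: mc_bound_def sum_distrib_left)
qed

section \<open>The rescaled law of the weights and its weak limit\<close>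

definition quantum_measure :: "nat \<Rightarrow> real \<Rightarrow> real measure" where
  "quantum_measure m \<theta> = distr (density (count_space UNIV) (\<lambda>d. ennreal ((mc_symbol m \<theta> d)\<^sup>2))) borel (\<lambda>d. of_int d / \<theta>)"

definition classical_measure :: "nat \<Rightarrow> real measure" where
  "classical_measure m = distr (density lborel (\<lambda>\<phi>. ennreal (indicator {0..2 * pi} \<phi> / (2 * pi)))) borel (mc_velocity m)"

lemma u_sq_abs: "(\<lambda>d. norm ((mc_symbol m \<theta> d)\<^sup>2)) summable_on UNIV"
  using multicritical.u_sq_summable by simp

lemma real_distribution_quantum: "real_distribution (quantum_measure m \<theta>)"
proof -
  have "(\<integral>\<^sup>+d. ennreal ((mc_symbol m \<theta> d)\<^sup>2) \<partial>count_space UNIV) = ennreal (infsetsum (\<lambda>d. (mc_symbol m \<theta> d)\<^sup>2) UNIV)"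
    by (rule nn_integral_conv_infsetsum) (use abs_summable_equivalent[THEN iffD1, OF u_sq_abs] in auto)
  also have "infsetsum (\<lambda>d. (mc_symbol m \<theta> d)\<^sup>2) UNIV = 1"
    unfolding infsetsum_infsum[OF abs_summable_equivalent[THEN iffD1, OF u_sq_abs]]
    by (rule infsumI[OF multicritical.u_sq_has_sum])
  finally have "prob_space (density (count_space UNIV) (\<lambda>d. ennreal ((mc_symbol m \<theta> d)\<^sup>2)))"
    by (intro prob_spaceI) (simp add: emeasure_density)
  then show ?thesis unfolding quantum_measure_def by (rule prob_space.real_distribution_distr) simp
qed

lemma integral_quantum:
  fixes f :: "real \<Rightarrow> 'b :: {banach, second_countable_topology}"
  assumes f: "f \<in> borel_measurable borel" and B: "\<And>x. norm (f x) \<le> B"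
  shows "integral\<^sup>L (quantum_measure m \<theta>) f = (\<Sum>\<^sub>\<infinity>d. (mc_symbol m \<theta> d)\<^sup>2 *\<^sub>R f (of_int d / \<theta>))"
proof -
  have "integral\<^sup>L (quantum_measure m \<theta>) f = (LINT d|count_space UNIV. (mc_symbol m \<theta> d)\<^sup>2 *\<^sub>R f (of_int d / \<theta>))"
    unfolding quantum_measure_def by (subst integral_distr) (simp_all add: f integral_density)
  also have "\<dots> = (\<Sum>\<^sub>\<infinity>d. (mc_symbol m \<theta> d)\<^sup>2 *\<^sub>R f (of_int d / \<theta>))"
  proof (rule lebesgue_integral_count_space_eq_infsum, rule Infinite_Sum.abs_summable_on_comparison_test')
    show "(\<lambda>d. (mc_symbol m \<theta> d)\<^sup>2 * B) summable_on UNIV"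
      by (rule summable_on_cmult_left[OF multicritical.u_sq_summable])
    show "norm ((mc_symbol m \<theta> d)\<^sup>2 *\<^sub>R f (of_int d / \<theta>)) \<le> (mc_symbol m \<theta> d)\<^sup>2 * B" for d
      using B by (simp add: mult_left_mono)
  qed
  finally show ?thesis .
qed

lemma integral_classical:
  fixes f :: "real \<Rightarrow> 'b :: euclidean_space"
  assumes f: "continuous_on UNIV f"
  shows "integral\<^sup>L (classical_measure m) f = (1 / (2 * pi)) *\<^sub>R integral {0..2 * pi} (\<lambda>\<phi>. f (mc_velocity m \<phi>))"
proof -
  have meas: "mc_velocity m \<in> borel_measurable borel" "f \<in> borel_measurable borel"
    by (intro borel_measurable_continuous_onI continuous_intros f)+
  have cont: "continuous_on {0..2 * pi} (\<lambda>\<phi>. f (mc_velocity m \<phi>))"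
    by (intro continuous_on_compose2[OF f] continuous_intros) auto
  have "integral\<^sup>L (classical_measure m) f = (LINT \<phi>|lborel. (indicator {0..2 * pi} \<phi> / (2 * pi)) *\<^sub>R f (mc_velocity m \<phi>))"
    unfolding classical_measure_def
    by (subst integral_distr) (use meas in \<open>simp_all add: integral_density measurable_compose[of _ _ borel]\<close>)
  also have "\<dots> = (LINT \<phi>|lborel. (1 / (2 * pi)) *\<^sub>R (indicator {0..2 * pi} \<phi> *\<^sub>R f (mc_velocity m \<phi>)))"
    by (rule Bochner_Integration.integral_cong) auto
  also have "\<dots> = (1 / (2 * pi)) *\<^sub>R (LINT \<phi>:{0..2 * pi}|lborel. f (mc_velocity m \<phi>))"
    unfolding set_lebesgue_integral_def by (rule integral_scaleR_right)
  also have "(LINT \<phi>:{0..2 * pi}|lborel. f (mc_velocity m \<phi>)) = integral {0..2 * pi} (\<lambda>\<phi>. f (mc_velocity m \<phi>))"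
    by (rule set_borel_integral_eq_integral(2)[OF borel_integrable_atLeastAtMost'[OF cont]])
  finally show ?thesis .
qed

lemma real_distribution_classical: "real_distribution (classical_measure m)"
proof -
  have "(\<integral>\<^sup>+\<phi>. ennreal (indicator {0..2 * pi} \<phi> / (2 * pi)) \<partial>lborel) = (\<integral>\<^sup>+\<phi>. ennreal (1 / (2 * pi)) * indicator {0..2 * pi} \<phi> \<partial>lborel)"
    by (rule nn_integral_cong) (auto split: split_indicator)
  also have "\<dots> = ennreal (1 / (2 * pi)) * ennreal (2 * pi)"
    by (simp add: nn_integral_cmult_indicator)
  also have "\<dots> = 1" by (simp flip: ennreal_mult)
  finally have "prob_space (density lborel (\<lambda>\<phi>. ennreal (indicator {0..2 * pi} \<phi> / (2 * pi))))"
    by (intro prob_spaceI) (simp add: emeasure_density)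
  then show ?thesis unfolding classical_measure_def
    by (rule prob_space.real_distribution_distr) (auto intro!: borel_measurable_continuous_onI continuous_intros)
qed

lemma char_quantum:
  "char (quantum_measure m \<theta>) s = (1 / (2 * pi)) *\<^sub>R integral {0..2 * pi} (\<lambda>\<phi>. cis (\<theta> * (mc_phase m (\<phi> + s / \<theta>) - mc_phase m \<phi>)))"
proof -
  have "char (quantum_measure m \<theta>) s = (\<Sum>\<^sub>\<infinity>d. (mc_symbol m \<theta> d)\<^sup>2 *\<^sub>R iexp (s * (of_int d / \<theta>)))"
    unfolding char_def by (rule integral_quantum[where B = 1]) auto
  also have "\<dots> = (\<Sum>\<^sub>\<infinity>d. of_real ((mc_symbol m \<theta> d)\<^sup>2) * cis (of_int d * (s / \<theta>)))"
    by (rule infsum_cong) (simp add: scaleR_conv_of_real cis_conv_exp mult_ac)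
  also have "2 * pi * \<dots> = integral {0..2 * pi} (\<lambda>\<phi>. cis (\<theta> * (mc_phase m (\<phi> + s / \<theta>) - mc_phase m \<phi>)))"
    using integral_unique[OF multicritical.symbol_char[of m \<theta> "s / \<theta>"]] by (simp add: phase_eq right_diff_distrib)
  finally show ?thesis by (simp add: scaleR_conv_of_real field_simps)
qed

text \<open>The exponent is s times a difference quotient of the phase with step s/\<theta>, so it
  tends to s times the derivative; the integrands have modulus one, which dominates.\<close>

lemma char_quantum_tendsto:
  assumes X: "filterlim X at_top sequentially"
  shows "(\<lambda>n. char (quantum_measure m (X n)) s) \<longlonglongrightarrow> char (classical_measure m) s"
proof -
  have "char (classical_measure m) s = (1 / (2 * pi)) *\<^sub>R integral {0..2 * pi} (\<lambda>\<phi>. cis (s * mc_velocity m \<phi>))"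
    unfolding char_def by (subst integral_classical) (auto intro!: continuous_intros simp: cis_conv_exp)
  moreover have "(\<lambda>n. integral {0..2 * pi} (\<lambda>\<phi>. cis (X n * (mc_phase m (\<phi> + s / X n) - mc_phase m \<phi>))))
      \<longlonglongrightarrow> integral {0..2 * pi} (\<lambda>\<phi>. cis (s * mc_velocity m \<phi>))"
  proof (rule dominated_convergence(2)[where h = "\<lambda>_. 1"])
    show "(\<lambda>\<phi>. cis (X n * (mc_phase m (\<phi> + s / X n) - mc_phase m \<phi>))) integrable_on {0..2 * pi}" for n
      unfolding cis_conv_exp by (intro integrable_continuous_interval continuous_intros)
    fix \<phi> :: real
    have "((\<lambda>y. mc_phase m (\<phi> + s * y)) has_real_derivative s * mc_velocity m \<phi>) (at 0)"
      by (rule DERIV_chain'[where f = "\<lambda>y. \<phi> + s * y" and g = "mc_phase m", THEN DERIV_cong])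
        (auto intro!: derivative_eq_intros DERIV_mc_phase simp: mult.commute)
    then have lim: "((\<lambda>y. (mc_phase m (\<phi> + s * y) - mc_phase m \<phi>) / y) \<longlongrightarrow> s * mc_velocity m \<phi>) (at 0)"
      by (simp add: has_field_derivative_iff)
    have "filterlim (\<lambda>n. inverse (X n)) (at 0) sequentially"
      using filterlim_compose[OF filterlim_inverse_at_right_top X] by (meson at_within_le_at filterlim_mono order_refl)
    from filterlim_compose[OF lim this]
    have "(\<lambda>n. X n * (mc_phase m (\<phi> + s / X n) - mc_phase m \<phi>)) \<longlonglongrightarrow> s * mc_velocity m \<phi>"
      by (simp add: field_simps)
    then show "(\<lambda>n. cis (X n * (mc_phase m (\<phi> + s / X n) - mc_phase m \<phi>))) \<longlonglongrightarrow> cis (s * mc_velocity m \<phi>)"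
      unfolding cis_conv_exp by (intro tendsto_exp tendsto_mult_left tendsto_of_real)
  qed auto
  ultimately show ?thesis unfolding char_quantum by (auto intro!: tendsto_intros)
qed

lemma quantum_bounded_tendsto:
  fixes f :: "real \<Rightarrow> real"
  assumes X: "filterlim X at_top sequentially" and f: "continuous_on UNIV f" and B: "\<And>x. norm (f x) \<le> B"
  shows "(\<lambda>n. mc_expect m (X n) f) \<longlonglongrightarrow> integral {0..2 * pi} (\<lambda>\<phi>. f (mc_velocity m \<phi>)) / (2 * pi)"
proof -
  have "weak_conv_m (\<lambda>n. quantum_measure m (X n)) (classical_measure m)"
    by (rule levy_continuity[OF real_distribution_quantum real_distribution_classical char_quantum_tendsto[OF X]])
  from weak_conv_imp_integral_bdd_continuous_conv[OF real_distribution_quantum real_distribution_classical this _ B]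
  have "(\<lambda>n. integral\<^sup>L (quantum_measure m (X n)) f) \<longlonglongrightarrow> integral\<^sup>L (classical_measure m) f"
    using f by (simp add: continuous_on_eq_continuous_at)
  moreover have "f \<in> borel_measurable borel" by (rule borel_measurable_continuous_onI[OF f])
  ultimately show ?thesis by (simp add: integral_quantum[OF _ B] integral_classical[OF f])
qed

text \<open>The one-sided series, extended by zeros, becomes the expectation of a positive part over
  all integers, the form to which weak convergence applies.\<close>

lemma mc_mean_has_sum: "((\<lambda>d. (mc_symbol m \<theta> d)\<^sup>2 * max 0 (of_int d - of_int n)) has_sum mc_mean m \<theta> n) UNIV"
proof -
  have "(\<lambda>e. real (Suc e) * (mc_symbol m \<theta> (n + 1 + int e))\<^sup>2) sums mc_mean m \<theta> n"
    by (rule multicritical.mean_sums)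
  then have "((\<lambda>e. real (Suc e) * (mc_symbol m \<theta> (n + 1 + int e))\<^sup>2) has_sum mc_mean m \<theta> n) UNIV"
    by (rule sums_nonneg_imp_has_sum) simp
  then have "((\<lambda>k. (of_int k + 1) * (mc_symbol m \<theta> (n + 1 + k))\<^sup>2) has_sum mc_mean m \<theta> n) (range int)"
    by (subst has_sum_reindex) (auto simp: o_def inj_on_def add_ac)
  then have "((\<lambda>k. (mc_symbol m \<theta> (n + 1 + k))\<^sup>2 * max 0 (of_int (n + 1 + k) - of_int n)) has_sum mc_mean m \<theta> n) UNIV"
  proof (rule has_sum_cong_neutral[THEN iffD1, rotated -1])
    fix k :: int assume "k \<in> UNIV - range int"
    then have "k < 0" by (metis DiffD2 nonneg_int_cases not_le rangeI)
    then show "(mc_symbol m \<theta> (n + 1 + k))\<^sup>2 * max 0 (of_int (n + 1 + k) - of_int n) = 0" by simp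
  qed (auto simp: mult.commute)
  moreover have "bij_betw (\<lambda>k. n + 1 + k) UNIV UNIV" by (rule bij_betwI[of _ _ _ "\<lambda>d. d - n - 1"]) auto
  ultimately show ?thesis
    using has_sum_reindex_bij_betw[of "\<lambda>k. n + 1 + k" UNIV UNIV "\<lambda>d. (mc_symbol m \<theta> d)\<^sup>2 * max 0 (of_int d - of_int n)"] by simp
qed

lemma quantum_second_moment:
  shows "(\<lambda>d. (mc_symbol m \<theta> d)\<^sup>2 * (of_int d / \<theta>)\<^sup>2) summable_on UNIV"
    and "mc_expect m \<theta> (\<lambda>y. y\<^sup>2) \<le> (mc_bound m)\<^sup>2"
proof -
  have eq: "(mc_symbol m \<theta> d)\<^sup>2 * (of_int d / \<theta>)\<^sup>2 = (of_int d * mc_symbol m \<theta> d)\<^sup>2 * (1 / \<theta>\<^sup>2)" for d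
    by (simp add: power_mult_distrib power_divide mult_ac)
  show "(\<lambda>d. (mc_symbol m \<theta> d)\<^sup>2 * (of_int d / \<theta>)\<^sup>2) summable_on UNIV"
    unfolding eq by (rule summable_on_cmult_left[OF multicritical.u_second_moment(1)])
  have "mc_expect m \<theta> (\<lambda>y. y\<^sup>2) = (\<Sum>\<^sub>\<infinity>d. (of_int d * mc_symbol m \<theta> d)\<^sup>2) * (1 / \<theta>\<^sup>2)"
    unfolding eq by (rule infsum_cmult_left) (rule multicritical.u_second_moment(1))
  also have "\<dots> \<le> (2 * (\<Sum>r=1..m. real r * \<bar>\<theta> * mc_gamma m r\<bar>))\<^sup>2 * (1 / \<theta>\<^sup>2)"
    by (rule mult_right_mono[OF multicritical.u_second_moment(2)]) simp
  also have "2 * (\<Sum>r=1..m. real r * \<bar>\<theta> * mc_gamma m r\<bar>) = \<bar>\<theta>\<bar> * mc_bound m"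
    by (simp add: mc_bound_def abs_mult sum_distrib_left mult_ac)
  also have "(\<bar>\<theta>\<bar> * mc_bound m)\<^sup>2 * (1 / \<theta>\<^sup>2) \<le> (mc_bound m)\<^sup>2"
    by (cases "\<theta> = 0") (simp_all add: power_mult_distrib)
  finally show "mc_expect m \<theta> (\<lambda>y. y\<^sup>2) \<le> (mc_bound m)\<^sup>2" .
qed

text \<open>The truncation error of the unbounded test function \<open>max 0 (y - x)\<close> is controlled by the
  second moment, uniformly in \<open>\<theta>\<close>.\<close>

lemma truncation_error:
  fixes x R :: real
  assumes R: "0 < R"
  defines "f \<equiv> \<lambda>y. max 0 (y - x)"
  shows "(\<lambda>d. (mc_symbol m \<theta> d)\<^sup>2 * f (of_int d / \<theta>)) summable_on UNIV"
    and "\<bar>mc_expect m \<theta> f - mc_expect m \<theta> (\<lambda>y. min R (f y))\<bar>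
      \<le> 2 * ((mc_bound m)\<^sup>2 + x\<^sup>2) / R"
proof -
  define w where "w d = (mc_symbol m \<theta> d)\<^sup>2" for d
  define y where "y d = of_int d / \<theta>" for d :: int
  have w0: "0 \<le> w d" for d by (simp add: w_def)
  have w: "(w has_sum 1) UNIV" unfolding w_def by (rule multicritical.u_sq_has_sum)
  have ws: "w summable_on UNIV" using w by (rule has_sum_imp_summable)
  have y2: "(\<lambda>d. w d * (y d)\<^sup>2) summable_on UNIV" "(\<Sum>\<^sub>\<infinity>d. w d * (y d)\<^sup>2) \<le> (mc_bound m)\<^sup>2"
    unfolding w_def y_def by (rule quantum_second_moment)+
  have f0: "0 \<le> f z" for z by (simp add: f_def)
  have sq: "(f z)\<^sup>2 \<le> 2 * (z\<^sup>2 + x\<^sup>2)" for z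
  proof -
    have "(f z)\<^sup>2 \<le> (z - x)\<^sup>2" by (auto simp: f_def max_def)
    also have "\<dots> \<le> 2 * (z\<^sup>2 + x\<^sup>2)" using zero_le_power2[of "z + x"] by (simp add: power2_sum power2_diff)
    finally show ?thesis .
  qed
  \<comment> \<open>The truncation acts only where f z > R, and there the excess times R is at most
    the square of f z.\<close>
  have tail: "f z - min R (f z) \<le> 2 * (z\<^sup>2 + x\<^sup>2) / R" for z
  proof (cases "f z \<le> R")
    case True
    then show ?thesis using R by simp
  next
    case False
    then have "(f z - min R (f z)) * R \<le> f z * f z" using R by (intro mult_mono) auto
    also have "\<dots> \<le> 2 * (z\<^sup>2 + x\<^sup>2)" using sq[of z] by (simp add: power2_eq_square)
    finally show ?thesis using R by (simp add: field_simps)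
  qed
  have trunc: "(\<lambda>d. w d * min R (f (y d))) summable_on UNIV"
    by (rule summable_on_comparison_test[OF summable_on_cmult_left[OF ws, of R]])
      (use w0 f0 R in \<open>auto intro!: mult_left_mono mult_nonneg_nonneg\<close>)
  have maj: "((\<lambda>d. (2 / R) * (w d * (y d)\<^sup>2 + w d * x\<^sup>2)) has_sum (2 / R) * ((\<Sum>\<^sub>\<infinity>d. w d * (y d)\<^sup>2) + 1 * x\<^sup>2)) UNIV"
    by (intro has_sum_cmult_right has_sum_add has_sum_infsum y2 has_sum_cmult_left w)
  have le: "w d * (f (y d) - min R (f (y d))) \<le> (2 / R) * (w d * (y d)\<^sup>2 + w d * x\<^sup>2)" for d
    using mult_left_mono[OF tail[of "y d"] w0[of d]] by (simp add: field_simps)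
  have diff: "(\<lambda>d. w d * (f (y d) - min R (f (y d)))) summable_on UNIV"
    by (rule summable_on_comparison_test[OF has_sum_imp_summable[OF maj] le]) (simp add: w0)
  have split: "w d * f (y d) = w d * (f (y d) - min R (f (y d))) + w d * min R (f (y d))" for d
    by (simp add: algebra_simps)
  have "(\<lambda>d. w d * f (y d)) summable_on UNIV"
    unfolding split by (rule summable_on_add[OF diff trunc])
  then show "(\<lambda>d. (mc_symbol m \<theta> d)\<^sup>2 * f (of_int d / \<theta>)) summable_on UNIV" by (simp add: w_def y_def)
  have "(\<Sum>\<^sub>\<infinity>d. w d * f (y d)) = (\<Sum>\<^sub>\<infinity>d. w d * (f (y d) - min R (f (y d)))) + (\<Sum>\<^sub>\<infinity>d. w d * min R (f (y d)))"
    unfolding split[of _] by (rule infsum_add[OF diff trunc])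
  moreover have "0 \<le> (\<Sum>\<^sub>\<infinity>d. w d * (f (y d) - min R (f (y d))))"
    by (rule infsum_nonneg) (simp add: w0)
  moreover have "(\<Sum>\<^sub>\<infinity>d. w d * (f (y d) - min R (f (y d)))) \<le> (2 / R) * ((\<Sum>\<^sub>\<infinity>d. w d * (y d)\<^sup>2) + 1 * x\<^sup>2)"
    by (rule has_sum_mono[OF has_sum_infsum[OF diff] maj le])
  moreover have "(2 / R) * ((\<Sum>\<^sub>\<infinity>d. w d * (y d)\<^sup>2) + 1 * x\<^sup>2) \<le> (2 / R) * ((mc_bound m)\<^sup>2 + x\<^sup>2)"
    using y2(2) R by (intro mult_left_mono) auto
  ultimately have "\<bar>(\<Sum>\<^sub>\<infinity>d. w d * f (y d)) - (\<Sum>\<^sub>\<infinity>d. w d * min R (f (y d)))\<bar> \<le> (2 / R) * ((mc_bound m)\<^sup>2 + x\<^sup>2)"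
    by linarith
  then show "\<bar>mc_expect m \<theta> f - mc_expect m \<theta> (\<lambda>y. min R (f y))\<bar>
      \<le> 2 * ((mc_bound m)\<^sup>2 + x\<^sup>2) / R"
    by (simp add: w_def y_def)
qed

lemma quantum_positive_part_tendsto:
  assumes X: "filterlim X at_top sequentially"
  shows "(\<lambda>n. mc_expect m (X n) (\<lambda>y. max 0 (y - x)))
     \<longlonglongrightarrow> integral {0..2 * pi} (\<lambda>\<phi>. max 0 (mc_velocity m \<phi> - x)) / (2 * pi)" (is "?E \<longlonglongrightarrow> ?L")
proof (rule LIMSEQ_I)
  fix e :: real assume e: "0 < e"
  define c where "c = 2 * ((mc_bound m)\<^sup>2 + x\<^sup>2)"
  have b0: "0 \<le> mc_bound m" by (auto simp: mc_bound_def intro!: sum_nonneg)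
  \<comment> \<open>The first bound keeps the truncation from touching the limit, whose values are
    at most \<open>mc_bound m\<close>; the second makes the truncation error less than e /
    2.\<close>
  define R where "R = max (mc_bound m + \<bar>x\<bar> + 1) (2 * c / e + 1)"
  have R: "0 < R" "mc_bound m + \<bar>x\<bar> \<le> R" "2 * c / e < R" using b0 by (auto simp: R_def)
  have cR: "c / R < e / 2" using R e by (simp add: field_simps)
  have "(\<lambda>n. mc_expect m (X n) (\<lambda>y. min R (max 0 (y - x))))
     \<longlonglongrightarrow> integral {0..2 * pi} (\<lambda>\<phi>. min R (max 0 (mc_velocity m \<phi> - x))) / (2 * pi)"
    by (rule quantum_bounded_tendsto[OF X, where B = R and f = "\<lambda>y. min R (max 0 (y - x))"])
      (use R in \<open>simp_all add: continuous_on_min continuous_on_max continuous_on_diff continuous_on_const continuous_on_id\<close>)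
  moreover have "min R (max 0 (mc_velocity m \<phi> - x)) = max 0 (mc_velocity m \<phi> - x)" for \<phi>
  proof -
    have "mc_velocity m \<phi> - x \<le> R" using mc_velocity_bound[of m \<phi>] R(2) by linarith
    then show ?thesis using R(1) by simp
  qed
  ultimately have lim: "(\<lambda>n. mc_expect m (X n) (\<lambda>y. min R (max 0 (y - x)))) \<longlonglongrightarrow> ?L" by simp
  obtain N where N: "\<And>n. N \<le> n \<Longrightarrow> norm (mc_expect m (X n) (\<lambda>y. min R (max 0 (y - x))) - ?L) < e / 2"
    using LIMSEQ_D[OF lim, of "e / 2"] e by auto
  show "\<exists>N. \<forall>n\<ge>N. norm (?E n - ?L) < e"
  proof (intro exI allI impI)
    fix n assume "N \<le> n"
    define T where "T = mc_expect m (X n) (\<lambda>y. min R (max 0 (y - x)))"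
    have "norm (T - ?L) < e / 2" unfolding T_def by (rule N) fact
    moreover have "norm (?E n - T) \<le> c / R"
      unfolding c_def T_def real_norm_def by (rule truncation_error(2)[OF R(1)])
    moreover have "norm (?E n - ?L) \<le> norm (?E n - T) + norm (T - ?L)"
      by (rule order.trans[OF eq_refl norm_triangle_ineq], rule arg_cong[where f = norm]) simp
    ultimately have "norm (?E n - ?L) < c / R + e / 2" by (meson add_le_less_mono le_less_trans)
    also have "\<dots> < e / 2 + e / 2" using cR by (rule add_strict_right_mono)
    also have "\<dots> = e" by simp
    finally show "norm (?E n - ?L) < e" .
  qed
qed

text \<open>Rounding \<theta> x down to an integer raises the positive part by at most 1/\<theta>,
  and the weights sum to 1, so the mean and the expectation differ by at most 1/\<theta>.\<close>

lemma mc_mean_tendsto: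
  "((\<lambda>\<theta>. mc_mean m \<theta> \<lfloor>\<theta> * x\<rfloor> / \<theta>) \<longlongrightarrow> integral {0..2 * pi} (\<lambda>\<phi>. max 0 (mc_velocity m \<phi> - x)) / (2 * pi)) at_top"
proof (rule tendsto_at_topI_sequentially)
  fix X :: "nat \<Rightarrow> real" assume X: "filterlim X at_top sequentially"
  let ?L = "integral {0..2 * pi} (\<lambda>\<phi>. max 0 (mc_velocity m \<phi> - x)) / (2 * pi)"
  define E where "E n = mc_expect m (X n) (\<lambda>y. max 0 (y - x))" for n
  have E: "E \<longlonglongrightarrow> ?L" unfolding E_def by (rule quantum_positive_part_tendsto[OF X])
  have "\<forall>\<^sub>F n in sequentially. 1 \<le> X n" using X by (simp add: filterlim_at_top)
  then have "\<forall>\<^sub>F n in sequentially. norm (mc_mean m (X n) \<lfloor>X n * x\<rfloor> / X n - E n) \<le> 1 / X n"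
  proof eventually_elim
    case (elim n)
    define \<theta> where "\<theta> = X n"
    have th: "0 < \<theta>" using elim by (simp add: \<theta>_def)
    define w where "w d = (mc_symbol m \<theta> d)\<^sup>2" for d
    have w: "(w has_sum 1) UNIV" unfolding w_def by (rule multicritical.u_sq_has_sum)
    have "((\<lambda>d. w d * max 0 (of_int d - of_int \<lfloor>\<theta> * x\<rfloor>) * (1 / \<theta>)) has_sum mc_mean m \<theta> \<lfloor>\<theta> * x\<rfloor> * (1 / \<theta>)) UNIV"
      unfolding w_def by (rule has_sum_cmult_left[OF mc_mean_has_sum])
    moreover have "((\<lambda>d. w d * max 0 (of_int d / \<theta> - x)) has_sum E n) UNIV"
      unfolding w_def E_def \<theta>_def[symmetric] by (rule has_sum_infsum[OF truncation_error(1)[of 1]]) simp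
    moreover have "((\<lambda>d. w d * (1 / \<theta>)) has_sum 1 * (1 / \<theta>)) UNIV" by (rule has_sum_cmult_left[OF w])
    moreover have "max 0 (of_int d / \<theta> - x) \<le> max 0 (of_int d - of_int \<lfloor>\<theta> * x\<rfloor>) * (1 / \<theta>)
        \<and> max 0 (of_int d - of_int \<lfloor>\<theta> * x\<rfloor>) * (1 / \<theta>) \<le> max 0 (of_int d / \<theta> - x) + 1 / \<theta>" for d :: int
    proof -
      have "of_int \<lfloor>\<theta> * x\<rfloor> \<le> \<theta> * x" "\<theta> * x \<le> of_int \<lfloor>\<theta> * x\<rfloor> + 1" by linarith+
      then have *: "of_int \<lfloor>\<theta> * x\<rfloor> / \<theta> \<le> x" "x \<le> of_int \<lfloor>\<theta> * x\<rfloor> / \<theta> + 1 / \<theta>"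
        using th by (simp_all add: field_simps)
      have "max 0 (of_int d - of_int \<lfloor>\<theta> * x\<rfloor>) * (1 / \<theta>) = max 0 (of_int d / \<theta> - of_int \<lfloor>\<theta> * x\<rfloor> / \<theta>)"
        using th by (simp add: max_def field_simps)
      then show ?thesis using * th by (auto simp: max_def)
    qed
    ultimately have "E n \<le> mc_mean m \<theta> \<lfloor>\<theta> * x\<rfloor> * (1 / \<theta>) \<and> mc_mean m \<theta> \<lfloor>\<theta> * x\<rfloor> * (1 / \<theta>) \<le> E n + 1 * (1 / \<theta>)"
    proof (intro conjI)
      assume a: "((\<lambda>d. w d * max 0 (of_int d - of_int \<lfloor>\<theta> * x\<rfloor>) * (1 / \<theta>)) has_sum mc_mean m \<theta> \<lfloor>\<theta> * x\<rfloor> * (1 / \<theta>)) UNIV"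
        and b: "((\<lambda>d. w d * max 0 (of_int d / \<theta> - x)) has_sum E n) UNIV"
        and c: "((\<lambda>d. w d * (1 / \<theta>)) has_sum 1 * (1 / \<theta>)) UNIV"
        and le: "\<And>d :: int. max 0 (of_int d / \<theta> - x) \<le> max 0 (of_int d - of_int \<lfloor>\<theta> * x\<rfloor>) * (1 / \<theta>)
        \<and> max 0 (of_int d - of_int \<lfloor>\<theta> * x\<rfloor>) * (1 / \<theta>) \<le> max 0 (of_int d / \<theta> - x) + 1 / \<theta>"
      have w0: "0 \<le> w d" for d by (simp add: w_def)
      show "E n \<le> mc_mean m \<theta> \<lfloor>\<theta> * x\<rfloor> * (1 / \<theta>)"
      proof (rule has_sum_mono[OF b a])
        fix d
        show "w d * max 0 (of_int d / \<theta> - x) \<le> w d * max 0 (of_int d - of_int \<lfloor>\<theta> * x\<rfloor>) * (1 / \<theta>)"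
          unfolding mult.assoc by (rule mult_left_mono[OF conjunct1[OF le] w0])
      qed
      show "mc_mean m \<theta> \<lfloor>\<theta> * x\<rfloor> * (1 / \<theta>) \<le> E n + 1 * (1 / \<theta>)"
      proof (rule has_sum_mono[OF a has_sum_add[OF b c]])
        fix d
        show "w d * max 0 (of_int d - of_int \<lfloor>\<theta> * x\<rfloor>) * (1 / \<theta>) \<le> w d * max 0 (of_int d / \<theta> - x) + w d * (1 / \<theta>)"
          unfolding mult.assoc distrib_left[symmetric] by (rule mult_left_mono[OF conjunct2[OF le] w0])
      qed
    qed
    then have "\<bar>mc_mean m \<theta> \<lfloor>\<theta> * x\<rfloor> / \<theta> - E n\<bar> \<le> 1 / \<theta>"
      unfolding abs_le_iff by simp
    then show ?case by (simp only: \<theta>_def real_norm_def)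
  qed
  moreover have "(\<lambda>n. 1 / X n) \<longlonglongrightarrow> 0"
    using tendsto_inverse_0_at_top[OF X] by (simp add: inverse_eq_divide)
  ultimately have "(\<lambda>n. mc_mean m (X n) \<lfloor>X n * x\<rfloor> / X n - E n) \<longlonglongrightarrow> 0"
    by (rule Lim_null_comparison)
  from tendsto_add[OF this E] show "(\<lambda>n. mc_mean m (X n) \<lfloor>X n * x\<rfloor> / X n) \<longlonglongrightarrow> ?L" by simp
qed

section \<open>The limit profile\<close>


text \<open>On the unit circle 2 - 2 cos \<phi> is - (1 - z)^2 / z, so its m-th power has
  alternating central binomial coefficients as Fourier coefficients, symmetric about the
  middle.\<close>

lemma power_two_minus_two_cos:
  "(2 - 2 * cos \<phi>) ^ m = real ((2 * m) choose m) + 2 * (\<Sum>r=1..m. (-1) ^ r * real ((2 * m) choose (m + r)) * cos (real r * \<phi>))"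
proof -
  define z where "z = cis \<phi>"
  define c where "c k = (-1) ^ (k + m) * real ((2 * m) choose k) * cos ((real k - real m) * \<phi>)" for k
  have z: "z \<noteq> 0" "z * cis (- \<phi>) = 1" by (simp_all add: z_def cis_mult)
  have "of_real (2 - 2 * cos \<phi>) = - ((1 - z)\<^sup>2 * cis (- \<phi>))"
  proof -
    have "(1 - z)\<^sup>2 * cis (- \<phi>) = cis (- \<phi>) - 2 * (z * cis (- \<phi>)) + z * (z * cis (- \<phi>))"
      by (simp add: power2_eq_square algebra_simps)
    also have "\<dots> = cis (- \<phi>) + cis \<phi> - 2" by (simp only: z) (simp add: z_def)
    finally show ?thesis by (simp add: complex_eq_iff)
  qed
  then have "of_real ((2 - 2 * cos \<phi>) ^ m) = (- ((1 - z)\<^sup>2 * cis (- \<phi>))) ^ m"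
    by (simp only: of_real_power)
  also have "\<dots> = (-1) ^ m * ((1 - z) ^ (2 * m) * cis (- (real m * \<phi>)))"
    by (subst power_minus) (simp add: power_mult_distrib power_mult Complex.DeMoivre)
  also have "(1 - z) ^ (2 * m) = (\<Sum>k\<le>2 * m. of_nat ((2 * m) choose k) * (- z) ^ k)"
    using binomial_ring[of "- z" 1 "2 * m"] by simp
  also have "(-1) ^ m * ((\<Sum>k\<le>2 * m. of_nat ((2 * m) choose k) * (- z) ^ k) * cis (- (real m * \<phi>)))
     = (\<Sum>k\<le>2 * m. of_real ((-1) ^ (k + m) * real ((2 * m) choose k)) * cis ((real k - real m) * \<phi>))"
    unfolding sum_distrib_left sum_distrib_right
  proof (rule sum.cong[OF refl])
    fix k
    have "(- z) ^ k * cis (- (real m * \<phi>)) = (-1) ^ k * cis ((real k - real m) * \<phi>)"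
      by (subst power_minus) (simp add: z_def Complex.DeMoivre cis_mult algebra_simps)
    then show "(-1) ^ m * (of_nat ((2 * m) choose k) * (- z) ^ k * cis (- (real m * \<phi>)))
       = of_real ((-1) ^ (k + m) * real ((2 * m) choose k)) * cis ((real k - real m) * \<phi>)"
      by (simp add: power_add mult_ac)
  qed
  finally have "complex_of_real ((2 - 2 * cos \<phi>) ^ m)
     = (\<Sum>k\<le>2 * m. of_real ((-1) ^ (k + m) * real ((2 * m) choose k)) * cis ((real k - real m) * \<phi>))" .
  from arg_cong[OF this, of Re] have "(2 - 2 * cos \<phi>) ^ m = (\<Sum>k\<le>2 * m. c k)" by (simp add: c_def)
  also have "{..2 * m} = {..<m} \<union> {m} \<union> {m<..2 * m}" by auto
  also have "sum c \<dots> = (\<Sum>k<m. c k) + c m + (\<Sum>k\<in>{m<..2 * m}. c k)"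
    by (subst sum.union_disjoint; auto)+
  also have "(\<Sum>k<m. c k) = (\<Sum>r=1..m. (-1) ^ r * real ((2 * m) choose (m + r)) * cos (real r * \<phi>))"
  proof (rule sum.reindex_bij_witness[of _ "\<lambda>r. m - r" "\<lambda>k. m - k"])
    fix k assume k: "k \<in> {..<m}"
    have "(2 * m) choose (m + (m - k)) = (2 * m) choose k"
      using k binomial_symmetric[of k "2 * m"] by (simp add: mult_2)
    moreover have "(-1 :: real) ^ (m - k) = (-1) ^ (k + m)"
      using k by (simp add: minus_one_power_iff)
    moreover have "cos (real (m - k) * \<phi>) = cos ((real k - real m) * \<phi>)"
      using k cos_minus[of "(real k - real m) * \<phi>"] by (simp add: of_nat_diff algebra_simps)
    ultimately show "(-1) ^ (m - k) * real ((2 * m) choose (m + (m - k))) * cos (real (m - k) * \<phi>) = c k"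
      by (simp add: c_def)
  qed auto
  also have "c m = real ((2 * m) choose m)" by (simp add: c_def)
  also have "(\<Sum>k\<in>{m<..2 * m}. c k) = (\<Sum>r=1..m. (-1) ^ r * real ((2 * m) choose (m + r)) * cos (real r * \<phi>))"
    by (rule sum.reindex_bij_witness[of _ "\<lambda>r. m + r" "\<lambda>k. k - m"])
      (auto simp: c_def minus_one_power_iff of_nat_diff)
  finally show ?thesis by simp
qed

locale multicritical_order =
  fixes m :: nat
  assumes m: "1 \<le> m"
begin

definition C :: real where "C = real ((2 * m) choose (m - 1))"

abbreviation b where "b \<equiv> right_edge m"
abbreviation b' where "b' \<equiv> left_edge m"
abbreviation D where "D \<equiv> mc_velocity m"

lemma C_pos: "0 < C"
  unfolding C_def using m by (simp add: zero_less_binomial_iff)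

text \<open>This explains the form of \<open>mc_gamma\<close>: the cosine series of the velocity is
  that of (2 - 2 cos \<phi>)^m, whose zero at \<phi> = 0 has order 2m.\<close>

lemma velocity_eq: "D \<phi> = (real ((2 * m) choose m) - (2 - 2 * cos \<phi>) ^ m) / C"
proof -
  have "D \<phi> = (\<Sum>r=1..m. - 2 * ((-1) ^ r * real ((2 * m) choose (m + r)) * cos (real r * \<phi>)) / C)"
    unfolding mc_velocity_def by (rule sum.cong) (auto simp: mc_gamma_def C_def)
  also have "\<dots> = - 2 * (\<Sum>r=1..m. (-1) ^ r * real ((2 * m) choose (m + r)) * cos (real r * \<phi>)) / C"
    by (simp only: sum_divide_distrib[symmetric] sum_distrib_left[symmetric])
  finally show ?thesis unfolding power_two_minus_two_cos[of \<phi> m] by simp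
qed

lemma right_edge_eq: "b = real ((2 * m) choose m) / C"
proof -
  have "b = D 0" by (simp add: right_edge_def mc_velocity_def sum_distrib_left mult_ac)
  then show ?thesis using m by (simp add: velocity_eq)
qed

text \<open>The signs in \<open>left_edge\<close> are the values cos (r pi), so the left edge is
  minus the velocity at pi, as the right edge is the velocity at 0.\<close>

lemma left_edge_eq: "b' = (4 ^ m - real ((2 * m) choose m)) / C"
proof -
  have "cos (real r * pi) = (-1) ^ r" for r by (simp add: cos_npi mult.commute)
  then have "b' = - D pi"
    unfolding left_edge_def mc_velocity_def sum_distrib_left sum_negf[symmetric]
    by (intro sum.cong refl) simp
  then show ?thesis by (simp add: velocity_eq minus_divide_left)
qed

lemma velocity: "D \<phi> = b - (2 - 2 * cos \<phi>) ^ m / C"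
  by (simp add: velocity_eq right_edge_eq diff_divide_distrib)

lemma edges_sum: "b + b' = 4 ^ m / C"
  by (simp add: right_edge_eq left_edge_eq add_divide_distrib[symmetric])

lemma right_edge_nonneg: "0 \<le> b"
  using C_pos by (simp add: right_edge_eq)

lemma left_edge_nonneg: "0 \<le> b'"
proof -
  have "(2 * m) choose m \<le> (\<Sum>k\<le>2 * m. (2 * m) choose k)"
    by (rule member_le_sum) auto
  also have "\<dots> = 4 ^ m" by (simp add: choose_row_sum power_mult)
  finally have "real ((2 * m) choose m) \<le> 4 ^ m" by (metis of_nat_le_iff of_nat_numeral of_nat_power)
  then show ?thesis using C_pos by (simp add: left_edge_eq)
qed

lemma velocity_antimono:
  assumes "0 \<le> \<phi>" "\<phi> \<le> \<psi>" "\<psi> \<le> pi"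
  shows "D \<psi> \<le> D \<phi>"
proof -
  have "cos \<psi> \<le> cos \<phi>" using assms by (intro cos_monotone_0_pi_le) auto
  then have "(2 - 2 * cos \<phi>) ^ m \<le> (2 - 2 * cos \<psi>) ^ m"
    by (intro power_mono) (auto simp: cos_le_one)
  then show ?thesis using C_pos by (simp add: velocity divide_right_mono)
qed

lemma velocity_ge: "- b' \<le> D \<phi>"
proof -
  have "2 - 2 * cos \<phi> \<le> 4" using cos_ge_minus_one[of \<phi>] by linarith
  then have "(2 - 2 * cos \<phi>) ^ m \<le> 4 ^ m" by (rule power_mono) simp
  then have "(2 - 2 * cos \<phi>) ^ m / C \<le> b + b'" unfolding edges_sum using C_pos by (intro divide_right_mono) auto
  then show ?thesis by (simp add: velocity)
qed

lemma velocity_le: "D \<phi> \<le> b"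
  unfolding velocity using C_pos by (simp add: cos_le_one)

text \<open>The inverse of the velocity on the half circle, and the integrand of
  \<open>limit_profile\<close>.\<close>

definition A :: "real \<Rightarrow> real" where
  "A v = arccos (1 - 1/2 * root m C * root m (b - v))"

text \<open>Between the edges C (b - v) lies in [0, 4^m], so the argument of the arccosine stays in
  [-1, 1].\<close>

lemma root_range:
  assumes "v \<in> {- b'..b}"
  shows "0 \<le> root m C * root m (b - v)" "root m C * root m (b - v) \<le> 4"
proof -
  show "0 \<le> root m C * root m (b - v)" using assms C_pos m by auto
  have "C * (b - v) \<le> 4 ^ m"
    using assms C_pos edges_sum mult_left_mono[of "b - v" "b + b'" C] by (auto simp: field_simps)
  then have "root m (C * (b - v)) \<le> root m (4 ^ m)" using m by (intro real_root_le_mono) auto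
  then show "root m C * root m (b - v) \<le> 4" using m by (simp add: real_root_mult real_root_power_cancel)
qed

lemma A_range: "v \<in> {- b'..b} \<Longrightarrow> A v \<in> {0..pi}"
  unfolding A_def using root_range[of v] by (auto intro!: arccos_lbound arccos_ubound)

lemma velocity_A:
  assumes "v \<in> {- b'..b}"
  shows "D (A v) = v"
proof -
  have "cos (A v) = 1 - 1/2 * root m C * root m (b - v)"
    unfolding A_def using root_range[OF assms] by (intro cos_arccos) auto
  then have "(2 - 2 * cos (A v)) ^ m = (root m C * root m (b - v)) ^ m" by simp
  also have "\<dots> = C * (b - v)"
    using assms C_pos m by (simp add: power_mult_distrib real_root_pow_pos2)
  finally show ?thesis using C_pos by (simp add: velocity)
qed

lemma continuous_on_A: "continuous_on {- b'..b} A"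
  unfolding A_def
  by (intro continuous_on_arccos continuous_intros) (use root_range m in \<open>force+\<close>)

text \<open>Up to the factor pi, the limit of the rescaled mean number of particles to the right of
  x.\<close>

definition J :: "real \<Rightarrow> real" where
  "J x = integral {0..pi} (\<lambda>\<phi>. max 0 (D \<phi> - x))"

text \<open>Together with \<open>J_eq\<close> a variational formula: J x is the maximum over a of
  the integral of D - x on [0, a], attained at a = A x because \<open>D\<close> decreases.\<close>

lemma J_ge:
  assumes "a \<in> {0..pi}"
  shows "integral {0..a} (\<lambda>\<phi>. D \<phi> - x) \<le> J x"
proof -
  have int: "(\<lambda>\<phi>. max 0 (D \<phi> - x)) integrable_on {c..d}" "(\<lambda>\<phi>. D \<phi> - x) integrable_on {c..d}" for c d
    by (intro integrable_continuous_interval continuous_intros)+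
  have "integral {0..a} (\<lambda>\<phi>. D \<phi> - x) \<le> integral {0..a} (\<lambda>\<phi>. max 0 (D \<phi> - x))"
    by (intro integral_le int) auto
  also have "\<dots> \<le> J x" unfolding J_def
    by (rule integral_subset_le) (use assms int in auto)
  finally show ?thesis .
qed

lemma J_eq:
  assumes "x \<in> {- b'..b}"
  shows "J x = integral {0..A x} (\<lambda>\<phi>. D \<phi> - x)"
proof -
  have int: "(\<lambda>\<phi>. max 0 (D \<phi> - x)) integrable_on {c..d}" for c d
    by (intro integrable_continuous_interval continuous_intros)
  note A = A_range[OF assms]
  have "J x = integral {0..A x} (\<lambda>\<phi>. max 0 (D \<phi> - x)) + integral {A x..pi} (\<lambda>\<phi>. max 0 (D \<phi> - x))"
    unfolding J_def by (rule Henstock_Kurzweil_Integration.integral_combine[symmetric]) (use A int in auto)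
  also have "integral {0..A x} (\<lambda>\<phi>. max 0 (D \<phi> - x)) = integral {0..A x} (\<lambda>\<phi>. D \<phi> - x)"
  proof (rule Henstock_Kurzweil_Integration.integral_cong)
    fix \<phi> assume "\<phi> \<in> {0..A x}"
    then show "max 0 (D \<phi> - x) = D \<phi> - x"
      using velocity_antimono[of \<phi> "A x"] A velocity_A[OF assms] by simp
  qed
  also have "integral {A x..pi} (\<lambda>\<phi>. max 0 (D \<phi> - x)) = integral {A x..pi} (\<lambda>\<phi>. 0)"
  proof (rule Henstock_Kurzweil_Integration.integral_cong)
    fix \<phi> assume "\<phi> \<in> {A x..pi}"
    then show "max 0 (D \<phi> - x) = 0"
      using velocity_antimono[of "A x" \<phi>] A velocity_A[OF assms] by simp
  qed
  finally show ?thesis by simp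
qed

text \<open>The maximiser A y for y is only a candidate for x. This says that - A y is a subgradient
  of \<open>J\<close> at y.\<close>

lemma J_diff:
  assumes "x \<in> {- b'..b}" "y \<in> {- b'..b}"
  shows "(y - x) * A y \<le> J x - J y"
proof -
  have int: "D integrable_on {c..d}" for c d
    by (intro integrable_continuous_interval continuous_intros)
  have eq: "integral {0..A y} (\<lambda>\<phi>. D \<phi> - z) = integral {0..A y} D - z * A y" for z
    using A_range[OF assms(2)]
    by (subst Henstock_Kurzweil_Integration.integral_diff) (auto intro: int)
  show ?thesis
    using J_ge[OF A_range[OF assms(2)], of x] unfolding J_eq[OF assms(2)] eq by (simp add: algebra_simps)
qed

text \<open>Envelope theorem: the two subgradient inequalities enclose the difference quotient
  between - A x and - A y, and \<open>A\<close> is continuous.\<close>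

lemma J_deriv:
  assumes x: "x \<in> {- b'..b}"
  shows "(J has_real_derivative - A x) (at x within {- b'..b})"
proof -
  have "((\<lambda>y. A y - A x) \<longlongrightarrow> 0) (at x within {- b'..b})"
    using continuous_on_A x by (auto simp: continuous_on_def intro!: tendsto_eq_intros)
  moreover have "\<forall>\<^sub>F y in at x within {- b'..b}. norm ((J y - J x) / (y - x) - (- A x)) \<le> norm (A y - A x)"
    unfolding eventually_at_filter
  proof (intro always_eventually allI impI)
    fix y assume y: "y \<noteq> x" "y \<in> {- b'..b}"
    have 1: "(y - x) * A y \<le> J x - J y" by (rule J_diff[OF x y(2)])
    have 2: "(x - y) * A x \<le> J y - J x" by (rule J_diff[OF y(2) x])
    define q where "q = (J y - J x) / (y - x)"
    have q: "J y - J x = q * (y - x)" using y(1) by (simp add: q_def)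
    have "\<bar>q + A x\<bar> \<le> \<bar>A y - A x\<bar>"
    proof (cases "x < y")
      case True
      have "(y - x) * (- A x) \<le> (y - x) * q" "(y - x) * q \<le> (y - x) * (- A y)"
        using 1 2 q by (simp_all add: algebra_simps)
      then have "- A x \<le> q" "q \<le> - A y" using True by (simp_all only: mult_le_cancel_left_pos diff_gt_0_iff_gt)
      then show ?thesis by linarith
    next
      case False
      then have xy: "y < x" using y(1) by simp
      have "(x - y) * q \<le> (x - y) * (- A x)" "(x - y) * (- A y) \<le> (x - y) * q"
        using 1 2 q by (simp_all add: algebra_simps)
      then have "q \<le> - A x" "- A y \<le> q" using xy by (simp_all only: mult_le_cancel_left_pos diff_gt_0_iff_gt)
      then show ?thesis by linarith
    qed
    then show "norm ((J y - J x) / (y - x) - (- A x)) \<le> norm (A y - A x)" by (simp add: q_def)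
  qed
  ultimately have "((\<lambda>y. (J y - J x) / (y - x) - (- A x)) \<longlongrightarrow> 0) (at x within {- b'..b})"
    by (rule Lim_null_comparison[OF _ tendsto_norm_zero, rotated])
  then show ?thesis unfolding has_field_derivative_iff by (simp only: LIM_zero_iff)
qed

text \<open>At the left edge the positive part is the function itself, and the velocity integrates
  to zero because the phase vanishes at 0 and at pi.\<close>

lemma J_left_edge: "J (- b') = pi * b'"
proof -
  have "(D has_integral (mc_phase m pi - mc_phase m 0)) {0..pi}"
    by (rule fundamental_theorem_of_calculus)
      (auto simp: has_real_derivative_iff_has_vector_derivative[symmetric] intro: DERIV_mc_phase has_field_derivative_at_within)
  moreover have "mc_phase m pi = 0" by (simp add: mc_phase_def mult.commute)
  ultimately have D: "(D has_integral 0) {0..pi}" by (simp add: mc_phase_def)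
  have "((\<lambda>\<phi>. D \<phi> + b') has_integral (0 + b' * pi)) {0..pi}"
    by (intro has_integral_add D) (use has_integral_const_real[of b' 0 pi] in \<open>simp add: mult.commute\<close>)
  moreover have "J (- b') = integral {0..pi} (\<lambda>\<phi>. D \<phi> + b')"
    unfolding J_def
  proof (rule Henstock_Kurzweil_Integration.integral_cong)
    fix \<phi> show "max 0 (D \<phi> - - b') = D \<phi> + b'" using velocity_ge[of \<phi>] by simp
  qed
  ultimately show ?thesis by (simp add: integral_unique mult.commute)
qed

lemma limit_profile_eq:
  assumes "x \<in> {- b'..b}"
  shows "limit_profile m x = x + 2 / pi * J x"
proof -
  have "((\<lambda>v. - A v) has_integral (J x - J (- b'))) {- b'..x}"
  proof (rule fundamental_theorem_of_calculus)
    fix v assume "v \<in> {- b'..x}"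
    then have "(J has_real_derivative - A v) (at v within {- b'..x})"
      using assms by (intro DERIV_subset[OF J_deriv]) auto
    then show "(J has_vector_derivative - A v) (at v within {- b'..x})"
      by (simp add: has_real_derivative_iff_has_vector_derivative)
  qed (use assms in auto)
  from has_integral_neg[OF this] have "(A has_integral (J (- b') - J x)) {- b'..x}" by simp
  then have A: "integral {- b'..x} A = pi * b' - J x" by (simp only: integral_unique J_left_edge)
  have "limit_profile m x = x + 2 * b' - 2 / pi * integral {- b'..x} A"
    unfolding limit_profile_def if_P[OF assms] A_def C_def ..
  then show ?thesis unfolding A by (simp add: field_simps)
qed

text \<open>The slope is 1 - 2 A / pi with A in [0, pi]; \<open>J_diff\<close> gives the
  corresponding bounds on increments.\<close>

lemma limit_profile_lipschitz:
  assumes "x \<in> {- b'..b}" "y \<in> {- b'..b}"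
  shows "\<bar>limit_profile m x - limit_profile m y\<bar> \<le> \<bar>x - y\<bar>"
proof -
  have main: "\<bar>limit_profile m x - limit_profile m y\<bar> \<le> y - x" if "x \<in> {- b'..b}" "y \<in> {- b'..b}" "x \<le> y" for x y
  proof -
    have "0 \<le> (y - x) * A y" using that A_range[of y] by simp
    then have 1: "0 \<le> J x - J y" using J_diff[of x y] that by simp
    have "(y - x) * A x \<le> (y - x) * pi" using that A_range[of x] by (intro mult_left_mono) auto
    then have 2: "J x - J y \<le> (y - x) * pi" using J_diff[of y x] that by (simp add: algebra_simps)
    define q where "q = 2 / pi * (J x - J y)"
    have "q \<le> 2 / pi * ((y - x) * pi)" unfolding q_def by (rule mult_left_mono[OF 2]) simp
    then have "q \<le> 2 * (y - x)" by simp
    moreover have "0 \<le> q" using 1 by (simp add: q_def)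
    moreover have "limit_profile m x - limit_profile m y = q - (y - x)"
      unfolding limit_profile_eq[OF that(1)] limit_profile_eq[OF that(2)] q_def by (simp add: algebra_simps)
    ultimately show ?thesis by (simp add: abs_le_iff)
  qed
  show ?thesis using main[OF assms] main[OF assms(2,1)] by (cases "x \<le> y") auto
qed

lemma limit_profile_right_edge: "limit_profile m b = b"
proof -
  have b: "b \<in> {- b'..b}" using right_edge_nonneg left_edge_nonneg by simp
  have "J b = integral {0..pi} (\<lambda>\<phi>. 0)"
    unfolding J_def
  proof (rule Henstock_Kurzweil_Integration.integral_cong)
    fix \<phi> show "max 0 (D \<phi> - b) = 0" using velocity_le[of \<phi>] by simp
  qed
  then show ?thesis by (simp add: limit_profile_eq[OF b])
qed

lemma limit_profile_left_edge: "limit_profile m (- b') = b'"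
proof -
  have "- b' \<in> {- b'..b}" using right_edge_nonneg left_edge_nonneg by simp
  then show ?thesis by (simp add: limit_profile_eq J_left_edge)
qed

text \<open>The velocity is even and 2 pi periodic, so both half circles contribute equally.\<close>

lemma integral_full_circle:
  "integral {0..2 * pi} (\<lambda>\<phi>. max 0 (D \<phi> - x)) = 2 * J x"
proof -
  let ?f = "\<lambda>\<phi>. max 0 (D \<phi> - x)"
  have int: "?f integrable_on {c..d}" for c d
    by (intro integrable_continuous_interval continuous_intros)
  have sym: "?f (2 * pi - \<phi>) = ?f \<phi>" for \<phi>
    by (simp add: velocity cos_diff)
  have "(?f has_integral J x) (cbox 0 pi)" unfolding J_def using int by (auto simp: integrable_integral)
  from has_integral_affinity[OF this, of "-1" "2 * pi"]
  have "((\<lambda>\<phi>. ?f (2 * pi - \<phi>)) has_integral J x) ((\<lambda>\<phi>. 2 * pi - \<phi>) ` {0..pi})" by simp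
  also have "(\<lambda>\<phi>. 2 * pi - \<phi>) ` {0..pi} = {pi..2 * pi}"
    by (auto simp: image_iff intro!: bexI[of _ "2 * pi - _"])
  finally have "(?f has_integral J x) {pi..2 * pi}" unfolding sym .
  then have "integral {pi..2 * pi} ?f = J x" by (rule integral_unique)
  moreover have "integral {0..2 * pi} ?f = integral {0..pi} ?f + integral {pi..2 * pi} ?f"
    by (rule Henstock_Kurzweil_Integration.integral_combine[symmetric]) (use int in auto)
  ultimately show ?thesis by (simp add: J_def)
qed

lemma mc_mean_tendsto_J: "((\<lambda>\<theta>. mc_mean m \<theta> \<lfloor>\<theta> * x\<rfloor> / \<theta>) \<longlongrightarrow> J x / pi) at_top"
  using mc_mean_tendsto[of m x] unfolding integral_full_circle by simp

end

section \<open>Convergence of the profile\<close>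


definition count_above :: "nat list \<Rightarrow> int \<Rightarrow> nat" where
  "count_above p n = card (particles p \<inter> {n<..})"

lemma count_above_step:
  "count_above p (n + 1) \<le> count_above p n" "count_above p n \<le> count_above p (n + 1) + 1"
proof -
  have "particles p \<inter> {n + 1<..} \<subseteq> particles p \<inter> {n<..}" by auto
  then show "count_above p (n + 1) \<le> count_above p n"
    unfolding count_above_def by (rule card_mono[OF particles_upper_finite(1)])
  have "particles p \<inter> {n<..} \<subseteq> insert (n + 1) (particles p \<inter> {n + 1<..})" by auto
  then have "count_above p n \<le> card (insert (n + 1) (particles p \<inter> {n + 1<..}))"
    unfolding count_above_def by (rule card_mono[rotated]) (simp add: particles_upper_finite(1))
  also have "\<dots> \<le> count_above p (n + 1) + 1"
    unfolding count_above_def by (simp add: card_insert_if particles_upper_finite(1))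
  finally show "count_above p n \<le> count_above p (n + 1) + 1" .
qed

lemma count_above_diff:
  assumes "n \<le> n'"
  shows "count_above p n' \<le> count_above p n" "int (count_above p n) \<le> int (count_above p n') + (n' - n)"
proof -
  have "count_above p n' \<le> count_above p n \<and> int (count_above p n) \<le> int (count_above p n') + (n' - n)"
    using assms
  proof (induction n' rule: int_ge_induct)
    case (step i)
    then show ?case using count_above_step[of p i] by auto
  qed simp
  then show "count_above p n' \<le> count_above p n" "int (count_above p n) \<le> int (count_above p n') + (n' - n)" by auto
qed

text \<open>The first - n positions all exceed n. For the profile this is the bound by - x from
  below.\<close>

lemma count_above_lower:
  assumes "is_partition p"
  shows "- n \<le> int (count_above p n)"
proof (cases "0 \<le> n")
  case False
  define k where "k = nat (- n)"
  have "inj_on (positions k p) {..<k}" by (rule inj_on_positions[OF assms])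
  then have "k = card (positions k p ` {..<k})" by (simp add: card_image)
  also have "\<dots> \<le> count_above p n"
    unfolding count_above_def
  proof (rule card_mono[OF particles_upper_finite(1)], rule image_subsetI)
    fix i assume i: "i \<in> {..<k}"
    then have "positions k p i \<in> particles p" by (auto simp: positions_def particles_def)
    moreover have "n < positions k p i" using positions_lower_bound[of i k p] i False by (simp add: k_def)
    ultimately show "positions k p i \<in> particles p \<inter> {n<..}" by simp
  qed
  finally show ?thesis using False by (simp add: k_def)
qed simp

text \<open>Piecewise linear interpolation of the count. It carries all randomness of the profile,
  as interpolating the linear term of \<open>profile_node\<close> returns x.\<close>

definition above_linear :: "nat list \<Rightarrow> real \<Rightarrow> real" where
  "above_linear p s = (1 - frac s) * real (count_above p \<lfloor>s\<rfloor>) + frac s * real (count_above p (\<lfloor>s\<rfloor> + 1))"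

lemma profile_eq_above_linear:
  assumes "\<theta> \<noteq> 0"
  shows "profile \<theta> p x = x + 2 / \<theta> * above_linear p (\<theta> * x)"
proof -
  have "(1 - frac (\<theta> * x)) * of_int \<lfloor>\<theta> * x\<rfloor> + frac (\<theta> * x) * of_int (\<lfloor>\<theta> * x\<rfloor> + 1) = \<theta> * x"
    by (simp add: frac_def algebra_simps)
  moreover have "profile \<theta> p x = ((1 - frac (\<theta> * x)) * of_int \<lfloor>\<theta> * x\<rfloor> + frac (\<theta> * x) * of_int (\<lfloor>\<theta> * x\<rfloor> + 1)) / \<theta>
      + 2 / \<theta> * above_linear p (\<theta> * x)"
    unfolding profile_def profile_node_def above_linear_def card_point_config count_above_def
    by (simp add: algebra_simps add_divide_distrib diff_divide_distrib)
  ultimately show ?thesis using assms by simp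
qed

lemma above_linear_near_floor:
  "above_linear p s = real (count_above p \<lfloor>s\<rfloor>) - frac s * (real (count_above p \<lfloor>s\<rfloor>) - real (count_above p (\<lfloor>s\<rfloor> + 1)))"
  "above_linear p s = real (count_above p (\<lfloor>s\<rfloor> + 1)) + (1 - frac s) * (real (count_above p \<lfloor>s\<rfloor>) - real (count_above p (\<lfloor>s\<rfloor> + 1)))"
  by (simp_all add: above_linear_def algebra_simps)

lemma count_above_step_real:
  "0 \<le> real (count_above p n) - real (count_above p (n + 1))" "real (count_above p n) - real (count_above p (n + 1)) \<le> 1"
  using count_above_step[of p n] by linarith+

lemma above_linear_floor:
  "above_linear p s \<le> real (count_above p \<lfloor>s\<rfloor>)" "real (count_above p \<lfloor>s\<rfloor>) - frac s \<le> above_linear p s"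
  "real (count_above p (\<lfloor>s\<rfloor> + 1)) \<le> above_linear p s" "above_linear p s \<le> real (count_above p (\<lfloor>s\<rfloor> + 1)) + (1 - frac s)"
proof -
  define d where "d = real (count_above p \<lfloor>s\<rfloor>) - real (count_above p (\<lfloor>s\<rfloor> + 1))"
  have d: "0 \<le> d" "d \<le> 1" unfolding d_def by (rule count_above_step_real)+
  have f: "0 \<le> frac s" "frac s \<le> 1" using frac_lt_1[of s] by auto
  have "0 \<le> frac s * d" "frac s * d \<le> frac s" "0 \<le> (1 - frac s) * d" "(1 - frac s) * d \<le> 1 - frac s"
    using d f by (auto intro: mult_left_le)
  then show "above_linear p s \<le> real (count_above p \<lfloor>s\<rfloor>)" "real (count_above p \<lfloor>s\<rfloor>) - frac s \<le> above_linear p s"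
    "real (count_above p (\<lfloor>s\<rfloor> + 1)) \<le> above_linear p s" "above_linear p s \<le> real (count_above p (\<lfloor>s\<rfloor> + 1)) + (1 - frac s)"
    using above_linear_near_floor[of p s] unfolding d_def by linarith+
qed

text \<open>The slope on each unit cell is - 1 or 0, according to whether a particle is passed. For
  points in different cells the lattice values in between are compared.\<close>

lemma above_linear_diff:
  assumes "s \<le> s'"
  shows "0 \<le> above_linear p s - above_linear p s'" "above_linear p s - above_linear p s' \<le> s' - s"
proof -
  have "0 \<le> above_linear p s - above_linear p s' \<and> above_linear p s - above_linear p s' \<le> s' - s"
  proof (cases "\<lfloor>s\<rfloor> = \<lfloor>s'\<rfloor>")
    case True
    define d where "d = real (count_above p \<lfloor>s\<rfloor>) - real (count_above p (\<lfloor>s\<rfloor> + 1))"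
    have d: "0 \<le> d" "d \<le> 1" unfolding d_def by (rule count_above_step_real)+
    have "frac s' - frac s = s' - s" using True by (simp add: frac_def)
    then have "above_linear p s - above_linear p s' = (s' - s) * d"
      using True unfolding above_linear_near_floor(1) d_def by (simp add: left_diff_distrib[symmetric])
    moreover have "0 \<le> (s' - s) * d" "(s' - s) * d \<le> s' - s" using d assms by (auto intro: mult_left_le)
    ultimately show ?thesis by simp
  next
    case False
    then have fl: "\<lfloor>s\<rfloor> + 1 \<le> \<lfloor>s'\<rfloor>" using floor_mono[OF assms] by simp
    have "real (count_above p \<lfloor>s'\<rfloor>) \<le> real (count_above p (\<lfloor>s\<rfloor> + 1))"
      "real (count_above p (\<lfloor>s\<rfloor> + 1)) \<le> real (count_above p \<lfloor>s'\<rfloor>) + (of_int \<lfloor>s'\<rfloor> - of_int \<lfloor>s\<rfloor> - 1)"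
      using count_above_diff[OF fl, of p] by linarith+
    then show ?thesis
      using above_linear_floor[of p s] above_linear_floor[of p s'] unfolding frac_def by linarith
  qed
  then show "0 \<le> above_linear p s - above_linear p s'" "above_linear p s - above_linear p s' \<le> s' - s" by auto
qed

lemma above_linear_nonneg: "0 \<le> above_linear p s"
  using above_linear_floor(3)[of p s] by linarith

lemma above_linear_lower:
  assumes "is_partition p"
  shows "0 \<le> above_linear p s + s"
proof -
  have "0 \<le> real (count_above p (\<lfloor>s\<rfloor> + 1)) + of_int (\<lfloor>s\<rfloor> + 1)" "0 \<le> real (count_above p \<lfloor>s\<rfloor>) + of_int \<lfloor>s\<rfloor>"
    using count_above_lower[OF assms, of "\<lfloor>s\<rfloor> + 1"] count_above_lower[OF assms, of "\<lfloor>s\<rfloor>"] by linarith+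
  then have "0 \<le> (1 - frac s) * (real (count_above p \<lfloor>s\<rfloor>) + of_int \<lfloor>s\<rfloor>) + frac s * (real (count_above p (\<lfloor>s\<rfloor> + 1)) + of_int (\<lfloor>s\<rfloor> + 1))"
    using frac_lt_1[of s] by (intro add_nonneg_nonneg[OF mult_nonneg_nonneg mult_nonneg_nonneg]) auto
  also have "\<dots> = above_linear p s + s" unfolding above_linear_def by (simp add: frac_def algebra_simps)
  finally show ?thesis .
qed

section \<open>Lipschitz bound and monotone tails of the profile\<close>

lemma profile_lipschitz:
  assumes "0 < \<theta>"
  shows "\<bar>profile \<theta> p x - profile \<theta> p y\<bar> \<le> \<bar>x - y\<bar>"
proof -
  have main: "\<bar>profile \<theta> p x - profile \<theta> p y\<bar> \<le> y - x" if "x \<le> y" for x y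
  proof -
    define q where "q = above_linear p (\<theta> * x) - above_linear p (\<theta> * y)"
    have "\<theta> * x \<le> \<theta> * y" using that assms by simp
    from above_linear_diff[OF this, of p] have q: "0 \<le> q" "q \<le> \<theta> * (y - x)"
      by (simp_all add: q_def algebra_simps)
    have "profile \<theta> p x - profile \<theta> p y = 2 / \<theta> * q - (y - x)"
      using assms unfolding q_def by (simp add: profile_eq_above_linear algebra_simps)
    moreover have "0 \<le> 2 / \<theta> * q" "2 / \<theta> * q \<le> 2 * (y - x)"
      using q assms by (simp_all add: field_simps)
    ultimately show ?thesis by (simp add: abs_le_iff)
  qed
  show ?thesis using main[of x y] main[of y x] by (cases "x \<le> y") auto
qed

text \<open>The excess over x is a multiple of the interpolated count, hence nonnegative and
  nonincreasing: one estimate at the edge controls the whole tail.\<close>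

lemma profile_right_tail:
  assumes "0 < \<theta>" "a \<le> x"
  shows "0 \<le> profile \<theta> p x - x" "profile \<theta> p x - x \<le> profile \<theta> p a - a"
proof -
  have "\<theta> * a \<le> \<theta> * x" using assms by simp
  from above_linear_diff(1)[OF this, of p]
  have "2 / \<theta> * above_linear p (\<theta> * x) \<le> 2 / \<theta> * above_linear p (\<theta> * a)"
    using assms by (intro mult_left_mono) auto
  then show "profile \<theta> p x - x \<le> profile \<theta> p a - a" using assms by (simp add: profile_eq_above_linear)
  show "0 \<le> profile \<theta> p x - x" using assms above_linear_nonneg[of p] by (simp add: profile_eq_above_linear)
qed

lemma profile_left_tail:
  assumes "0 < \<theta>" "x \<le> a" "is_partition p"
  shows "0 \<le> profile \<theta> p x + x" "profile \<theta> p x + x \<le> profile \<theta> p a + a"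
proof -
  have eq: "profile \<theta> p y + y = 2 / \<theta> * (above_linear p (\<theta> * y) + \<theta> * y)" for y
    using assms by (simp add: profile_eq_above_linear field_simps)
  have "\<theta> * x \<le> \<theta> * a" using assms by simp
  from above_linear_diff(2)[OF this, of p]
  have "2 / \<theta> * (above_linear p (\<theta> * x) + \<theta> * x) \<le> 2 / \<theta> * (above_linear p (\<theta> * a) + \<theta> * a)"
    using assms by (intro mult_left_mono) auto
  then show "profile \<theta> p x + x \<le> profile \<theta> p a + a" unfolding eq .
  show "0 \<le> profile \<theta> p x + x"
    unfolding eq using assms by (intro mult_nonneg_nonneg above_linear_lower) auto
qed

context multicritical_order
begin

text \<open>Inside, moving to a net point costs \<delta> for each of the two 1-Lipschitz profiles.
  Outside, the monotone tails inherit the bound at the edges, which is why both edges belong to the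
  net.\<close>

lemma profile_uniformly_close:
  assumes \<theta>: "0 < \<theta>" and p: "is_partition p"
    and T: "T \<subseteq> {- b'..b}" "b \<in> T" "- b' \<in> T"
    and net: "\<And>x. x \<in> {- b'..b} \<Longrightarrow> \<exists>\<tau>\<in>T. \<bar>x - \<tau>\<bar> \<le> \<delta>" and \<delta>: "0 \<le> \<delta>"
    and close: "\<And>\<tau>. \<tau> \<in> T \<Longrightarrow> \<bar>profile \<theta> p \<tau> - limit_profile m \<tau>\<bar> \<le> \<eta>"
  shows "\<bar>profile \<theta> p x - limit_profile m x\<bar> \<le> \<eta> + 2 * \<delta>"
proof -
  consider "x \<in> {- b'..b}" | "b < x" | "x < - b'" by fastforce
  then show ?thesis
  proof cases
    case 1
    then obtain \<tau> where \<tau>: "\<tau> \<in> T" "\<bar>x - \<tau>\<bar> \<le> \<delta>" using net by blast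
    then have "\<tau> \<in> {- b'..b}" using T by blast
    then have "\<bar>limit_profile m x - limit_profile m \<tau>\<bar> \<le> \<delta>"
      using limit_profile_lipschitz[OF 1, of \<tau>] \<tau>(2) by simp
    moreover have "\<bar>profile \<theta> p x - profile \<theta> p \<tau>\<bar> \<le> \<delta>" using profile_lipschitz[OF \<theta>, of p x \<tau>] \<tau>(2) by simp
    ultimately show ?thesis using close[OF \<tau>(1)] by linarith
  next
    case 2
    then have "limit_profile m x = x" using right_edge_nonneg by (simp add: limit_profile_def)
    moreover have "\<bar>profile \<theta> p b - b\<bar> \<le> \<eta>" using close[OF T(2)] by (simp add: limit_profile_right_edge)
    ultimately show ?thesis using profile_right_tail[OF \<theta>, of b x p] 2 \<delta> by simp
  next
    case 3
    then have "limit_profile m x = - x" using left_edge_nonneg by (simp add: limit_profile_def)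
    moreover have "\<bar>profile \<theta> p (- b') - b'\<bar> \<le> \<eta>" using close[OF T(3)] by (simp add: limit_profile_left_edge)
    ultimately show ?thesis using profile_left_tail[OF \<theta>, of x "- b'" p] p 3 \<delta> by simp
  qed
qed

text \<open>Three errors of size \<delta> - interpolation, fluctuation and convergence of the mean -
  are doubled by the factor 2 in front of the count.\<close>

lemma profile_close_at_point:
  assumes \<theta>: "0 < \<theta>" "1 / \<theta> \<le> \<delta>" and \<tau>: "\<tau> \<in> {- b'..b}"
    and mean: "\<bar>mc_mean m \<theta> \<lfloor>\<theta> * \<tau>\<rfloor> / \<theta> - J \<tau> / pi\<bar> \<le> \<delta>"
    and dev: "\<bar>real (count_above p \<lfloor>\<theta> * \<tau>\<rfloor>) - mc_mean m \<theta> \<lfloor>\<theta> * \<tau>\<rfloor>\<bar> \<le> \<delta> * \<theta>"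
  shows "\<bar>profile \<theta> p \<tau> - limit_profile m \<tau>\<bar> \<le> 6 * \<delta>"
proof -
  define i where "i = above_linear p (\<theta> * \<tau>)"
  define a where "a = real (count_above p \<lfloor>\<theta> * \<tau>\<rfloor>)"
  define \<mu> where "\<mu> = mc_mean m \<theta> \<lfloor>\<theta> * \<tau>\<rfloor>"
  have "\<bar>i - a\<bar> \<le> 1" using above_linear_floor[of p "\<theta> * \<tau>"] frac_lt_1[of "\<theta> * \<tau>"] unfolding i_def a_def by linarith
  then have "\<bar>i - a\<bar> / \<theta> \<le> 1 / \<theta>" using \<theta> by (intro divide_right_mono) auto
  then have 1: "\<bar>i / \<theta> - a / \<theta>\<bar> \<le> \<delta>" using \<theta> by (simp add: diff_divide_distrib[symmetric] abs_divide)
  have "\<bar>a - \<mu>\<bar> / \<theta> \<le> \<delta>" using dev \<theta> unfolding a_def \<mu>_def by (simp add: field_simps)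
  then have 2: "\<bar>a / \<theta> - \<mu> / \<theta>\<bar> \<le> \<delta>" using \<theta> by (simp add: diff_divide_distrib[symmetric] abs_divide)
  have "profile \<theta> p \<tau> - limit_profile m \<tau> = 2 * (i / \<theta> - J \<tau> / pi)"
    using \<theta> unfolding limit_profile_eq[OF \<tau>] i_def by (simp add: profile_eq_above_linear)
  moreover have "\<bar>2 * (y\<^sub>1 - y\<^sub>4)\<bar> \<le> 6 * \<delta>"
    if "\<bar>y\<^sub>1 - y\<^sub>2\<bar> \<le> \<delta>" "\<bar>y\<^sub>2 - y\<^sub>3\<bar> \<le> \<delta>" "\<bar>y\<^sub>3 - y\<^sub>4\<bar> \<le> \<delta>" for y\<^sub>1 y\<^sub>2 y\<^sub>3 y\<^sub>4 :: real
  proof -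
    have "\<bar>y\<^sub>1 - y\<^sub>4\<bar> \<le> 3 * \<delta>" using that by linarith
    then show ?thesis unfolding abs_mult by simp
  qed
  ultimately show ?thesis using 1 2 mean unfolding \<mu>_def[symmetric] by metis
qed

lemma finite_net:
  assumes "0 < \<delta>"
  obtains T where "finite T" "T \<subseteq> {- b'..b}" "b \<in> T" "- b' \<in> T" "\<And>x. x \<in> {- b'..b} \<Longrightarrow> \<exists>\<tau>\<in>T. \<bar>x - \<tau>\<bar> \<le> \<delta>"
proof -
  obtain k where k: "finite k" "k \<subseteq> {- b'..b}" "{- b'..b} \<subseteq> (\<Union>x\<in>k. ball x \<delta>)"
    using seq_compact_imp_totally_bounded[of "{- b'..b}"] assms compact_Icc compact_eq_seq_compact_metric by blast
  have edges: "b \<in> {- b'..b}" "- b' \<in> {- b'..b}" using right_edge_nonneg left_edge_nonneg by auto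
  show ?thesis
  proof (rule that[of "insert b (insert (- b') k)"])
    show "\<exists>\<tau>\<in>insert b (insert (- b') k). \<bar>x - \<tau>\<bar> \<le> \<delta>" if x: "x \<in> {- b'..b}" for x
    proof -
      obtain \<tau> where "\<tau> \<in> k" "x \<in> ball \<tau> \<delta>" using k(3) x by blast
      then show ?thesis by (intro bexI[of _ \<tau>]) (auto simp: dist_real_def abs_minus_commute)
    qed
  qed (use k edges in auto)
qed

lemma multicritical_limit_shape:
  assumes \<epsilon>: "0 < \<epsilon>"
  shows "((\<lambda>\<theta>. \<P>(p in multicritical_measure m \<theta>.
              (SUP x::real. ereal \<bar>profile \<theta> p x - limit_profile m x\<bar>) > ereal \<epsilon>)) \<longlongrightarrow> 0) at_top"
proof -
  \<comment> \<open>The total error is 6 \<delta> at the net points plus 2 \<delta> for the net,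
    which is below \<epsilon>.\<close>
  define \<delta> where "\<delta> = \<epsilon> / 9"
  have \<delta>: "0 < \<delta>" using \<epsilon> by (simp add: \<delta>_def)
  obtain T where T: "finite T" "T \<subseteq> {- b'..b}" "b \<in> T" "- b' \<in> T"
    and net: "\<And>x. x \<in> {- b'..b} \<Longrightarrow> \<exists>\<tau>\<in>T. \<bar>x - \<tau>\<bar> \<le> \<delta>"
    using finite_net[OF \<delta>] by blast
  \<comment> \<open>The sum of the Chebyshev bounds over the net. The mean grows like \<theta> while
    the squared deviation grows like \<theta>^2, so each term is of order 1/\<theta>.\<close>
  define bnd where "bnd \<theta> = (\<Sum>\<tau>\<in>T. mc_mean m \<theta> \<lfloor>\<theta> * \<tau>\<rfloor> / (\<delta> * \<theta>)\<^sup>2)" for \<theta>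
  have bnd: "(bnd \<longlongrightarrow> 0) at_top"
  proof -
    have "((\<lambda>\<theta>. \<Sum>\<tau>\<in>T. (mc_mean m \<theta> \<lfloor>\<theta> * \<tau>\<rfloor> / \<theta>) * (1 / \<delta>\<^sup>2) * inverse \<theta>) \<longlongrightarrow> (\<Sum>\<tau>\<in>T. (J \<tau> / pi) * (1 / \<delta>\<^sup>2) * 0)) at_top"
      by (intro tendsto_sum tendsto_mult mc_mean_tendsto_J tendsto_const tendsto_inverse_0_at_top filterlim_ident)
    then show ?thesis by (simp add: bnd_def[abs_def] field_simps power2_eq_square)
  qed
  have "\<forall>\<^sub>F \<theta> in at_top. \<forall>\<tau>\<in>T. \<bar>mc_mean m \<theta> \<lfloor>\<theta> * \<tau>\<rfloor> / \<theta> - J \<tau> / pi\<bar> < \<delta>"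
    using tendstoD[OF mc_mean_tendsto_J \<delta>] T(1) by (intro eventually_ball_finite) (auto simp: dist_real_def)
  moreover have "\<forall>\<^sub>F \<theta>::real in at_top. 1 / \<delta> \<le> \<theta>" by (rule eventually_ge_at_top)
  moreover have "\<forall>\<^sub>F \<theta>::real in at_top. 0 < \<theta>" by (rule eventually_gt_at_top)
  ultimately have "\<forall>\<^sub>F \<theta> in at_top. \<P>(p in multicritical_measure m \<theta>.
        (SUP x::real. ereal \<bar>profile \<theta> p x - limit_profile m x\<bar>) > ereal \<epsilon>) \<le> bnd \<theta>"
  proof eventually_elim
    case (elim \<theta>)
    let ?M = "multicritical_measure m \<theta>"
    let ?bad = "{p \<in> space ?M. (SUP x::real. ereal \<bar>profile \<theta> p x - limit_profile m x\<bar>) > ereal \<epsilon>}"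
    define B where "B \<tau> = {p. is_partition p \<and> \<delta> * \<theta> \<le> \<bar>real (card {k \<in> point_config p. real_of_int \<lfloor>\<theta> * \<tau>\<rfloor> < k}) - mc_mean m \<theta> \<lfloor>\<theta> * \<tau>\<rfloor>\<bar>}" for \<tau>
    have space: "space ?M = {p. is_partition p}" "sets ?M = Pow {p. is_partition p}"
      by (simp_all add: multicritical_measure_def)
    have th: "1 / \<theta> \<le> \<delta>" using elim \<delta> by (simp add: field_simps)
    have "?bad \<subseteq> (\<Union>\<tau>\<in>T. B \<tau>)"
    proof (rule subsetI, rule ccontr)
      fix p assume p: "p \<in> ?bad" and nB: "p \<notin> (\<Union>\<tau>\<in>T. B \<tau>)"
      have part: "is_partition p" using p by (simp add: space)
      have "\<bar>profile \<theta> p \<tau> - limit_profile m \<tau>\<bar> \<le> 6 * \<delta>" if \<tau>: "\<tau> \<in> T" for \<tau>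
      proof (rule profile_close_at_point)
        have "p \<notin> B \<tau>" using nB \<tau> by blast
        then show "\<bar>real (count_above p \<lfloor>\<theta> * \<tau>\<rfloor>) - mc_mean m \<theta> \<lfloor>\<theta> * \<tau>\<rfloor>\<bar> \<le> \<delta> * \<theta>"
          using part by (simp add: B_def card_point_config count_above_def)
        show "\<bar>mc_mean m \<theta> \<lfloor>\<theta> * \<tau>\<rfloor> / \<theta> - J \<tau> / pi\<bar> \<le> \<delta>" using elim(1) \<tau> by (simp add: less_imp_le)
        show "\<tau> \<in> {- b'..b}" using T(2) \<tau> by blast
      qed (fact elim(3), fact th)
      then have le: "\<bar>profile \<theta> p x - limit_profile m x\<bar> \<le> 6 * \<delta> + 2 * \<delta>" for x
        using \<delta> by (intro profile_uniformly_close[OF elim(3) part T(2,3,4) net]) auto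
      have "6 * \<delta> + 2 * \<delta> \<le> \<epsilon>" using \<epsilon> by (simp add: \<delta>_def)
      then have "ereal \<bar>profile \<theta> p x - limit_profile m x\<bar> \<le> ereal \<epsilon>" for x
        unfolding ereal_less_eq by (rule order.trans[OF le])
      then have "(SUP x::real. ereal \<bar>profile \<theta> p x - limit_profile m x\<bar>) \<le> ereal \<epsilon>" by (rule SUP_least)
      then show False using p by (simp add: not_less[symmetric])
    qed
    then have "emeasure ?M ?bad \<le> emeasure ?M (\<Union>\<tau>\<in>T. B \<tau>)"
      by (rule emeasure_mono) (auto simp: space B_def)
    also have "\<dots> \<le> (\<Sum>\<tau>\<in>T. emeasure ?M (B \<tau>))"
      by (rule emeasure_subadditive_finite[OF T(1)]) (auto simp: space B_def)
    also have "\<dots> \<le> (\<Sum>\<tau>\<in>T. ennreal (mc_mean m \<theta> \<lfloor>\<theta> * \<tau>\<rfloor> / (\<delta> * \<theta>)\<^sup>2))"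
      unfolding B_def by (intro sum_mono multicritical_deviation) (use \<delta> elim in simp)
    also have "\<dots> = ennreal (bnd \<theta>)"
      unfolding bnd_def by (rule sum_ennreal) (simp add: multicritical.mean_nonneg)
    finally have "emeasure ?M ?bad \<le> ennreal (bnd \<theta>)" .
    then show ?case
      unfolding measure_def by (rule enn2real_leI[rotated])
        (auto simp: bnd_def intro!: sum_nonneg multicritical.mean_nonneg divide_nonneg_nonneg)
  qed
  then show ?thesis
    by (rule tendsto_sandwich[OF always_eventually _ tendsto_const bnd, rotated]) simp
qed

end

theorem corollary6:
  fixes m :: nat
  assumes "1 \<le> m"
  shows "\<forall>\<epsilon>::real. 0 < \<epsilon> \<longrightarrow>
    ((\<lambda>\<theta>. \<P>(p in multicritical_measure m \<theta>.
              (SUP x::real. ereal \<bar>profile \<theta> p x - limit_profile m x\<bar>) > ereal \<epsilon>))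
      \<longlongrightarrow> 0) at_top"
proof -
  interpret multicritical_order m by unfold_locales (rule assms)
  show ?thesis using multicritical_limit_shape by blast
qed

end
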